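(* Let $p$ be a prime with $p\equiv 1\pmod 4$, and let $b_n=\sum_{k=0}^{[n/3]}\binom{2k}k\binom{3k}k\binom n{3k}\binom{n+k}k(-3)^{n-3k}$ for $n\ge0$ (the Almkvist–Zudilin numbers). Then $$\sum_{n=0}^{p-1}\frac{b_n}{(-3)^n}\equiv \sum_{n=0}^{p-1}\frac{b_n}{(-27)^n}\equiv\begin{cases}4x^2-2p\pmod{p^2}&\text{if }p\equiv1\pmod{12}\text{ and }p=x^2+9y^2,\\ 2p-2x^2\pmod{p^2}&\text{if }p\equiv 5\pmod{12}\text{ and }2p=x^2+9y^2,\end{cases}$$ where $x,y$ are integers.
   Context: $[x]$ denotes the greatest integer not exceeding $x$. Congruences are taken in the ring $\mathbb Z_p$ of rational numbers whose denominators are not divisible by $p$. For $p\equiv1\pmod{12}$ one has $p=x^2+9y^2$ with integers $x,y$, and for $p\equiv 5\pmod{12}$ one has $2p=x^2+9y^2$ with integers $x,y$. *)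

theory Defs
  imports Complex_Main "HOL-Number_Theory.Cong"
begin

definition Z_ring :: "nat \<Rightarrow> rat set" where
  "Z_ring p = {r. \<not> int p dvd snd (quotient_of r)}"
  (* quotient_of yields the fraction in lowest terms, so its second component is the denominator *)

definition cong_Z :: "nat \<Rightarrow> rat \<Rightarrow> rat \<Rightarrow> nat \<Rightarrow> bool" where
  "cong_Z p a b m \<longleftrightarrow>
     a \<in> Z_ring p \<and> b \<in> Z_ring p \<and> (\<exists>c\<in>Z_ring p. a - b = of_nat m * c)"

definition almkvist_zudilin :: "nat \<Rightarrow> int" where
  "almkvist_zudilin n =
     (\<Sum>k=0..n div 3. int ((2 * k) choose k) * int ((3 * k) choose k) *
        int (n choose (3 * k)) * int ((n + k) choose k) * (-3) ^ (n - 3 * k))"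

end

theory Submission
  imports Defs "HOL-Number_Theory.Number_Theory"
begin

text \<open>
  Both sums in the numbers \<open>b\<^sub>n\<close> can be summed over \<open>n\<close> in closed form, because
  \<open>b\<^sub>n = (\<Sum>k. (n+3k)! / (k!^4 (n-k)!) (-27)^(n-k))\<close> in addition to the defining formula, the two
  expressions satisfying the same three-term recurrence. Each sum becomes \<open>\<Sum>k<p\<close> of a term with
  denominator \<open>4k+1\<close> and a factor \<open>p\<close>; for \<open>p = 4m+1\<close> only \<open>k = m\<close> has a vanishing denominator
  modulo \<open>p\<close>. The remaining terms are needed modulo \<open>p\<close> only, where
  \<open>(3k)!/(k!^3 27^k) \<equiv> (-1)^k C(n,k) C(n+k,k)\<close> with \<open>n = p div 3\<close>, and the resulting sum is a
  partial fraction expansion. Together with a congruence of Lerch type for the Fermat quotient of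
  3, both sums are \<open>\<equiv> 3^(pm) (3m)!/m!^3 (mod p^2)\<close>.

  Let \<open>\<chi>\<close> be the quartic character modulo \<open>p\<close> with \<open>\<chi> x \<equiv> x^(3m)\<close>, where \<open>\<i>\<close> corresponds to a square
  root \<open>\<iota>\<close> of \<open>-1\<close> modulo \<open>p^2\<close>, and let \<open>J = A + B \<i>\<close> be the Jacobi sum of \<open>\<chi>\<close> and \<open>\<chi>^2\<close>. Replacing \<open>x\<close> by
  \<open>x^p\<close> lifts these congruences to \<open>p^2\<close>; expanding then shows that both sums are
  \<open>\<equiv> (-3)^(pm) (A + B \<iota>)^2\<close>, where the first factor is a fourth root of unity corresponding to
  \<open>\<chi> (-3)^3\<close>. Now \<open>A^2 + B^2 = p\<close> makes \<open>(A + B \<iota>)^2\<close> congruent to both \<open>2 (A^2 - B^2)\<close> and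
  \<open>4 A B \<iota>\<close>, while \<open>J^2 \<equiv> \<chi> (-3) (mod 3)\<close> fixes the root of unity. The uniqueness of representations
  of \<open>p\<close> as a sum of two squares identifies \<open>A\<close>, \<open>B\<close> in terms of \<open>x\<close>, \<open>y\<close>.
\<close>

section \<open>Two formulas for the Almkvist--Zudilin numbers\<close>

text \<open>Dividing by (-3)^n or (-27)^n makes the power in one of the two formulas independent of
  n, so that the inner sum over n becomes a hockey-stick sum; this is why a second formula is
  required. The results differ only by exchanging p + i and p - i, which is invisible at the
  precision needed. The term k = m alone is not the answer: the other terms add
  \<open>az_ratio m\<close> times a multiple of p, and exactly the factor 3^((p-1)(m+1)), with m + 1
  = 3/4 modulo p, absorbs it.

  In the second half the obstacle is the modulus p^2. The map x -> x^p lifts residues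
  multiplicatively, but 1 - x^p need not be the lift of 1 - x. A Newton step for square roots of 1
  repairs this, since \<open>\<chi>\<close>^2 only takes the values 0, 1, -1; it is the origin of
  the binomial coefficient C(6m,m). The value of \<open>\<chi>\<close> at -3 would follow from
  quartic reciprocity; instead it is read off J^2 modulo 3, because the product of the Jacobi sums
  for (\<open>\<chi>\<close>, \<open>\<chi>\<close>) and (\<open>\<chi>\<close>,
  \<open>\<chi>\<close>^2) is a cyclically symmetric sum in three variables.\<close>

text \<open>Reciprocals of factorials vanish at negative arguments, so that the sums over \<open>k\<close> below may
  run over any sufficiently long range.\<close>

definition recip_fact :: "int \<Rightarrow> rat" where
  "recip_fact j = (if j < 0 then 0 else 1 / fact (nat j))"

lemma recip_fact_neg [simp]: "j < 0 \<Longrightarrow> recip_fact j = 0"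
  by (simp add: recip_fact_def)

lemma recip_fact_of_nat [simp]: "recip_fact (int n) = 1 / fact n"
  by (simp add: recip_fact_def)

text \<open>The functional equation of 1/Gamma, valid also for \<open>j \<le> 0\<close>, where both
  sides vanish. Shifts of the argument therefore become polynomial factors, with no case distinction
  at the ends of the supports.\<close>

lemma recip_fact_minus_one: "recip_fact (j - 1) = of_int j * recip_fact j"
proof (cases "j \<le> 0")
  case True
  then show ?thesis by (cases "j = 0") auto
next
  case False
  then obtain i where i: "j = int (Suc i)"
    by (metis gr0_implies_Suc not_le zero_less_imp_eq_int)
  then have "j - 1 = int i" by simp
  then show ?thesis
    by (simp only: i recip_fact_of_nat) (simp del: of_nat_Suc)
qed

text \<open>The four binomials of \<open>almkvist_zudilin\<close> multiply to (n+k)!/(k!^4 (n-3k)!).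
  Integer exponents keep the ratio of neighbouring terms uniform, also where
  \<open>n < 3 * k\<close> and the term is 0.\<close>

definition az_term1 :: "nat \<Rightarrow> nat \<Rightarrow> rat" where
  "az_term1 n k = fact (n + k) / fact k ^ 4 * recip_fact (int n - 3 * int k)
     * (-3) powi (int n - 3 * int k)"

definition az_term2 :: "nat \<Rightarrow> nat \<Rightarrow> rat" where
  "az_term2 n k = fact (n + 3 * k) / fact k ^ 4 * recip_fact (int n - int k)
     * (-27) powi (int n - int k)"

text \<open>With n = m + 1 the coefficients are (n+1)^3, (2n+1)(7n^2+7n+3) and 81 n^3, those of the
  classical Almkvist--Zudilin recurrence.\<close>

definition az_recurrence :: "(nat \<Rightarrow> rat) \<Rightarrow> nat \<Rightarrow> rat" where
  "az_recurrence b m = of_nat (m + 2) ^ 3 * b (m + 2)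
     + of_nat (2 * m + 3) * of_nat (7 * (m + 1) ^ 2 + 7 * (m + 1) + 3) * b (m + 1)
     + 81 * of_nat (m + 1) ^ 3 * b m"

lemma az_recurrence_sum:
  "az_recurrence (\<lambda>n. \<Sum>k\<in>A. f n k) m = (\<Sum>k\<in>A. az_recurrence (\<lambda>n. f n k) m)"
  by (simp add: az_recurrence_def sum.distrib sum_distrib_left)

text \<open>Certificates from Zeilberger's algorithm for the recurrence.\<close>

definition az_cert1 :: "nat \<Rightarrow> nat \<Rightarrow> rat" where
  "az_cert1 m k = 108 * of_nat (4 * m + 5) * of_nat k ^ 4 * (fact (m + k) / fact k ^ 4)
     * recip_fact (int m + 2 - 3 * int k) * (-3) powi (int m + 1 - 3 * int k)"

definition az_cert2 :: "nat \<Rightarrow> nat \<Rightarrow> rat" where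
  "az_cert2 m k = 108 * of_nat (4 * m + 7) * of_nat k ^ 4 * (fact (m + 3 * k) / fact k ^ 4)
     * recip_fact (int m + 2 - int k) * (-27) powi (int m + 1 - int k)"

lemma az_term1_telescope:
  "az_recurrence (\<lambda>n. az_term1 n k) m = az_cert1 m (Suc k) - az_cert1 m k"
proof -
  \<comment> \<open>All reciprocal factorials are expressed through the one with the largest
    argument, hence by multiplication only. Every term is then a polynomial in \<open>x\<close>,
    \<open>y\<close> times the common quantity \<open>Q\<close>, and the claim becomes a polynomial
    identity.\<close>
  define X where "X = recip_fact (int m + 2 - 3 * int k)"
  define W :: rat where "W = (-3) powi (int m + 1 - 3 * int k)"
  define F :: rat where "F = fact (m + k)"
  define D :: rat where "D = fact k"
  define x :: rat where "x = of_nat m"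
  define y :: rat where "y = of_nat k"
  have D: "D \<noteq> 0" by (simp add: D_def)
  have y1: "y + 1 \<noteq> 0" by (simp add: y_def flip: of_nat_Suc)
  have X1: "recip_fact (int m + 1 - 3 * int k) = (x + 2 - 3 * y) * X"
    using recip_fact_minus_one[of "int m + 2 - 3 * int k"] by (simp add: X_def x_def y_def algebra_simps)
  have X0: "recip_fact (int m - 3 * int k) = (x + 1 - 3 * y) * ((x + 2 - 3 * y) * X)"
    using recip_fact_minus_one[of "int m + 1 - 3 * int k"] unfolding X1
    by (simp add: x_def y_def)
  have Xm: "recip_fact (int m - 3 * int k - 1) = (x - 3 * y) * ((x + 1 - 3 * y) * ((x + 2 - 3 * y) * X))"
    using recip_fact_minus_one[of "int m - 3 * int k"] unfolding X0
    by (simp add: x_def y_def)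
  have W2: "(-3) powi (int m + 2 - 3 * int k) = (-3) * W"
    using power_int_add_1'[of "-3 :: rat" "int m + 1 - 3 * int k"] by (simp add: W_def algebra_simps)
  have W0: "(-3) powi (int m - 3 * int k) = W / (-3)"
    using power_int_diff[of "-3 :: rat" "int m + 1 - 3 * int k" 1] by (simp add: W_def algebra_simps)
  have Wm: "(-3) powi (int m + 1 - 3 * int (Suc k)) = W / (-27)"
    using power_int_diff[of "-3 :: rat" "int m + 1 - 3 * int k" 3] by (simp add: W_def algebra_simps)
  have F1: "fact (m + 1 + k) = (x + y + 1) * F" "fact (m + Suc k) = (x + y + 1) * F"
    by (simp_all add: F_def x_def y_def algebra_simps)
  have F2: "fact (m + 2 + k) = (x + y + 2) * ((x + y + 1) * F)"
  proof -
    have "m + 3 * Suc k = Suc (Suc (Suc (m + 3 * k)))" by simp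
    then show ?thesis by (simp only: fact_Suc F_def) (simp add: x_def y_def algebra_simps)
  qed
  have D1: "fact (Suc k) = (y + 1) * D"
    by (simp add: D_def y_def algebra_simps)
  have i1: "int (m + 1) = int m + 1" by simp
  have i2: "int (m + 2) = int m + 2" by simp
  have e0: "az_term1 m k = F / D ^ 4 * ((x + 1 - 3 * y) * ((x + 2 - 3 * y) * X)) * (W / (-3))"
    unfolding az_term1_def X0 W0 by (simp add: F_def D_def)
  have e1: "az_term1 (m + 1) k = (x + y + 1) * F / D ^ 4 * ((x + 2 - 3 * y) * X) * W"
    unfolding az_term1_def F1 i1 X1 by (simp add: D_def W_def)
  have e2: "az_term1 (m + 2) k = (x + y + 2) * ((x + y + 1) * F) / D ^ 4 * X * ((-3) * W)"
    unfolding az_term1_def F2 i2 W2 by (simp add: D_def X_def)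
  have c0: "az_cert1 m k = 108 * (4 * x + 5) * y ^ 4 * (F / D ^ 4) * X * W"
    by (simp add: az_cert1_def x_def y_def F_def D_def X_def W_def)
  have i3: "int m + 2 - 3 * int (Suc k) = int m - 3 * int k - 1" by simp
  have c1: "az_cert1 m (Suc k) = 108 * (4 * x + 5) * (y + 1) ^ 4 * ((x + y + 1) * F / ((y + 1) * D) ^ 4)
      * ((x - 3 * y) * ((x + 1 - 3 * y) * ((x + 2 - 3 * y) * X))) * (W / (-27))"
    unfolding az_cert1_def D1 F1 Wm i3 Xm by (simp add: x_def y_def add.commute)
  have c1': "az_cert1 m (Suc k) = 108 * (4 * x + 5) * ((x + y + 1) * F / D ^ 4)
      * ((x - 3 * y) * ((x + 1 - 3 * y) * ((x + 2 - 3 * y) * X))) * (W / (-27))"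
    unfolding c1 using y1 by (simp add: power_mult_distrib)
  have n1: "of_nat (m + 2) = x + 2" and n2: "of_nat (2 * m + 3) = 2 * x + 3"
    and n3: "of_nat (7 * (m + 1)\<^sup>2 + 7 * (m + 1) + 3) = 7 * (x + 1)\<^sup>2 + 7 * (x + 1) + 3"
    and n4: "of_nat (m + 1) = x + 1"
    by (simp_all add: x_def add.commute)
  define Q where "Q = F / D ^ 4 * X * W"
  have q0: "az_term1 m k = - (1 / 3) * ((x + 1 - 3 * y) * (x + 2 - 3 * y)) * Q"
    unfolding e0 Q_def by (simp add: mult_ac)
  have q1: "az_term1 (m + 1) k = (x + y + 1) * (x + 2 - 3 * y) * Q"
    unfolding e1 Q_def by simp
  have q2: "az_term1 (m + 2) k = - 3 * ((x + y + 2) * (x + y + 1)) * Q"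
    unfolding e2 Q_def by simp
  have r0: "az_cert1 m k = 108 * (4 * x + 5) * y ^ 4 * Q"
    unfolding c0 Q_def by simp
  have r1: "az_cert1 m (Suc k) = - 4 * (4 * x + 5) * ((x + y + 1) * (x - 3 * y) * (x + 1 - 3 * y) * (x + 2 - 3 * y)) * Q"
    unfolding c1' Q_def using D by (simp add: field_simps)
  have "az_recurrence (\<lambda>n. az_term1 n k) m =
      ((x + 2) ^ 3 * ((x + y + 2) * (x + y + 1)) * (-3)
       + (2 * x + 3) * (7 * (x + 1)\<^sup>2 + 7 * (x + 1) + 3) * (x + y + 1) * (x + 2 - 3 * y)
       - 27 * (x + 1) ^ 3 * (x + 1 - 3 * y) * (x + 2 - 3 * y)) * Q"
    unfolding az_recurrence_def q0 q1 q2 n1 n2 n3 n4 by (simp add: algebra_simps)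
  also have "\<dots> = (- 4 * (4 * x + 5) * ((x + y + 1) * (x - 3 * y) * (x + 1 - 3 * y) * (x + 2 - 3 * y)) - 108 * (4 * x + 5) * y ^ 4) * Q"
    by (rule arg_cong[where f = "\<lambda>z. z * Q"]) (simp add: algebra_simps power2_eq_square power3_eq_cube power4_eq_xxxx)
  also have "\<dots> = az_cert1 m (Suc k) - az_cert1 m k"
    unfolding r0 r1 by (simp only: left_diff_distrib)
  finally show ?thesis .
qed

lemma az_term2_telescope:
  "az_recurrence (\<lambda>n. az_term2 n k) m = az_cert2 m (Suc k) - az_cert2 m k"
proof -
  define X where "X = recip_fact (int m + 2 - int k)"
  define W :: rat where "W = (-27) powi (int m + 1 - int k)"
  define F :: rat where "F = fact (m + 3 * k)"
  define D :: rat where "D = fact k"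
  define x :: rat where "x = of_nat m"
  define y :: rat where "y = of_nat k"
  have D: "D \<noteq> 0" by (simp add: D_def)
  have y1: "y + 1 \<noteq> 0" by (simp add: y_def flip: of_nat_Suc)
  have X1: "recip_fact (int m + 1 - int k) = (x + 2 - y) * X"
    using recip_fact_minus_one[of "int m + 2 - int k"] by (simp add: X_def x_def y_def algebra_simps)
  have X0: "recip_fact (int m - int k) = (x + 1 - y) * ((x + 2 - y) * X)"
    using recip_fact_minus_one[of "int m + 1 - int k"] unfolding X1
    by (simp add: x_def y_def)
  have W2: "(-27) powi (int m + 2 - int k) = (-27) * W"
    using power_int_add_1'[of "-27 :: rat" "int m + 1 - int k"] by (simp add: W_def algebra_simps)
  have W0: "(-27) powi (int m - int k) = W / (-27)"
    using power_int_diff[of "-27 :: rat" "int m + 1 - int k" 1] by (simp add: W_def algebra_simps)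
  have F1: "fact (m + 1 + 3 * k) = (x + 3 * y + 1) * F"
    by (simp add: F_def x_def y_def algebra_simps)
  have F2: "fact (m + 2 + 3 * k) = (x + 3 * y + 2) * ((x + 3 * y + 1) * F)"
    by (simp add: F_def x_def y_def algebra_simps numeral_2_eq_2)
  have F3: "fact (m + 3 * Suc k) = (x + 3 * y + 3) * ((x + 3 * y + 2) * ((x + 3 * y + 1) * F))"
  proof -
    have "m + 3 * Suc k = Suc (Suc (Suc (m + 3 * k)))" by simp
    then show ?thesis by (simp only: fact_Suc F_def) (simp add: x_def y_def algebra_simps)
  qed
  have D1: "fact (Suc k) = (y + 1) * D"
    by (simp add: D_def y_def algebra_simps)
  have i1: "int (m + 1) = int m + 1" by simp
  have i2: "int (m + 2) = int m + 2" by simp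
  have e0: "az_term2 m k = F / D ^ 4 * ((x + 1 - y) * ((x + 2 - y) * X)) * (W / (-27))"
    unfolding az_term2_def X0 W0 by (simp add: F_def D_def)
  have e1: "az_term2 (m + 1) k = (x + 3 * y + 1) * F / D ^ 4 * ((x + 2 - y) * X) * W"
    unfolding az_term2_def F1 i1 X1 by (simp add: D_def W_def)
  have e2: "az_term2 (m + 2) k = (x + 3 * y + 2) * ((x + 3 * y + 1) * F) / D ^ 4 * X * ((-27) * W)"
    unfolding az_term2_def F2 i2 W2 by (simp add: D_def X_def)
  have c0: "az_cert2 m k = 108 * (4 * x + 7) * y ^ 4 * (F / D ^ 4) * X * W"
    by (simp add: az_cert2_def x_def y_def F_def D_def X_def W_def)
  have i3: "int m + 2 - int (Suc k) = int m + 1 - int k"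
    and i4: "int m + 1 - int (Suc k) = int m - int k" by simp_all
  have c1: "az_cert2 m (Suc k) = 108 * (4 * x + 7) * (y + 1) ^ 4
      * ((x + 3 * y + 3) * ((x + 3 * y + 2) * ((x + 3 * y + 1) * F)) / ((y + 1) * D) ^ 4)
      * ((x + 2 - y) * X) * (W / (-27))"
    unfolding az_cert2_def D1 F3 i3 i4 X1 W0 by (simp add: x_def y_def add.commute)
  have c1': "az_cert2 m (Suc k) = 108 * (4 * x + 7)
      * ((x + 3 * y + 3) * ((x + 3 * y + 2) * ((x + 3 * y + 1) * F)) / D ^ 4)
      * ((x + 2 - y) * X) * (W / (-27))"
    unfolding c1 using y1 by (simp add: power_mult_distrib)
  have n1: "of_nat (m + 2) = x + 2" and n2: "of_nat (2 * m + 3) = 2 * x + 3"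
    and n3: "of_nat (7 * (m + 1)\<^sup>2 + 7 * (m + 1) + 3) = 7 * (x + 1)\<^sup>2 + 7 * (x + 1) + 3"
    and n4: "of_nat (m + 1) = x + 1"
    by (simp_all add: x_def add.commute)
  define Q where "Q = F / D ^ 4 * X * W"
  have q0: "az_term2 m k = - (1 / 27) * ((x + 1 - y) * (x + 2 - y)) * Q"
    unfolding e0 Q_def by (simp add: mult_ac)
  have q1: "az_term2 (m + 1) k = (x + 3 * y + 1) * (x + 2 - y) * Q"
    unfolding e1 Q_def by simp
  have q2: "az_term2 (m + 2) k = - 27 * ((x + 3 * y + 2) * (x + 3 * y + 1)) * Q"
    unfolding e2 Q_def by simp
  have r0: "az_cert2 m k = 108 * (4 * x + 7) * y ^ 4 * Q"
    unfolding c0 Q_def by simp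
  have r1: "az_cert2 m (Suc k) = - 4 * (4 * x + 7) * ((x + 3 * y + 1) * (x + 3 * y + 2) * (x + 3 * y + 3) * (x + 2 - y)) * Q"
    unfolding c1' Q_def using D by (simp add: field_simps)
  have "az_recurrence (\<lambda>n. az_term2 n k) m =
      ((x + 2) ^ 3 * ((x + 3 * y + 2) * (x + 3 * y + 1)) * (-27)
       + (2 * x + 3) * (7 * (x + 1)\<^sup>2 + 7 * (x + 1) + 3) * (x + 3 * y + 1) * (x + 2 - y)
       - 3 * (x + 1) ^ 3 * (x + 1 - y) * (x + 2 - y)) * Q"
    unfolding az_recurrence_def q0 q1 q2 n1 n2 n3 n4 by (simp add: algebra_simps)
  also have "\<dots> = (- 4 * (4 * x + 7) * ((x + 3 * y + 1) * (x + 3 * y + 2) * (x + 3 * y + 3) * (x + 2 - y)) - 108 * (4 * x + 7) * y ^ 4) * Q"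
    by (rule arg_cong[where f = "\<lambda>z. z * Q"]) (simp add: algebra_simps power2_eq_square power3_eq_cube power4_eq_xxxx)
  also have "\<dots> = az_cert2 m (Suc k) - az_cert2 m k"
    unfolding r0 r1 by (simp only: left_diff_distrib)
  finally show ?thesis .
qed

text \<open>A bound \<open>K\<close> independent of \<open>n\<close> lets the recurrence act on the
  summands. Both sums satisfy it, its leading coefficient (m+2)^3 is nonzero, and the initial values
  agree: 1 for n = 0, and -3 = -27 + 24 for n = 1.\<close>

lemma az_sums_agree:
  assumes "n \<le> K"
  shows "(\<Sum>k<K+1. az_term1 n k) = (\<Sum>k<K+1. az_term2 n k)"
  using assms
proof (induction n rule: less_induct)
  case (less n)
  define b1 where "b1 n = (\<Sum>k<K+1. az_term1 n k)" for n
  define b2 where "b2 n = (\<Sum>k<K+1. az_term2 n k)" for n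
  consider "n = 0" | "n = 1" | m where "n = m + 2"
    by (metis One_nat_def add_2_eq_Suc' not0_implies_Suc)
  then show ?case
  proof cases
    case 1
    have "az_term1 0 k = (if k = 0 then 1 else 0)" "az_term2 0 k = (if k = 0 then 1 else 0)" for k
      by (auto simp: az_term1_def az_term2_def recip_fact_def)
    then show ?thesis by (simp add: 1)
  next
    case 2
    have a: "az_term1 (Suc 0) k = (if k = 0 then -3 else 0)"
      and "az_term2 (Suc 0) k = (if k = 0 then -27 else if k = 1 then 24 else 0)" for k
      by (auto simp: az_term1_def az_term2_def recip_fact_def fact_numeral)
    then have "az_term2 (Suc 0) k = (if k = 0 then -27 else 0) + (if k = 1 then 24 else 0)" for k
      by simp
    then show ?thesis using less.prems by (simp add: 2 a sum.distrib del: sum.lessThan_Suc)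
  next
    case 3
    have "az_recurrence b1 m = az_cert1 m (K + 1) - az_cert1 m 0"
      unfolding b1_def az_recurrence_sum az_term1_telescope by (rule sum_lessThan_telescope)
    \<comment> \<open>The certificate vanishes at \<open>0\<close> by its factor k^4, and at
      \<open>K + 1\<close> because \<open>m + 2 \<le> K\<close> makes the argument of
      \<open>recip_fact\<close> negative.\<close>
    also have "\<dots> = 0"
      using less.prems 3 by (simp add: az_cert1_def)
    finally have r1: "az_recurrence b1 m = 0" .
    have "az_recurrence b2 m = az_cert2 m (K + 1) - az_cert2 m 0"
      unfolding b2_def az_recurrence_sum az_term2_telescope by (rule sum_lessThan_telescope)
    also have "\<dots> = 0"
      using less.prems 3 by (simp add: az_cert2_def)
    finally have r2: "az_recurrence b2 m = 0" .
    have e: "b1 m = b2 m" "b1 (m + 1) = b2 (m + 1)"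
      using less.IH[of m] less.IH[of "m + 1"] less.prems 3 by (simp_all add: b1_def b2_def)
    have "of_nat (m + 2) ^ 3 * b1 (m + 2) = of_nat (m + 2) ^ 3 * b2 (m + 2)"
      using r1 r2 unfolding az_recurrence_def e by linarith
    moreover have "(of_nat (m + 2) :: rat) ^ 3 \<noteq> 0"
      by (simp only: power_eq_0_iff of_nat_eq_0_iff) simp
    ultimately have "b1 (m + 2) = b2 (m + 2)"
      by (metis mult_left_cancel)
    then show ?thesis by (simp only: 3 b1_def b2_def)
  qed
qed

text \<open>The reduced denominator divides every denominator, so closure properties can be checked
  on arbitrary fractions.\<close>

lemma Z_ring_iff:
  "r \<in> Z_ring p \<longleftrightarrow> (\<exists>a b. \<not> int p dvd b \<and> r = of_int a / of_int b)"
proof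
  assume "r \<in> Z_ring p"
  moreover have "r = of_int (fst (quotient_of r)) / of_int (snd (quotient_of r))"
    by (rule quotient_of_div) simp
  ultimately show "\<exists>a b. \<not> int p dvd b \<and> r = of_int a / of_int b"
    unfolding Z_ring_def by blast
next
  assume "\<exists>a b. \<not> int p dvd b \<and> r = of_int a / of_int b"
  then obtain a b where ab: "\<not> int p dvd b" "r = of_int a / of_int b" by blast
  obtain c d where cd: "quotient_of r = (c, d)" by force
  have "d > 0" "coprime c d" "r = of_int c / of_int d"
    using cd quotient_of_denom_pos quotient_of_coprime quotient_of_div by auto
  moreover have "b \<noteq> 0" using ab by auto
  ultimately have "of_int a * of_int d = (of_int c * of_int b :: rat)"
    using ab by (simp add: field_simps)
  then have "a * d = c * b"
    by (metis of_int_eq_iff of_int_mult)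
  then have "d dvd b"
    using \<open>coprime c d\<close> by (metis coprime_commute coprime_dvd_mult_right_iff dvd_triv_right)
  then show "r \<in> Z_ring p"
    using ab(1) cd by (auto simp: Z_ring_def)
qed

section \<open>Congruences between p-integral rationals\<close>

locale p_integral =
  fixes p :: nat
  assumes prime_p: "prime p"
begin

abbreviation R :: "rat set" where "R \<equiv> Z_ring p"

lemma prime_int_p: "prime (int p)"
  using prime_p by simp

lemma R_frac: "\<not> int p dvd b \<Longrightarrow> of_int a / of_int b \<in> R"
  unfolding Z_ring_iff by blast

lemma R_of_int [simp, intro]: "of_int a \<in> R"
proof -
  have "\<not> int p dvd 1" using prime_int_p not_prime_unit by blast
  from R_frac[OF this, of a] show ?thesis by simp
qed

lemma R_of_nat [simp, intro]: "of_nat a \<in> R"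
  using R_of_int[of "int a"] by simp

lemma R_numeral [simp, intro]: "numeral a \<in> R"
  using R_of_int[of "numeral a"] by simp

lemma R_0 [simp, intro]: "0 \<in> R" and R_1 [simp, intro]: "1 \<in> R"
  using R_of_int[of 0] R_of_int[of 1] by simp_all

lemma R_add [simp, intro]: assumes "x \<in> R" "y \<in> R" shows "x + y \<in> R"
proof -
  obtain a b c d where ab: "\<not> int p dvd b" "x = of_int a / of_int b"
    and cd: "\<not> int p dvd d" "y = of_int c / of_int d"
    using assms unfolding Z_ring_iff by blast
  have "b \<noteq> 0" "d \<noteq> 0" using ab cd by auto
  then have "x + y = of_int (a * d + c * b) / of_int (b * d)"
    using ab cd by (simp add: field_simps)
  moreover have "\<not> int p dvd b * d"
    using ab cd prime_int_p prime_dvd_multD by blast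
  ultimately show ?thesis by (metis R_frac)
qed

lemma R_mult [simp, intro]: assumes "x \<in> R" "y \<in> R" shows "x * y \<in> R"
proof -
  obtain a b c d where ab: "\<not> int p dvd b" "x = of_int a / of_int b"
    and cd: "\<not> int p dvd d" "y = of_int c / of_int d"
    using assms unfolding Z_ring_iff by blast
  have "x * y = of_int (a * c) / of_int (b * d)"
    using ab cd by simp
  moreover have "\<not> int p dvd b * d"
    using ab cd prime_int_p prime_dvd_multD by blast
  ultimately show ?thesis by (metis R_frac)
qed

lemma R_uminus [simp, intro]: "x \<in> R \<Longrightarrow> - x \<in> R"
  using R_mult[of "-1" x] R_of_int[of "-1"] by simp

lemma R_diff [simp, intro]: "x \<in> R \<Longrightarrow> y \<in> R \<Longrightarrow> x - y \<in> R"
  using R_add[of x "- y"] by simp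

lemma R_power [simp, intro]: "x \<in> R \<Longrightarrow> x ^ n \<in> R"
  by (induction n) auto

lemma R_sum [simp, intro]: "(\<And>i. i \<in> A \<Longrightarrow> f i \<in> R) \<Longrightarrow> sum f A \<in> R"
  by (induction A rule: infinite_finite_induct) auto

lemma R_prod [simp, intro]: "(\<And>i. i \<in> A \<Longrightarrow> f i \<in> R) \<Longrightarrow> prod f A \<in> R"
  by (induction A rule: infinite_finite_induct) auto

definition runit :: "rat \<Rightarrow> bool" where
  "runit x \<longleftrightarrow> x \<in> R \<and> inverse x \<in> R \<and> x \<noteq> 0"

lemma runit_of_int: "\<not> int p dvd a \<Longrightarrow> runit (of_int a)"
  using R_frac[of a 1] by (auto simp: runit_def field_simps)

lemma runit_of_nat: "\<not> p dvd a \<Longrightarrow> runit (of_nat a)"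
  using runit_of_int[of "int a"] by simp

lemma runit_less: "0 < a \<Longrightarrow> a < p \<Longrightarrow> runit (of_nat a)"
  by (intro runit_of_nat) (auto dest: dvd_imp_le)

lemma runit_R: "runit x \<Longrightarrow> x \<in> R" and runit_inverse_R: "runit x \<Longrightarrow> inverse x \<in> R"
  and runit_nz: "runit x \<Longrightarrow> x \<noteq> 0"
  by (auto simp: runit_def)

lemma runit_mult: "runit x \<Longrightarrow> runit y \<Longrightarrow> runit (x * y)"
  by (auto simp: runit_def)

lemma runit_inverse: "runit x \<Longrightarrow> runit (inverse x)"
  by (auto simp: runit_def)

lemma runit_uminus: "runit x \<Longrightarrow> runit (- x)"
  by (auto simp: runit_def)

lemma runit_divide: "runit x \<Longrightarrow> runit y \<Longrightarrow> runit (x / y)"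
  by (simp add: divide_inverse runit_mult runit_inverse)

lemma runit_1: "runit 1"
  by (simp add: runit_def)

lemma runit_power: "runit x \<Longrightarrow> runit (x ^ n)"
  by (induction n) (auto simp: runit_1 runit_mult)

lemma runit_prod: "(\<And>i. i \<in> A \<Longrightarrow> runit (f i)) \<Longrightarrow> runit (prod f A)"
  by (induction A rule: infinite_finite_induct) (auto simp: runit_1 runit_mult)

lemma runit_fact: "n < p \<Longrightarrow> runit (fact n)"
  using runit_of_nat[of "fact n"] prime_p by (simp add: prime_dvd_fact_iff)

lemma R_divide [intro]: "x \<in> R \<Longrightarrow> runit y \<Longrightarrow> x / y \<in> R"
  by (simp add: divide_inverse runit_inverse_R)

text \<open>Only the difference is required to be p-integral: chains of congruences can be built
  before membership in \<open>R\<close> is known, and \<open>zcong_R\<close> then transports it from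
  one end to the other.\<close>

definition zcong :: "nat \<Rightarrow> rat \<Rightarrow> rat \<Rightarrow> bool" where
  "zcong e x y \<longleftrightarrow> (\<exists>c\<in>R. x - y = of_nat p ^ e * c)"

lemma zcongI: "c \<in> R \<Longrightarrow> x - y = of_nat p ^ e * c \<Longrightarrow> zcong e x y"
  unfolding zcong_def by blast

lemma zcong_refl [simp]: "zcong e x x"
  by (rule zcongI[of 0]) auto

lemma zcong_sym: "zcong e x y \<Longrightarrow> zcong e y x"
  unfolding zcong_def by (metis R_uminus minus_diff_eq mult_minus_right)

lemma zcong_trans [trans]: assumes "zcong e x y" "zcong e y z" shows "zcong e x z"
proof -
  obtain c d where "c \<in> R" "x - y = of_nat p ^ e * c" "d \<in> R" "y - z = of_nat p ^ e * d"
    using assms unfolding zcong_def by blast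
  then show ?thesis
    by (intro zcongI[of "c + d"]) (auto simp: distrib_left)
qed

lemma zcong_add: assumes "zcong e x y" "zcong e x' y'" shows "zcong e (x + x') (y + y')"
proof -
  obtain c d where "c \<in> R" "x - y = of_nat p ^ e * c" "d \<in> R" "x' - y' = of_nat p ^ e * d"
    using assms unfolding zcong_def by blast
  then show ?thesis
    by (intro zcongI[of "c + d"]) (auto simp: distrib_left)
qed

lemma zcong_cmult: assumes "zcong e x y" "z \<in> R" shows "zcong e (z * x) (z * y)"
proof -
  obtain c where "c \<in> R" "x - y = of_nat p ^ e * c"
    using assms unfolding zcong_def by blast
  then show ?thesis
    using assms(2) by (intro zcongI[of "z * c"]) (auto simp: algebra_simps simp flip: right_diff_distrib)
qed

lemma zcong_minus: "zcong e x y \<Longrightarrow> zcong e (- x) (- y)"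
  using zcong_cmult[of e x y "-1"] R_of_int[of "-1"] by simp

lemma zcong_diff: "zcong e x y \<Longrightarrow> zcong e x' y' \<Longrightarrow> zcong e (x - x') (y - y')"
  using zcong_add[of e x y "- x'" "- y'"] zcong_minus by simp

lemma zcong_mult:
  assumes "zcong e x y" "zcong e x' y'" "x \<in> R" "y' \<in> R"
  shows "zcong e (x * x') (y * y')"
  using zcong_trans[OF zcong_cmult[OF assms(2,3)] zcong_cmult[OF assms(1,4), unfolded mult.commute[of y']]]
  by (simp add: mult.commute)

lemma zcong_sum: "(\<And>i. i \<in> A \<Longrightarrow> zcong e (f i) (g i)) \<Longrightarrow> zcong e (sum f A) (sum g A)"
  by (induction A rule: infinite_finite_induct) (auto intro: zcong_add)

lemma zcong_prod:
  "(\<And>i. i \<in> A \<Longrightarrow> zcong e (f i) (g i)) \<Longrightarrow> (\<And>i. i \<in> A \<Longrightarrow> f i \<in> R) \<Longrightarrow>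
   (\<And>i. i \<in> A \<Longrightarrow> g i \<in> R) \<Longrightarrow> zcong e (prod f A) (prod g A)"
  by (induction A rule: infinite_finite_induct) (auto intro!: zcong_mult)

lemma zcong_power: "zcong e x y \<Longrightarrow> x \<in> R \<Longrightarrow> y \<in> R \<Longrightarrow> zcong e (x ^ n) (y ^ n)"
  by (induction n) (auto intro!: zcong_mult)

lemma zcong_R: "zcong e x y \<Longrightarrow> y \<in> R \<Longrightarrow> x \<in> R"
  unfolding zcong_def by (metis R_add R_mult R_of_nat R_power diff_add_cancel)

lemma zcong_of_int: "[a = b] (mod int p ^ e) \<Longrightarrow> zcong e (of_int a) (of_int b)"
proof -
  assume "[a = b] (mod int p ^ e)"
  then obtain k where "a - b = int p ^ e * k"
    by (meson cong_iff_dvd_diff dvd_def)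
  then have "of_int (a - b) = (of_int (int p ^ e * k) :: rat)" by simp
  then show ?thesis
    by (intro zcongI[of "of_int k"]) auto
qed

lemma zcong_p_mult: "zcong e x y \<Longrightarrow> zcong (Suc e) (of_nat p * x) (of_nat p * y)"
  unfolding zcong_def by (metis mult.assoc power_Suc right_diff_distrib)

lemma zcong_cancel: "zcong e (z * x) (z * y) \<Longrightarrow> runit z \<Longrightarrow> zcong e x y"
  using zcong_cmult[of e "z * x" "z * y" "inverse z"]
  by (simp add: runit_inverse_R runit_nz flip: mult.assoc)

lemma zcong_divide:
  assumes "zcong e x y" "zcong e x' y'" "x \<in> R" "runit x'" "runit y'"
  shows "zcong e (x / x') (y / y')"
proof (rule zcong_cancel[of _ "x' * y'"])
  have "zcong e (x * y') (y * x')"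
    using assms by (intro zcong_mult) (auto intro: zcong_sym runit_R)
  then show "zcong e (x' * y' * (x / x')) (x' * y' * (y / y'))"
    using assms runit_nz by (simp add: mult_ac)
qed (use assms runit_mult in auto)

lemma zcong_mono: "zcong e x y \<Longrightarrow> d \<le> e \<Longrightarrow> zcong d x y"
proof -
  assume a: "zcong e x y" "d \<le> e"
  then obtain c where "c \<in> R" "x - y = of_nat p ^ e * c" unfolding zcong_def by blast
  then show ?thesis
    using a(2) by (intro zcongI[of "of_nat p ^ (e - d) * c"]) (auto simp flip: mult.assoc power_add)
qed

lemma zcong_zero_p: "c \<in> R \<Longrightarrow> zcong 1 (of_nat p * c) 0"
  by (rule zcongI) auto

lemma zcong_int_imp:
  assumes "zcong e (of_int a) (of_int b)"
  shows "[a = b] (mod int p ^ e)"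
proof -
  obtain c where c: "c \<in> R" "of_int a - of_int b = (of_nat p ^ e * c :: rat)"
    using assms unfolding zcong_def by blast
  then obtain u v where uv: "\<not> int p dvd v" "c = of_int u / of_int v"
    unfolding Z_ring_iff by blast
  then have "of_int ((a - b) * v) = (of_int (int p ^ e * u) :: rat)"
    using c by (cases "v = 0") (auto simp: field_simps)
  then have "(a - b) * v = int p ^ e * u" by (simp only: of_int_eq_iff)
  then have "int p ^ e dvd (a - b) * v" by simp
  moreover have "coprime (int p ^ e) v"
    using uv prime_int_p by (simp add: prime_imp_coprime)
  ultimately show ?thesis
    by (simp add: cong_iff_dvd_diff coprime_dvd_mult_left_iff)
qed

lemma cong_Z_iff: "cong_Z p x y (p ^ 2) \<longleftrightarrow> x \<in> R \<and> y \<in> R \<and> zcong 2 x y"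
  unfolding cong_Z_def zcong_def by simp

text \<open>First-order expansion modulo p^2; through it the comparisons of products below turn into
  statements on sums of reciprocals modulo p.\<close>

lemma zcong_prod_one_plus:
  assumes "finite A" "\<And>i. i \<in> A \<Longrightarrow> c i \<in> R"
  shows "zcong 2 (\<Prod>i\<in>A. 1 + of_nat p * c i) (1 + of_nat p * (\<Sum>i\<in>A. c i))"
  using assms
proof (induction A rule: finite_induct)
  case (insert x A)
  define S where "S = (\<Sum>i\<in>A. c i)"
  have S: "S \<in> R" "c x \<in> R" using insert.prems by (auto simp: S_def)
  have "zcong 2 ((1 + of_nat p * c x) * (\<Prod>i\<in>A. 1 + of_nat p * c i))
      ((1 + of_nat p * c x) * (1 + of_nat p * S))"
    unfolding S_def using insert by (intro zcong_cmult) auto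
  also have "zcong 2 \<dots> (1 + of_nat p * (c x + S))"
    using S by (intro zcongI[of "c x * S"]) (auto simp: algebra_simps power2_eq_square)
  finally show ?case using insert by (simp add: S_def)
qed simp

end

section \<open>Closed forms for the sums over n\<close>

lemma almkvist_zudilin_eq_sum_az_term1:
  assumes "n \<le> K"
  shows "of_int (almkvist_zudilin n) = (\<Sum>k<K+1. az_term1 n k)"
proof -
  have "of_int (almkvist_zudilin n) = (\<Sum>k=0..n div 3. az_term1 n k)"
    unfolding almkvist_zudilin_def of_int_sum
  proof (rule sum.cong[OF refl])
    fix k assume "k \<in> {0..n div 3}"
    then have k: "3 * k \<le> n" by auto
    have "recip_fact (int n - 3 * int k) = 1 / fact (n - 3 * k)"
      using recip_fact_of_nat[of "n - 3 * k"] k by (simp add: of_nat_diff)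
    moreover have "(-3 :: rat) powi (int n - 3 * int k) = (-3) ^ (n - 3 * k)"
      using power_int_of_nat[of "-3 :: rat" "n - 3 * k"] k by (simp add: of_nat_diff)
    moreover have "3 * k - k = 2 * k" "2 * k - k = k" by simp_all
    then have "of_nat ((2 * k) choose k) * of_nat ((3 * k) choose k) *
        of_nat (n choose (3 * k)) * of_nat ((n + k) choose k)
        = (fact (n + k) / fact k ^ 4 * (1 / fact (n - 3 * k)) :: rat)"
      using k by (simp add: binomial_fact field_simps power4_eq_xxxx)
    ultimately show "of_int (int ((2 * k) choose k) * int ((3 * k) choose k) *
        int (n choose (3 * k)) * int ((n + k) choose k) * (-3) ^ (n - 3 * k)) = az_term1 n k"
      by (simp add: az_term1_def)
  qed
  also have "\<dots> = (\<Sum>k<K+1. az_term1 n k)"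
    using assms by (intro sum.mono_neutral_left) (auto simp: az_term1_def)
  finally show ?thesis .
qed

text \<open>As (n+a)!/(n-b)! is a falling factorial of length a + b, this is the hockey-stick
  identity. With k and 3k for a and b, in either order, it produces the denominators 4k + 1.\<close>

lemma sum_fact_recip_fact:
  "(\<Sum>n<N. fact (n + a) * recip_fact (int n - int b)) =
     fact (N + a) * recip_fact (int N - 1 - int b) / of_nat (a + b + 1)"
proof (induction N)
  case (Suc N)
  define X where "X = recip_fact (int N - int b)"
  define c :: rat where "c = of_nat (a + b + 1)"
  have r: "recip_fact (int N - 1 - int b) = (of_nat N - of_nat b) * X"
    using recip_fact_minus_one[of "int N - int b"] by (simp add: X_def algebra_simps)
  have c: "c \<noteq> 0" "c = of_nat a + of_nat b + 1"
    by (simp_all add: c_def flip: of_nat_Suc of_nat_add)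
  have "(\<Sum>n<Suc N. fact (n + a) * recip_fact (int n - int b)) =
      fact (N + a) * ((of_nat N - of_nat b) * X) / c + fact (N + a) * X"
    using Suc by (simp add: r X_def c_def)
  also have "\<dots> = fact (N + a) * X * ((of_nat N - of_nat b + c) / c)"
    using c(1) by (simp add: field_simps)
  also have "\<dots> = fact (Suc N + a) * X / c"
    unfolding c(2) by (simp add: field_simps)
  finally show ?case by (simp add: X_def c_def)
qed simp

text \<open>\<open>of_nat N * shifted_prod N a b\<close> is the falling factorial from N + a down to
  N - b. The middle factor N, later the prime p, is kept apart because it supplies the extra power
  of p.\<close>

definition shifted_prod :: "nat \<Rightarrow> nat \<Rightarrow> nat \<Rightarrow> rat" where
  "shifted_prod N a b = (\<Prod>i=1..a. of_nat N + of_nat i) * (\<Prod>i=1..b. of_nat N - of_nat i)"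

lemma fact_recip_fact_eq_shifted_prod:
  assumes "N > 0"
  shows "fact (N + a) * recip_fact (int N - 1 - int b) = of_nat N * shifted_prod N a b"
proof -
  have 1: "fact (N + a) = fact N * (\<Prod>i=1..a. of_nat N + (of_nat i :: rat))"
    by (induction a) (simp_all add: algebra_simps)
  have 2: "fact N * recip_fact (int N - 1 - int b) = of_nat N * (\<Prod>i=1..b. of_nat N - of_nat i)"
  proof (induction b)
    case 0
    have "int N - 1 = int (N - 1)" using assms by simp
    then have "recip_fact (int N - 1) = 1 / fact (N - 1)" by (simp only: recip_fact_of_nat)
    then show ?case using assms by (simp add: fact_reduce field_simps)
  next
    case (Suc b)
    have "recip_fact (int N - 1 - int (Suc b)) = (of_nat N - of_nat (Suc b)) * recip_fact (int N - 1 - int b)"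
      using recip_fact_minus_one[of "int N - 1 - int b"] by (simp add: algebra_simps)
    then show ?case using Suc by simp
  qed
  show ?thesis
    unfolding 1 shifted_prod_def using 2 by (simp add: algebra_simps)
qed

text \<open>Division by (-3)^n leaves only (-27)^(-k) of the power in \<open>az_term1\<close>, so
  the sum over n is one of factorial ratios; \<open>az_term2\<close> does the same for (-27)^n with
  \<open>k\<close> and \<open>3 * k\<close> exchanged.\<close>

lemma sum_almkvist_zudilin_1:
  assumes "N > 0"
  shows "(\<Sum>n<N. of_int (almkvist_zudilin n) / (-3) ^ n) =
    (\<Sum>k<N. of_nat N * shifted_prod N k (3 * k) / (of_nat (4 * k + 1) * fact k ^ 4 * (-27) ^ k))"
proof -
  have "(\<Sum>n<N. of_int (almkvist_zudilin n) / (-3) ^ n) = (\<Sum>n<N. \<Sum>k<N. az_term1 n k / (-3) ^ n)"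
    using almkvist_zudilin_eq_sum_az_term1[where K = "N - 1"] assms
    by (intro sum.cong) (simp_all add: sum_divide_distrib)
  also have "\<dots> = (\<Sum>k<N. \<Sum>n<N. az_term1 n k / (-3) ^ n)"
    by (rule sum.swap)
  also have "\<dots> = (\<Sum>k<N. of_nat N * shifted_prod N k (3 * k) / (of_nat (4 * k + 1) * fact k ^ 4 * (-27) ^ k))"
  proof (rule sum.cong[OF refl])
    fix k
    have "az_term1 n k / (-3) ^ n = fact (n + k) * recip_fact (int n - int (3 * k)) / (fact k ^ 4 * (-27) ^ k)" for n
    proof -
      have "(-3 :: rat) powi (int n - int (3 * k)) = (-3) ^ n / (-27) ^ k"
        using power_int_diff[of "-3 :: rat" "int n" "int (3 * k)"]
        by (simp add: power_mult del: of_nat_mult)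
      then have "(-3 :: rat) powi (int n - 3 * int k) = (-3) ^ n / (-27) ^ k"
        by simp
      then show ?thesis by (simp add: az_term1_def)
    qed
    then have "(\<Sum>n<N. az_term1 n k / (-3) ^ n) =
        (\<Sum>n<N. fact (n + k) * recip_fact (int n - int (3 * k))) / (fact k ^ 4 * (-27) ^ k)"
      by (simp only: sum_divide_distrib)
    also have "\<dots> = of_nat N * shifted_prod N k (3 * k) / of_nat (k + 3 * k + 1) / (fact k ^ 4 * (-27) ^ k)"
      unfolding sum_fact_recip_fact fact_recip_fact_eq_shifted_prod[OF assms] ..
    finally show "(\<Sum>n<N. az_term1 n k / (-3) ^ n) =
        of_nat N * shifted_prod N k (3 * k) / (of_nat (4 * k + 1) * fact k ^ 4 * (-27) ^ k)"
      by (simp add: mult.assoc)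
  qed
  finally show ?thesis .
qed

lemma sum_almkvist_zudilin_2:
  assumes "N > 0"
  shows "(\<Sum>n<N. of_int (almkvist_zudilin n) / (-27) ^ n) =
    (\<Sum>k<N. of_nat N * shifted_prod N (3 * k) k / (of_nat (4 * k + 1) * fact k ^ 4 * (-27) ^ k))"
proof -
  have "(\<Sum>n<N. of_int (almkvist_zudilin n) / (-27) ^ n) = (\<Sum>n<N. \<Sum>k<N. az_term2 n k / (-27) ^ n)"
    using almkvist_zudilin_eq_sum_az_term1[where K = "N - 1"] az_sums_agree[where K = "N - 1"] assms
    by (intro sum.cong) (simp_all add: sum_divide_distrib)
  also have "\<dots> = (\<Sum>k<N. \<Sum>n<N. az_term2 n k / (-27) ^ n)"
    by (rule sum.swap)
  also have "\<dots> = (\<Sum>k<N. of_nat N * shifted_prod N (3 * k) k / (of_nat (4 * k + 1) * fact k ^ 4 * (-27) ^ k))"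
  proof (rule sum.cong[OF refl])
    fix k
    have "az_term2 n k / (-27) ^ n = fact (n + 3 * k) * recip_fact (int n - int k) / (fact k ^ 4 * (-27) ^ k)" for n
      using power_int_diff[of "-27 :: rat" "int n" "int k"] by (simp add: az_term2_def power_int_of_nat)
    then have "(\<Sum>n<N. az_term2 n k / (-27) ^ n) =
        (\<Sum>n<N. fact (n + 3 * k) * recip_fact (int n - int k)) / (fact k ^ 4 * (-27) ^ k)"
      by (simp only: sum_divide_distrib)
    also have "\<dots> = of_nat N * shifted_prod N (3 * k) k / of_nat (3 * k + k + 1) / (fact k ^ 4 * (-27) ^ k)"
      unfolding sum_fact_recip_fact fact_recip_fact_eq_shifted_prod[OF assms] ..
    finally show "(\<Sum>n<N. az_term2 n k / (-27) ^ n) =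
        of_nat N * shifted_prod N (3 * k) k / (of_nat (4 * k + 1) * fact k ^ 4 * (-27) ^ k)"
      by (simp add: mult.assoc)
  qed
  finally show ?thesis .
qed

section \<open>Reduction to one central term\<close>

text \<open>The coefficients of the shifted Legendre polynomial of degree \<open>n\<close>.\<close>

definition legendre_coeff :: "nat \<Rightarrow> nat \<Rightarrow> rat" where
  "legendre_coeff n k = (-1) ^ k * fact (n + k) * recip_fact (int n - int k) / fact k ^ 2"

lemma legendre_coeff_eq_prod:
  "legendre_coeff n k = (\<Prod>i=1..k. (of_nat n + of_nat i) * (of_nat i - 1 - of_nat n) / of_nat i ^ 2)"
proof (induction k)
  case (Suc k)
  have "recip_fact (int n - int (Suc k)) = (of_nat n - of_nat k) * recip_fact (int n - int k)"
    using recip_fact_minus_one[of "int n - int k"] by (simp add: algebra_simps)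
  then have "legendre_coeff n (Suc k) = legendre_coeff n k *
      ((of_nat n + of_nat (Suc k)) * (of_nat (Suc k) - 1 - of_nat n) / of_nat (Suc k) ^ 2)"
    by (simp add: legendre_coeff_def power_mult_distrib del: of_nat_Suc)
       (simp add: divide_inverse algebra_simps)
  with Suc show ?case by simp
qed (simp add: legendre_coeff_def)

text \<open>The induction step is (x+1)^2 - y^2 = (x+1-y)(x+1+y). For \<open>K > n + 1\<close> the
  right side is 0, and the summand is a common factor of \<open>legendre_coeff n k\<close> and
  \<open>legendre_coeff (Suc n) k\<close>.\<close>

lemma legendre_telescope:
  "(\<Sum>k<K. (-1) ^ k * fact (n + k) * recip_fact (int n + 1 - int k) / fact k ^ 2) =
     (-1) ^ (K + 1) * of_nat K ^ 2 * fact (n + K) * recip_fact (int n + 1 - int K) / (fact K ^ 2 * of_nat (n + 1) ^ 2)"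
proof (induction K)
  case (Suc K)
  define x :: rat where "x = of_nat n"
  define y :: rat where "y = of_nat K"
  define X where "X = recip_fact (int n + 1 - int K)"
  define F :: rat where "F = fact (n + K)"
  define D :: rat where "D = fact K"
  define s :: rat where "s = (-1) ^ K"
  have nz: "D \<noteq> 0" "x + 1 \<noteq> 0" "y + 1 \<noteq> 0"
    by (simp_all add: D_def x_def y_def flip: of_nat_Suc)
  have 1: "recip_fact (int n + 1 - int (Suc K)) = (x + 1 - y) * X"
    using recip_fact_minus_one[of "int n + 1 - int K"] by (simp add: X_def x_def y_def algebra_simps)
  have 2: "fact (n + Suc K) = (x + y + 1) * F" "fact (Suc K) = (y + 1) * D"
      "of_nat (n + 1) = x + 1" "of_nat (Suc K) = y + 1"
    by (simp_all add: F_def D_def x_def y_def algebra_simps)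
  have "(\<Sum>k<Suc K. (-1) ^ k * fact (n + k) * recip_fact (int n + 1 - int k) / fact k ^ 2) =
      - s * y ^ 2 * F * X / (D ^ 2 * (x + 1) ^ 2) + s * F * X / D ^ 2"
    using Suc unfolding 2 by (simp add: s_def X_def F_def D_def y_def)
  also have "\<dots> = s * ((x + y + 1) * (x + 1 - y)) * F * X / (D ^ 2 * (x + 1) ^ 2)"
  proof -
    have "s * F * X / D ^ 2 = s * F * X * (x + 1) ^ 2 / (D ^ 2 * (x + 1) ^ 2)"
      using nz by simp
    then show ?thesis
      by (simp only: add_divide_distrib[symmetric])
         (rule arg_cong[where f = "\<lambda>z. z / _"], simp add: algebra_simps power2_eq_square)
  qed
  also have "\<dots> = (-1) ^ (Suc K + 1) * of_nat (Suc K) ^ 2 * fact (n + Suc K) *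
      recip_fact (int n + 1 - int (Suc K)) / (fact (Suc K) ^ 2 * of_nat (n + 1) ^ 2)"
    unfolding 1 2 using nz by (simp add: s_def power_mult_distrib)
  finally show ?case .
qed simp

text \<open>Partial fractions at z = 1/4: the quotient of the product of all i - z (i from 1 to n)
  by that of all z + j (j from 0 to n) has residue \<open>legendre_coeff n k\<close> at z = -k. The
  induction rests on (4n+5)(n+1+k) = (4n+3)(n+1-k) + 2(n+1)(4k+1), whose last summand cancels the
  denominator and leaves a telescoping sum of value 0.\<close>

lemma sum_legendre_coeff:
  assumes "K > n"
  shows "(\<Sum>k<K. legendre_coeff n k / of_nat (4 * k + 1)) =
    (\<Prod>i=1..n. of_nat (4 * i) - 1) / (\<Prod>j=0..n. of_nat (4 * j + 1))"
  using assms
proof (induction n)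
  case 0
  have "legendre_coeff 0 k / of_nat (4 * k + 1) = (if k = 0 then 1 else 0)" for k
    by (cases k) (simp_all add: legendre_coeff_def recip_fact_def)
  then show ?case using 0 by simp
next
  case (Suc n)
  define t where "t k = (-1) ^ k * fact (n + k) * recip_fact (int n + 1 - int k) / fact k ^ 2" for k
  have t: "(\<Sum>k<K. t k) = 0"
    unfolding t_def legendre_telescope using Suc.prems by simp
  have "of_nat (4 * n + 5) * (legendre_coeff (Suc n) k / of_nat (4 * k + 1))
      = of_nat (4 * n + 3) * (legendre_coeff n k / of_nat (4 * k + 1)) + 2 * of_nat (n + 1) * t k" for k
  proof -
    have L1: "legendre_coeff (Suc n) k = (of_nat n + 1 + of_nat k) * t k"
      by (simp add: legendre_coeff_def t_def algebra_simps)
    have r: "recip_fact (int n - int k) = (of_nat n + 1 - of_nat k) * recip_fact (int n + 1 - int k)"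
      using recip_fact_minus_one[of "int n + 1 - int k"] by simp
    have L2: "legendre_coeff n k = (of_nat n + 1 - of_nat k) * t k"
      unfolding legendre_coeff_def r t_def by (simp add: mult_ac)
    have nz: "1 + 4 * of_nat k \<noteq> (0 :: rat)"
      using of_nat_eq_0_iff[of "1 + 4 * k", where 'a = rat] by simp
    show ?thesis
      unfolding L1 L2 using nz by (simp add: field_simps)
  qed
  then have "of_nat (4 * n + 5) * (\<Sum>k<K. legendre_coeff (Suc n) k / of_nat (4 * k + 1))
      = of_nat (4 * n + 3) * (\<Sum>k<K. legendre_coeff n k / of_nat (4 * k + 1)) + 2 * of_nat (n + 1) * (\<Sum>k<K. t k)"
    by (simp only: sum_distrib_left sum.distrib[symmetric])
  also have "\<dots> = of_nat (4 * n + 3) * ((\<Prod>i=1..n. of_nat (4 * i) - 1) / (\<Prod>j=0..n. of_nat (4 * j + 1)))"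
    using Suc unfolding t by simp
  finally have e: "of_nat (4 * n + 5) * (\<Sum>k<K. legendre_coeff (Suc n) k / of_nat (4 * k + 1)) = \<dots>" .
  have nz: "of_nat (4 * n + 5) \<noteq> (0 :: rat)"
    by (simp only: of_nat_eq_0_iff; simp)
  have "x = y / a" if "a * x = y" "a \<noteq> 0" for a x y :: rat
    using that by (simp add: field_simps)
  from this[OF e nz] have "(\<Sum>k<K. legendre_coeff (Suc n) k / of_nat (4 * k + 1)) =
      of_nat (4 * n + 3) * ((\<Prod>i=1..n. of_nat (4 * i) - 1) / (\<Prod>j=0..n. of_nat (4 * j + 1))) / of_nat (4 * n + 5)" .
  also have "\<dots> = (\<Prod>i=1..Suc n. of_nat (4 * i) - 1) / (\<Prod>j=0..Suc n. of_nat (4 * j + 1))"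
    by (simp add: algebra_simps)
  finally show ?case .
qed

text \<open>This is (1/3)_k (2/3)_k / k!^2, a hypergeometric coefficient; the product form below
  makes the parameters 1/3 and 2/3 visible.\<close>

definition az_ratio :: "nat \<Rightarrow> rat" where
  "az_ratio k = fact (3 * k) / (fact k ^ 3 * 27 ^ k)"

lemma az_ratio_eq_prod:
  "az_ratio k = (\<Prod>i=1..k. (3 * of_nat i - 1) * (3 * of_nat i - 2) / (9 * of_nat i ^ 2))"
proof (induction k)
  case (Suc k)
  define y :: rat where "y = of_nat k"
  have y: "y + 1 \<noteq> 0" by (simp add: y_def flip: of_nat_Suc)
  have "3 * Suc k = Suc (Suc (Suc (3 * k)))" by simp
  then have f3: "fact (3 * Suc k) = (3 * y + 3) * ((3 * y + 2) * ((3 * y + 1) * fact (3 * k)))"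
    by (simp only: fact_Suc) (simp add: y_def algebra_simps)
  have f1: "(fact (Suc k) :: rat) = (y + 1) * fact k" by (simp add: y_def)
  have "az_ratio (Suc k) = az_ratio k * (((3 * y + 3) * (3 * y + 2) * (3 * y + 1)) / ((y + 1) ^ 3 * 27))"
    unfolding az_ratio_def f3 f1 by (simp add: power_mult_distrib mult_ac)
  also have "((3 * y + 3) * (3 * y + 2) * (3 * y + 1)) / ((y + 1) ^ 3 * 27) = (3 * y + 2) * (3 * y + 1) / (9 * (y + 1) ^ 2)"
  proof -
    have "((3 * y + 3) * (3 * y + 2) * (3 * y + 1)) / ((y + 1) ^ 3 * 27) =
       ((y + 1) * 3) * ((3 * y + 2) * (3 * y + 1)) / (((y + 1) * 3) * (9 * (y + 1) ^ 2))"
      by (simp add: algebra_simps power2_eq_square power3_eq_cube)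
    also have "\<dots> = (3 * y + 2) * (3 * y + 1) / (9 * (y + 1) ^ 2)"
      using y by (subst mult_divide_mult_cancel_left) auto
    finally show ?thesis .
  qed
  also have "az_ratio k * ((3 * y + 2) * (3 * y + 1) / (9 * (y + 1) ^ 2)) =
     (\<Prod>i=1..Suc k. (3 * of_nat i - 1) * (3 * of_nat i - 2) / (9 * of_nat i ^ 2))"
    using Suc by (simp add: y_def algebra_simps)
  finally show ?case .
qed (simp add: az_ratio_def)

locale quartic_prime = p_integral +
  fixes m :: nat
  assumes p_eq: "p = 4 * m + 1"
begin

lemma m_pos: "m > 0"
  using prime_p p_eq by (cases m) auto

lemma p_ge: "p \<ge> 5"
  using m_pos p_eq by linarith

lemma not_p_dvd_small: "0 < a \<Longrightarrow> a < p \<Longrightarrow> \<not> p dvd a"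
  by (auto dest: dvd_imp_le)

lemma p_mod_3: "p = 3 * (p div 3) + 1 \<or> p = 3 * (p div 3) + 2"
proof -
  have "\<not> 3 dvd p"
    using prime_p p_ge by (auto simp: prime_nat_iff)
  then show ?thesis by presburger
qed

lemma runit_3: "runit 3" and runit_9: "runit 9" and runit_27: "runit 27" and runit_4: "runit 4"
  and runit_2: "runit 2"
proof -
  have 3: "runit 3" "runit 2" using runit_less[of 3] runit_less[of 2] p_ge by simp_all
  then show "runit 3" "runit 2" by auto
  from 3 show "runit 9" "runit 27" "runit 4"
    using runit_power[of 3 2] runit_power[of 3 3] runit_power[of 2 2] by simp_all
qed

text \<open>If 4k + 1 = pc, then c < 4 by size and c = 1 modulo 4, hence c = 1.\<close>

lemma not_dvd_4k1:
  assumes "k < p" "k \<noteq> m" shows "\<not> p dvd 4 * k + 1"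
proof
  assume "p dvd 4 * k + 1"
  then obtain c where c: "4 * k + 1 = p * c" by blast
  have "p * c < p * 4" using c assms p_ge by linarith
  then have "c < 4" by simp
  moreover have "4 * k + 1 = 4 * (m * c) + c" using c p_eq by (simp add: algebra_simps)
  ultimately have "c = 1" by presburger
  then show False using c assms p_eq by simp
qed

lemma shifted_prod_zcong:
  "zcong 1 (shifted_prod p a b) ((-1) ^ b * fact a * fact b)"
  and shifted_prod_R: "shifted_prod p a b \<in> R"
proof -
  have 1: "zcong 1 (\<Prod>i=1..a. of_nat p + of_nat i) (fact a)"
  proof (induction a)
    case (Suc a)
    have "zcong 1 (of_nat p * 1 + of_nat (Suc a)) (0 + of_nat (Suc a))"
      by (intro zcong_add zcong_zero_p) auto
    then have "zcong 1 ((of_nat p + of_nat (Suc a)) * (\<Prod>i=1..a. of_nat p + of_nat i)) (of_nat (Suc a) * fact a)"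
      using Suc by (intro zcong_mult) (auto simp del: of_nat_Suc intro: R_of_nat[of "fact a", simplified])
    then show ?case by (simp add: mult_ac)
  qed simp
  have 2: "zcong 1 (\<Prod>i=1..b. of_nat p - of_nat i) ((-1) ^ b * fact b)"
  proof (induction b)
    case (Suc b)
    have "zcong 1 (of_nat p * 1 - of_nat (Suc b)) (0 - of_nat (Suc b))"
      by (intro zcong_diff zcong_zero_p) auto
    moreover have "(-1) ^ b * fact b \<in> R"
      using R_of_int[of "(-1) ^ b * fact b"] by simp
    ultimately have "zcong 1 ((of_nat p - of_nat (Suc b)) * (\<Prod>i=1..b. of_nat p - of_nat i))
       (- of_nat (Suc b) * ((-1) ^ b * fact b))"
      using Suc by (intro zcong_mult) (auto simp del: of_nat_Suc)
    then show ?case by (simp add: mult_ac del: of_nat_Suc)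
  qed simp
  have f: "fact c \<in> R" for c using R_of_nat[of "fact c"] by simp
  have g: "(-1) ^ c \<in> R" for c :: nat using R_of_int[of "(-1) ^ c"] by simp
  show "shifted_prod p a b \<in> R" by (auto simp: shifted_prod_def)
  have "zcong 1 (shifted_prod p a b) (fact a * ((-1) ^ b * fact b))"
    unfolding shifted_prod_def using 1 2 f g by (intro zcong_mult) auto
  then show "zcong 1 (shifted_prod p a b) ((-1) ^ b * fact a * fact b)"
    by (simp add: mult_ac)
qed

lemma zcong_p_mult_2: "zcong 1 x y \<Longrightarrow> zcong 2 (of_nat p * x) (of_nat p * y)"
  using zcong_p_mult[of 1] by (simp add: numeral_2_eq_2)

lemma off_diagonal_term:
  assumes "k < p" "k \<noteq> m" "P \<in> R" "zcong 1 P ((-1) ^ k * fact k * fact (3 * k))"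
  shows "zcong 2 (of_nat p * P / (of_nat (4 * k + 1) * fact k ^ 4 * (-27) ^ k))
     (of_nat p * (az_ratio k / of_nat (4 * k + 1)))"
proof -
  have u: "runit (of_nat (4 * k + 1) * fact k ^ 4 * (-27) ^ k)"
    using assms runit_fact runit_27 not_dvd_4k1
    by (intro runit_mult runit_power runit_of_nat runit_uminus) auto
  have "zcong 1 (P / (of_nat (4 * k + 1) * fact k ^ 4 * (-27) ^ k))
      ((-1) ^ k * fact k * fact (3 * k) / (of_nat (4 * k + 1) * fact k ^ 4 * (-27) ^ k))"
    using u assms by (intro zcong_divide) auto
  also have "(-1) ^ k * fact k * fact (3 * k) / (of_nat (4 * k + 1) * fact k ^ 4 * (-27) ^ k)
     = az_ratio k / of_nat (4 * k + 1)"
  proof -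
    have "(-27 :: rat) ^ k = (-1) ^ k * 27 ^ k" by (simp flip: power_mult_distrib)
    then have "(-1) ^ k * fact k * fact (3 * k) / (of_nat (4 * k + 1) * fact k ^ 4 * (-27) ^ k)
       = ((-1 :: rat) ^ k * fact k) * fact (3 * k) / (((-1) ^ k * fact k) * (of_nat (4 * k + 1) * (fact k ^ 3 * 27 ^ k)))"
      by (simp add: power4_eq_xxxx power3_eq_cube mult_ac)
    also have "\<dots> = az_ratio k / of_nat (4 * k + 1)"
      by (subst mult_divide_mult_cancel_left) (simp_all add: az_ratio_def mult_ac)
    finally show ?thesis .
  qed
  finally show ?thesis
    unfolding times_divide_eq_right[symmetric] by (rule zcong_p_mult_2)
qed

text \<open>The denominator 4m + 1 is p itself and cancels the factor p, so here \<open>P\<close>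
  must be known modulo p^2.\<close>

lemma diagonal_term:
  assumes "P \<in> R" "zcong 2 P ((-1) ^ m * fact m * fact (3 * m))"
  shows "zcong 2 (of_nat p * P / (of_nat (4 * m + 1) * fact m ^ 4 * (-27) ^ m)) (az_ratio m)"
proof -
  have u: "runit (fact m ^ 4 * (-27) ^ m)"
    using p_eq runit_fact runit_27
    by (intro runit_mult runit_power runit_uminus) auto
  have "zcong 2 (P / (fact m ^ 4 * (-27) ^ m)) ((-1) ^ m * fact m * fact (3 * m) / (fact m ^ 4 * (-27) ^ m))"
    using u assms by (intro zcong_divide) auto
  also have "(-1) ^ m * fact m * fact (3 * m) / (fact m ^ 4 * (-27) ^ m) = az_ratio m"
  proof -
    have "(-27 :: rat) ^ m = (-1) ^ m * 27 ^ m" by (simp flip: power_mult_distrib)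
    then have "(-1) ^ m * fact m * fact (3 * m) / (fact m ^ 4 * (-27) ^ m)
       = ((-1 :: rat) ^ m * fact m) * fact (3 * m) / (((-1) ^ m * fact m) * (fact m ^ 3 * 27 ^ m))"
      by (simp add: power4_eq_xxxx power3_eq_cube mult_ac)
    also have "\<dots> = az_ratio m"
      by (subst mult_divide_mult_cancel_left) (simp_all add: az_ratio_def mult_ac)
    finally show ?thesis .
  qed
  also have "P / (fact m ^ 4 * (-27) ^ m) = of_nat p * P / (of_nat (4 * m + 1) * fact m ^ 4 * (-27) ^ m)"
    using p_ge by (simp only: p_eq[symmetric] mult.assoc) simp
  finally show ?thesis .
qed

text \<open>The block m+1..3m is the part of 1..3m mapped to itself by i -> p - i, which makes its
  shifts by p computable modulo p^2.\<close>

definition middle_prod :: rat where "middle_prod = (\<Prod>i=m+1..3*m. of_nat i)"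

lemma fact_middle: "fact (3 * m) = fact m * middle_prod"
proof -
  have "{1..3*m} = {1..m} \<union> {m+1..3*m}" by auto
  then have "\<Prod>{1..3*m} = \<Prod>{1..m} * \<Prod>{m+1..3*m}"
    by (simp add: prod.union_disjoint)
  then show ?thesis
    unfolding fact_prod middle_prod_def by simp
qed

lemma middle_reflect: "(\<Prod>i=m+1..3*m. f (p - i)) = (\<Prod>i=m+1..3*m. f i)"
  by (rule prod.reindex_bij_witness[where i = "\<lambda>i. p - i" and j = "\<lambda>i. p - i"])
     (use p_eq in auto)

lemma prod_small_squares:
  "zcong 2 ((\<Prod>i=1..m. of_nat p + of_nat i) * (\<Prod>i=1..m. of_nat p - of_nat i)) ((-1) ^ m * fact m ^ 2)"
proof -
  have "zcong 2 (\<Prod>i=1..m. (of_nat p + of_nat i) * (of_nat p - of_nat i)) (\<Prod>i=1..m. - (of_nat i ^ 2))"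
    by (intro zcong_prod zcongI[of 1]) (auto simp: algebra_simps power2_eq_square)
  moreover have "(\<Prod>i=1..m. - (of_nat i ^ 2)) = (-1) ^ m * (fact m ^ 2 :: rat)"
    by (induction m) (simp_all add: algebra_simps power2_eq_square)
  ultimately show ?thesis by (simp add: prod.distrib)
qed

lemma middle_prod_minus: "(\<Prod>i=m+1..3*m. of_nat p - of_nat i) = middle_prod"
proof -
  have "(\<Prod>i=m+1..3*m. of_nat p - of_nat i) = (\<Prod>i=m+1..3*m. (of_nat (p - i) :: rat))"
    using p_eq by (intro prod.cong) (auto simp: of_nat_diff)
  then show ?thesis unfolding middle_reflect middle_prod_def .
qed

text \<open>1/i + 1/(p-i) = p/(i(p-i)), so the sum of reciprocals over the symmetric block is
  divisible by p and the first-order term disappears.\<close>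

lemma middle_prod_plus: "zcong 2 (\<Prod>i=m+1..3*m. of_nat p + of_nat i) middle_prod"
proof -
  define S :: rat where "S = (\<Sum>i=m+1..3*m. 1 / of_nat i)"
  have u: "runit (of_nat i)" if "i \<in> {m+1..3*m}" for i
    using that p_eq by (intro runit_less) auto
  have S: "S \<in> R" unfolding S_def using u by (intro R_sum R_divide) auto
  have "S = (\<Sum>i=m+1..3*m. 1 / of_nat (p - i))"
    unfolding S_def
    by (rule sum.reindex_bij_witness[where i = "\<lambda>i. p - i" and j = "\<lambda>i. p - i"])
       (use p_eq in auto)
  then have "2 * S = (\<Sum>i=m+1..3*m. 1 / of_nat i + 1 / of_nat (p - i))"
    by (simp add: S_def sum.distrib)
  also have "\<dots> = (\<Sum>i=m+1..3*m. of_nat p * (1 / (of_nat i * of_nat (p - i))))"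
    using p_eq by (intro sum.cong) (auto simp: of_nat_diff field_simps)
  finally have 2: "2 * S = of_nat p * (\<Sum>i=m+1..3*m. 1 / (of_nat i * of_nat (p - i)))"
    by (simp add: sum_distrib_left)
  have "(\<Sum>i=m+1..3*m. 1 / (of_nat i * of_nat (p - i))) \<in> R"
    by (intro R_sum R_divide runit_mult runit_less R_1) (use p_eq in auto)
  then have "zcong 1 (2 * S) (2 * 0)" unfolding 2 by (simp add: zcong_zero_p[simplified])
  then have S0: "zcong 1 S 0" using runit_2 by (rule zcong_cancel)
  have "zcong 2 (\<Prod>i=m+1..3*m. 1 + of_nat p * (1 / of_nat i)) (1 + of_nat p * S)"
    unfolding S_def using u by (intro zcong_prod_one_plus R_divide) auto
  also have "zcong 2 (1 + of_nat p * S) (1 + of_nat p * 0)"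
    using zcong_p_mult[OF S0] by (intro zcong_add) (auto simp: numeral_2_eq_2)
  finally have "zcong 2 (middle_prod * (\<Prod>i=m+1..3*m. 1 + of_nat p * (1 / of_nat i))) (middle_prod * 1)"
    by (intro zcong_cmult) (auto simp: middle_prod_def)
  also have "middle_prod * (\<Prod>i=m+1..3*m. 1 + of_nat p * (1 / of_nat i)) = (\<Prod>i=m+1..3*m. of_nat p + of_nat i)"
    unfolding middle_prod_def prod.distrib[symmetric]
    by (intro prod.cong) (auto simp: field_simps)
  finally show ?thesis by simp
qed

text \<open>For i up to m the factors pair up as (p+i)(p-i) = -i^2 modulo p^2; the others form the
  symmetric block, for which p + i and p - i give the same product modulo p^2.\<close>

lemma diagonal_prods:
  "zcong 2 (shifted_prod p m (3 * m)) ((-1) ^ m * fact m * fact (3 * m))"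
  "zcong 2 (shifted_prod p (3 * m) m) ((-1) ^ m * fact m * fact (3 * m))"
proof -
  have s: "(\<Prod>i=1..3*m. f i) = (\<Prod>i=1..m. f i) * (\<Prod>i=m+1..3*m. f i)" for f :: "nat \<Rightarrow> rat"
  proof -
    have "{1..3*m} = {1..m} \<union> {m+1..3*m}" by auto
    then show ?thesis by (simp add: prod.union_disjoint)
  qed
  have mp: "middle_prod \<in> R" by (auto simp: middle_prod_def)
  have "zcong 2 (((\<Prod>i=1..m. of_nat p + of_nat i) * (\<Prod>i=1..m. of_nat p - of_nat i)) * middle_prod)
      (((-1) ^ m * fact m ^ 2) * middle_prod)"
    using mp by (intro zcong_mult[OF prod_small_squares zcong_refl]) auto
  then show "zcong 2 (shifted_prod p m (3 * m)) ((-1) ^ m * fact m * fact (3 * m))"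
    unfolding shifted_prod_def s middle_prod_minus fact_middle by (simp add: power2_eq_square mult_ac)
  have "zcong 2 (((\<Prod>i=1..m. of_nat p + of_nat i) * (\<Prod>i=1..m. of_nat p - of_nat i)) * (\<Prod>i=m+1..3*m. of_nat p + of_nat i))
      (((-1) ^ m * fact m ^ 2) * middle_prod)"
    using mp by (intro zcong_mult[OF prod_small_squares middle_prod_plus]) auto
  then show "zcong 2 (shifted_prod p (3 * m) m) ((-1) ^ m * fact m * fact (3 * m))"
    unfolding shifted_prod_def s fact_middle by (simp add: power2_eq_square mult_ac)
qed

definition off_diagonal_sum :: rat where
  "off_diagonal_sum = (\<Sum>k\<in>{..<p} - {m}. of_nat p * (az_ratio k / of_nat (4 * k + 1)))"

lemma sums_zcong_off_diagonal:
  "zcong 2 (\<Sum>n<p. of_int (almkvist_zudilin n) / (-3) ^ n) (az_ratio m + off_diagonal_sum)"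
  "zcong 2 (\<Sum>n<p. of_int (almkvist_zudilin n) / (-27) ^ n) (az_ratio m + off_diagonal_sum)"
proof -
  have m: "m \<in> {..<p}" using p_eq by simp
  have p: "p > 0" using p_ge by simp
  have "(-1 :: rat) ^ (3 * k) = (-1) ^ k" for k
    unfolding power_mult by simp
  then have a: "zcong 1 (shifted_prod p k (3 * k)) ((-1) ^ k * fact k * fact (3 * k))" for k
    using shifted_prod_zcong[of k "3 * k"] by (simp add: mult_ac)
  have b: "zcong 1 (shifted_prod p (3 * k) k) ((-1) ^ k * fact k * fact (3 * k))" for k
    using shifted_prod_zcong[of "3 * k" k] by (simp add: mult_ac)
  show "zcong 2 (\<Sum>n<p. of_int (almkvist_zudilin n) / (-3) ^ n) (az_ratio m + off_diagonal_sum)"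
    unfolding sum_almkvist_zudilin_1[OF p] sum.remove[OF finite_lessThan m] off_diagonal_sum_def
    by (intro zcong_add zcong_sum diagonal_term off_diagonal_term shifted_prod_R diagonal_prods a) auto
  show "zcong 2 (\<Sum>n<p. of_int (almkvist_zudilin n) / (-27) ^ n) (az_ratio m + off_diagonal_sum)"
    unfolding sum_almkvist_zudilin_2[OF p] sum.remove[OF finite_lessThan m] off_diagonal_sum_def
    by (intro zcong_add zcong_sum diagonal_term off_diagonal_term shifted_prod_R diagonal_prods b) auto
qed

end

section \<open>Harmonic sums and the Fermat quotient of 3\<close>

definition harm_sum :: "nat \<Rightarrow> rat" where
  "harm_sum N = (\<Sum>i=1..N. 1 / of_nat i)"

lemma sum_of_bool_greater:
  fixes f :: "nat \<Rightarrow> 'a::comm_ring_1"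
  assumes "n \<le> N"
  shows "(\<Sum>j=1..N. of_bool (n < j) * f j) = (\<Sum>j=1..N. f j) - (\<Sum>j=1..n. f j)"
  using assms
proof (induction N rule: dec_induct)
  case base
  then show ?case by (simp add: sum.neutral)
qed simp

context p_integral
begin

lemma inj_on_mult_mod:
  assumes "coprime a p"
  shows "inj_on (\<lambda>x. (a * x + b) mod p) {..<p}"
proof (rule inj_onI)
  fix x y assume xy: "x \<in> {..<p}" "y \<in> {..<p}" "(a * x + b) mod p = (a * y + b) mod p"
  then have "[a * x = a * y] (mod p)"
    by (metis cong_add_rcancel_nat cong_def)
  then have "[x = y] (mod p)"
    using assms cong_mult_lcancel_nat by blast
  then show "x = y" using xy by (simp add: cong_less_modulus_unique_nat)
qed

lemma bij_betw_mult_mod: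
  assumes "coprime a p"
  shows "bij_betw (\<lambda>x. (a * x + b) mod p) {..<p} {..<p}"
  unfolding bij_betw_def
proof
  show "inj_on (\<lambda>x. (a * x + b) mod p) {..<p}" by (rule inj_on_mult_mod[OF assms])
  then show "(\<lambda>x. (a * x + b) mod p) ` {..<p} = {..<p}"
    using prime_gt_0_nat[OF prime_p] by (intro endo_inj_surj) auto
qed

lemma bij_betw_mult_mod_units:
  assumes "coprime a p"
  shows "bij_betw (\<lambda>x. a * x mod p) {1..p-1} {1..p-1}"
proof -
  have "bij_betw (\<lambda>x. a * x mod p) ({..<p} - {0}) ({..<p} - {0})"
    using bij_betw_mult_mod[OF assms, of 0]  prime_gt_0_nat[OF prime_p]
    by (intro bij_betw_DiffI) (auto simp: bij_betw_def)
  moreover have "{..<p} - {0} = {1..p-1}"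
    using prime_gt_0_nat[OF prime_p] by auto
  ultimately show ?thesis by simp
qed

text \<open>An integer model of harmonic numbers modulo p: i^(p-2) stands for 1/i and is divisible
  by p at multiples of p. It thus makes sense modulo p for \<open>N \<ge> p\<close> too, with period
  p in \<open>N\<close>.\<close>

definition inv_pow_sum :: "nat \<Rightarrow> int" where
  "inv_pow_sum N = (\<Sum>i=1..N. int i ^ (p - 2))"

lemma inv_pow_sum_0 [simp]: "inv_pow_sum 0 = 0"
  and inv_pow_sum_Suc [simp]: "inv_pow_sum (Suc N) = inv_pow_sum N + int (Suc N) ^ (p - 2)"
  by (simp_all add: inv_pow_sum_def)

lemma fermat_int: "\<not> int p dvd a \<Longrightarrow> [a ^ (p - 1) = 1] (mod int p)"
proof -
  assume a: "\<not> int p dvd a"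
  have p: "int p > 0" using prime_gt_0_nat[OF prime_p] by simp
  have "\<not> p dvd nat (a mod int p)"
  proof
    assume "p dvd nat (a mod int p)"
    then have "int p dvd int (nat (a mod int p))" by (simp only: int_dvd_int_iff)
    then have "int p dvd a mod int p" using p by simp
    then show False using a by (simp add: dvd_mod_iff)
  qed
  then have "[nat (a mod int p) ^ (p - 1) = 1] (mod p)"
    by (rule fermat_theorem[OF prime_p])
  then have "[int (nat (a mod int p) ^ (p - 1)) = int 1] (mod int p)"
    by (simp only: cong_int_iff)
  then have "[(a mod int p) ^ (p - 1) = 1] (mod int p)"
    using p by simp
  then show ?thesis by (simp add: cong_def power_mod)
qed

end

lemma mod_12_cases:
  fixes m n p :: nat
  assumes "p = 4 * m + 1" and "p = 3 * n + 1 \<or> p = 3 * n + 2"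
  shows "\<exists>r. p = 12 * r + 1 \<and> m = 3 * r \<and> n = 4 * r \<or> p = 12 * r + 5 \<and> m = 3 * r + 1 \<and> n = 4 * r + 1"
proof -
  have "\<exists>r. m = 3 * r \<or> m = 3 * r + 1 \<or> m = 3 * r + 2" by presburger
  then obtain r where r: "m = 3 * r \<or> m = 3 * r + 1 \<or> m = 3 * r + 2" by blast
  have "p mod 3 \<noteq> 0" using assms(2) by presburger
  moreover have "p mod 3 = 0" if "m = 3 * r + 2" using assms(1) that by presburger
  ultimately have "m = 3 * r \<or> m = 3 * r + 1" using r by metis
  then show ?thesis
  proof (elim disjE)
    assume 1: "m = 3 * r"
    then have "n = 4 * r" using assms by presburger
    with 1 assms(1) show ?thesis by (intro exI[of _ r]) simp
  next
    assume 2: "m = 3 * r + 1"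
    then have "n = 4 * r + 1" using assms by presburger
    with 2 assms(1) show ?thesis by (intro exI[of _ r]) simp
  qed
qed

context quartic_prime
begin

lemma p_gt: "p > 2" using p_ge by simp

lemma inv_pow: "\<not> int p dvd a \<Longrightarrow> [a * a ^ (p - 2) = 1] (mod int p)"
  using fermat_int[of a] p_gt by (simp add: numeral_2_eq_2 Suc_diff_Suc flip: power_Suc)

lemma neg_inv_pow: "(- a :: int) ^ (p - 2) = - (a ^ (p - 2))"
  using p_eq m_pos by (intro power_minus_odd) auto

lemma inv_pow_reflect: "i \<le> p \<Longrightarrow> [int (p - i) ^ (p - 2) = - (int i ^ (p - 2))] (mod int p)"
proof -
  assume "i \<le> p"
  then have "[int (p - i) = - int i] (mod int p)"
    by (simp add: of_nat_diff cong_iff_dvd_diff)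
  then show ?thesis using neg_inv_pow cong_pow by metis
qed

lemma inv_pow_sum_full: "[inv_pow_sum (p - 1) = 0] (mod int p)"
proof -
  have "inv_pow_sum (p - 1) = (\<Sum>i=1..p-1. int (p - i) ^ (p - 2))"
    unfolding inv_pow_sum_def
    by (rule sum.reindex_bij_witness[where i = "\<lambda>i. p - i" and j = "\<lambda>i. p - i"]) auto
  also have "[\<dots> = (\<Sum>i=1..p-1. - (int i ^ (p - 2)))] (mod int p)"
    by (intro cong_sum inv_pow_reflect) auto
  finally have "[inv_pow_sum (p - 1) = - inv_pow_sum (p - 1)] (mod int p)"
    by (simp add: inv_pow_sum_def sum_negf)
  then have "int p dvd 2 * inv_pow_sum (p - 1)"
    by (simp add: cong_iff_dvd_diff)
  moreover have "coprime (int p) 2"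
    using p_eq by simp
  ultimately show ?thesis
    by (simp add: cong_0_iff coprime_dvd_mult_right_iff)
qed

lemma inv_pow_sum_reflect: "N \<le> p - 1 \<Longrightarrow> [inv_pow_sum (p - 1 - N) = inv_pow_sum N] (mod int p)"
proof (induction N)
  case (Suc N)
  have "p - 1 - N = Suc (p - 1 - Suc N)" "p - 1 - N = p - Suc N" using Suc.prems by auto
  then have "inv_pow_sum (p - 1 - Suc N) = inv_pow_sum (p - 1 - N) - int (p - Suc N) ^ (p - 2)"
    by simp
  also have "[\<dots> = inv_pow_sum N - (- (int (Suc N) ^ (p - 2)))] (mod int p)"
    using Suc by (intro cong_diff inv_pow_reflect) auto
  finally show ?case by simp
qed (use inv_pow_sum_full in simp)

lemma inv_pow_sum_add_p: "[inv_pow_sum (N + p) = inv_pow_sum N] (mod int p)"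
proof (induction N)
  case 0
  have "p = Suc (p - 1)" using p_gt by simp
  then have "inv_pow_sum p = inv_pow_sum (p - 1) + int p ^ (p - 2)"
    using inv_pow_sum_Suc[of "p - 1"] by simp
  also have "[\<dots> = 0 + 0] (mod int p)"
    using inv_pow_sum_full p_gt by (intro cong_add) (auto simp: cong_0_iff dvd_power)
  finally show ?case by simp
next
  case (Suc N)
  have "[int (Suc N + p) = int (Suc N)] (mod int p)"
    by (simp add: cong_iff_dvd_diff)
  then have "[int (Suc N + p) ^ (p - 2) = int (Suc N) ^ (p - 2)] (mod int p)"
    by (rule cong_pow)
  then have "[inv_pow_sum (N + p) + int (Suc N + p) ^ (p - 2) = inv_pow_sum N + int (Suc N) ^ (p - 2)] (mod int p)"
    using Suc by (rule cong_add[rotated])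
  then show ?case by (simp only: inv_pow_sum_Suc add_Suc)
qed

lemma three_times_inv_pow:
  assumes "[a = 3 * b] (mod int p)"
  shows "[3 * a ^ (p - 2) = b ^ (p - 2)] (mod int p)"
proof -
  have "\<not> int p dvd 3"
    using p_ge not_p_dvd_small[of 3] int_dvd_int_iff[of p 3] by simp
  have "[3 * a ^ (p - 2) = 3 * (3 * b) ^ (p - 2)] (mod int p)"
    using assms by (intro cong_mult cong_pow) auto
  also have "3 * (3 * b) ^ (p - 2) = (3 * 3 ^ (p - 2)) * b ^ (p - 2)"
    by (simp add: power_mult_distrib)
  also have "[\<dots> = 1 * b ^ (p - 2)] (mod int p)"
    using \<open>\<not> int p dvd 3\<close> by (intro cong_mult inv_pow) auto
  finally show ?thesis by simp
qed

text \<open>Here \<open>s\<close> stands for \<open>-1/3\<close> modulo \<open>p\<close>: the three residue classes modulo 3 of the summation index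
  become three shifted intervals.\<close>

lemma inv_pow_sum_triple:
  assumes "[3 * int s = -1] (mod int p)"
  shows "[3 * inv_pow_sum (3 * x) = inv_pow_sum x + inv_pow_sum (x + s) + inv_pow_sum (x + 2 * s)
     - inv_pow_sum s - inv_pow_sum (2 * s)] (mod int p)"
proof (induction x)
  case (Suc x)
  obtain c where c: "3 * int s + 1 = int p * c"
    using assms by (auto simp: cong_iff_dvd_diff)
  have 1: "[3 * int (3 * x + 3) ^ (p - 2) = int (Suc x) ^ (p - 2)] (mod int p)"
    by (rule three_times_inv_pow) (simp add: add.commute)
  have "int (3 * x + 2) - 3 * int (Suc (x + s)) = int p * (- c)"
    using c by (simp add: algebra_simps)
  then have 2: "[3 * int (3 * x + 2) ^ (p - 2) = int (Suc (x + s)) ^ (p - 2)] (mod int p)"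
    by (intro three_times_inv_pow) (metis cong_iff_dvd_diff dvd_triv_left)
  have "int (3 * x + 1) - 3 * int (Suc (x + 2 * s)) = int p * (- 2 * c)"
    using c by (simp add: algebra_simps)
  then have 3: "[3 * int (3 * x + 1) ^ (p - 2) = int (Suc (x + 2 * s)) ^ (p - 2)] (mod int p)"
    by (intro three_times_inv_pow) (metis cong_iff_dvd_diff dvd_triv_left)
  have e: "3 * Suc x = Suc (Suc (Suc (3 * x)))" by simp
  have "3 * inv_pow_sum (3 * Suc x) = 3 * inv_pow_sum (3 * x) + 3 * int (3 * x + 3) ^ (p - 2)
     + 3 * int (3 * x + 2) ^ (p - 2) + 3 * int (3 * x + 1) ^ (p - 2)"
    unfolding e by (simp only: inv_pow_sum_Suc) (simp add: algebra_simps)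
  also have "[\<dots> = inv_pow_sum x + inv_pow_sum (x + s) + inv_pow_sum (x + 2 * s)
     - inv_pow_sum s - inv_pow_sum (2 * s) + int (Suc x) ^ (p - 2) + int (Suc (x + s)) ^ (p - 2)
     + int (Suc (x + 2 * s)) ^ (p - 2)] (mod int p)"
    by (intro cong_add Suc 1 2 3)
  also have "inv_pow_sum x + inv_pow_sum (x + s) + inv_pow_sum (x + 2 * s)
     - inv_pow_sum s - inv_pow_sum (2 * s) + int (Suc x) ^ (p - 2) + int (Suc (x + s)) ^ (p - 2)
     + int (Suc (x + 2 * s)) ^ (p - 2) = inv_pow_sum (Suc x) + inv_pow_sum (Suc x + s) + inv_pow_sum (Suc x + 2 * s)
     - inv_pow_sum s - inv_pow_sum (2 * s)"
    by simp
  finally show ?case .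
qed simp

abbreviation n3 :: nat where "n3 \<equiv> p div 3"

lemma n3_bounds: "m \<le> n3" "n3 + m < p" "m < p"
  using p_eq m_pos p_mod_3 by linarith+

text \<open>The triplication formula \<open>inv_pow_sum_triple\<close> at the argument 1/12,
  simplified by period and reflection: \<open>n3 - m\<close>, \<open>m\<close>, \<open>n3\<close>,
  \<open>n3 + m\<close> are close to p/12, 3p/12, 4p/12, 7p/12.\<close>

lemma inv_pow_sum_twelfths:
  "[2 * inv_pow_sum m - inv_pow_sum (n3 + m) - inv_pow_sum (n3 - m) = - 2 * inv_pow_sum n3] (mod int p)"
proof -
  have refl: "[inv_pow_sum N = inv_pow_sum M] (mod int p)" if "N + M = p - 1" for N M
    using inv_pow_sum_reflect[of M] that by (metis add_diff_cancel_right' le_add2)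
  have per: "[inv_pow_sum N = inv_pow_sum M] (mod int p)" if "N = M + p" for N M
    using inv_pow_sum_add_p that by metis
  obtain r where r: "p = 12 * r + 1 \<and> m = 3 * r \<and> n3 = 4 * r \<or> p = 12 * r + 5 \<and> m = 3 * r + 1 \<and> n3 = 4 * r + 1"
    using mod_12_cases[OF p_eq p_mod_3] by blast
  have combine: "[2 * A - C' - B' = - 2 * G] (mod int p)"
    if "[3 * A = B + C + D - E - F] (mod int p)" "[B = B'] (mod int p)" "[C = C'] (mod int p)"
      "[D = A] (mod int p)" "[E = G] (mod int p)" "[F = G] (mod int p)" for A B C D E F G B' C'
  proof -
    have "2 * A - C' - B' - - 2 * G =
      (3 * A - (B + C + D - E - F)) + (B - B') + (C - C') + (D - A) - (E - G) - (F - G)" by simp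
    then show ?thesis
      using that unfolding cong_iff_dvd_diff by (simp only: dvd_add dvd_diff)
  qed
  from r show ?thesis
  proof (elim disjE)
    assume 1: "p = 12 * r + 1 \<and> m = 3 * r \<and> n3 = 4 * r"
    have "[3 * int (4 * r) = -1] (mod int p)" using 1 by (simp add: cong_iff_dvd_diff add.commute)
    from inv_pow_sum_triple[OF this, of r]
    have "[3 * inv_pow_sum m = inv_pow_sum r + inv_pow_sum (5 * r) + inv_pow_sum (9 * r)
       - inv_pow_sum (4 * r) - inv_pow_sum (8 * r)] (mod int p)"
      using 1 by simp
    then show ?thesis
    proof (rule combine)
      have "n3 - m = r" using 1 by linarith
      then show "[inv_pow_sum r = inv_pow_sum (n3 - m)] (mod int p)" by simp
      have "n3 = 4 * r" using 1 by linarith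
      then show "[inv_pow_sum (4 * r) = inv_pow_sum n3] (mod int p)" by simp
    qed (rule refl; use 1 in linarith)+
  next
    assume 2: "p = 12 * r + 5 \<and> m = 3 * r + 1 \<and> n3 = 4 * r + 1"
    \<comment> \<open>Here 3s + 1 = 2p with s = 8r + 3, and x = 5r + 2 is chosen so that 3x = m +
      p.\<close>
    have "[3 * int (8 * r + 3) = -1] (mod int p)"
      using 2 cong_iff_dvd_diff[of "3 * int (8 * r + 3)" "-1" "int p"]
      by (simp add: dvd_def) (rule exI[of _ 2], simp)
    from inv_pow_sum_triple[OF this, of "5 * r + 2"]
    have "[3 * inv_pow_sum (m + p) = inv_pow_sum (13 * r + 5) + inv_pow_sum (5 * r + 2) + inv_pow_sum (21 * r + 8)
       - inv_pow_sum (8 * r + 3) - inv_pow_sum (16 * r + 6)] (mod int p)"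
      using 2 by (simp add: algebra_simps)
    then have "[3 * inv_pow_sum m = inv_pow_sum (13 * r + 5) + inv_pow_sum (5 * r + 2) + inv_pow_sum (21 * r + 8)
       - inv_pow_sum (8 * r + 3) - inv_pow_sum (16 * r + 6)] (mod int p)"
      using cong_scalar_left[OF inv_pow_sum_add_p[of m], of 3] cong_sym cong_trans by blast
    then show ?thesis
    proof (rule combine)
      show "[inv_pow_sum (13 * r + 5) = inv_pow_sum (n3 - m)] (mod int p)"
        by (rule per) (use 2 in linarith)
      have "[inv_pow_sum (21 * r + 8) = inv_pow_sum (9 * r + 3)] (mod int p)"
        by (rule per) (use 2 in linarith)
      moreover have "[inv_pow_sum (9 * r + 3) = inv_pow_sum m] (mod int p)"
        by (rule refl) (use 2 in linarith)
      ultimately show "[inv_pow_sum (21 * r + 8) = inv_pow_sum m] (mod int p)"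
        by (rule cong_trans)
      show "[inv_pow_sum (16 * r + 6) = inv_pow_sum n3] (mod int p)"
        by (rule per) (use 2 in linarith)
    qed (rule refl; use 2 in linarith)+
  qed
qed

lemma runit_of_nat_less: "i \<in> {1..N} \<Longrightarrow> N < p \<Longrightarrow> runit (of_nat i)"
  by (intro runit_less) auto

lemma harm_sum_R: "N < p \<Longrightarrow> harm_sum N \<in> R"
  unfolding harm_sum_def by (intro R_sum R_divide R_1 runit_of_nat_less) auto

lemma harm_sum_zcong: "N < p \<Longrightarrow> zcong 1 (harm_sum N) (of_int (inv_pow_sum N))"
  unfolding harm_sum_def inv_pow_sum_def of_int_sum
proof (rule zcong_sum)
  fix i assume "N < p" "i \<in> {1..N}"
  then have u: "runit (of_nat i)" and i: "\<not> p dvd i"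
    using runit_of_nat_less not_p_dvd_small by auto
  have "[1 = int i * int i ^ (p - 2)] (mod int p ^ 1)"
    using inv_pow[of "int i"] i by (simp add: cong_sym)
  then have "zcong 1 (of_int 1) (of_int (int i * int i ^ (p - 2)))"
    by (rule zcong_of_int)
  then have "zcong 1 (of_nat i * (1 / of_nat i)) (of_nat i * of_int (int i ^ (p - 2)))"
    using runit_nz[OF u] by simp
  then show "zcong 1 (1 / of_nat i) (of_int (int i ^ (p - 2)))"
    using u by (rule zcong_cancel)
qed

lemma harm_sum_twelfths:
  "zcong 1 (2 * harm_sum m - harm_sum (n3 + m) - harm_sum (n3 - m)) (- 2 * harm_sum n3)"
proof -
  have "zcong 1 (2 * harm_sum m - harm_sum (n3 + m) - harm_sum (n3 - m))
      (of_int (2 * inv_pow_sum m - inv_pow_sum (n3 + m) - inv_pow_sum (n3 - m)))"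
    using n3_bounds unfolding of_int_diff of_int_mult of_int_numeral
    by (intro zcong_diff zcong_cmult harm_sum_zcong) auto
  also have "zcong 1 \<dots> (of_int (- 2 * inv_pow_sum n3))"
    by (rule zcong_of_int) (use inv_pow_sum_twelfths in simp)
  also have "zcong 1 \<dots> (- 2 * harm_sum n3)"
    unfolding of_int_mult of_int_minus of_int_numeral
    using n3_bounds by (intro zcong_cmult zcong_sym[OF harm_sum_zcong]) auto
  finally show ?thesis .
qed

lemma harm_sum_reflect: "N < p \<Longrightarrow> zcong 1 (harm_sum (p - 1 - N)) (harm_sum N)"
proof -
  assume N: "N < p"
  have "zcong 1 (harm_sum (p - 1 - N)) (of_int (inv_pow_sum (p - 1 - N)))"
    using N by (intro harm_sum_zcong) auto
  also have "zcong 1 \<dots> (of_int (inv_pow_sum N))"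
    using inv_pow_sum_reflect[of N] N by (intro zcong_of_int) auto
  also have "zcong 1 \<dots> (harm_sum N)"
    using N by (intro zcong_sym[OF harm_sum_zcong])
  finally show ?thesis .
qed

text \<open>Lerch's form of the Fermat quotient: modulo p it is (3^(p-1) - 1)/p.\<close>

definition fermat_quot3 :: rat where
  "fermat_quot3 = (\<Sum>j=1..p-1. of_nat (3 * j div p) / of_nat (3 * j mod p))"

lemma three_mul_mod_bounds: "j \<in> {1..p-1} \<Longrightarrow> 0 < 3 * j mod p \<and> 3 * j mod p < p"
proof -
  assume j: "j \<in> {1..p-1}"
  then have "j < p" using p_ge by auto
  then have "\<not> p dvd 3" "\<not> p dvd j"
    using not_p_dvd_small[of 3] not_p_dvd_small[of j] j p_ge by auto
  then have "\<not> p dvd 3 * j" using prime_p by (simp add: prime_dvd_mult_iff)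
  then show ?thesis using p_ge by (simp add: mod_greater_zero_iff_not_dvd)
qed

lemma fermat_quot3_R: "fermat_quot3 \<in> R"
  unfolding fermat_quot3_def
  using three_mul_mod_bounds by (intro R_sum R_divide R_of_nat runit_less) auto

text \<open>Each 3j is its residue times 1 + p (3j div p)/(3j mod p), and the residues multiply to
  (p-1)! because multiplication by 3 permutes them.\<close>

lemma three_power_zcong: "zcong 2 (3 ^ (p - 1)) (1 + of_nat p * fermat_quot3)"
proof -
  have co: "coprime 3 p"
    using prime_p p_ge by (intro primes_coprime) auto
  have bij: "bij_betw (\<lambda>j. 3 * j mod p) {1..p-1} {1..p-1}"
    by (rule bij_betw_mult_mod_units[OF co])
  have "(\<Prod>j=1..p-1. of_nat (3 * j mod p)) = (\<Prod>j=1..p-1. (of_nat j :: rat))"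
    using prod.reindex_bij_betw[OF bij, of "of_nat :: nat \<Rightarrow> rat"] .
  then have f: "(\<Prod>j=1..p-1. of_nat (3 * j mod p)) = (fact (p - 1) :: rat)"
    by (simp add: fact_prod)
  have "3 ^ (p - 1) * fact (p - 1) = (\<Prod>j=1..p-1. 3 * (of_nat j :: rat))"
    by (simp add: fact_prod prod.distrib)
  also have "\<dots> = (\<Prod>j=1..p-1. of_nat (3 * j mod p) * (1 + of_nat p * (of_nat (3 * j div p) / of_nat (3 * j mod p))))"
  proof (rule prod.cong[OF refl])
    fix j assume j: "j \<in> {1..p-1}"
    have "of_nat (3 * j) = (of_nat (3 * j mod p + p * (3 * j div p)) :: rat)"
      by (simp only: mod_mult_div_eq)
    then have "3 * of_nat j = (of_nat (3 * j mod p) + of_nat p * of_nat (3 * j div p) :: rat)"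
      by (simp only: of_nat_add of_nat_mult of_nat_numeral)
    then show "3 * (of_nat j :: rat) = of_nat (3 * j mod p) * (1 + of_nat p * (of_nat (3 * j div p) / of_nat (3 * j mod p)))"
      using three_mul_mod_bounds[OF j] by (simp add: distrib_left)
  qed
  also have "\<dots> = fact (p - 1) * (\<Prod>j=1..p-1. 1 + of_nat p * (of_nat (3 * j div p) / of_nat (3 * j mod p)))"
    unfolding prod.distrib f ..
  finally have "3 ^ (p - 1) = (\<Prod>j=1..p-1. 1 + of_nat p * (of_nat (3 * j div p) / (of_nat (3 * j mod p) :: rat)))"
    by simp
  also have "zcong 2 \<dots> (1 + of_nat p * fermat_quot3)"
    unfolding fermat_quot3_def using three_mul_mod_bounds
    by (intro zcong_prod_one_plus R_divide R_of_nat runit_less) auto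
  finally show ?thesis .
qed

text \<open>The quotient counts which of p/3 and 2p/3 lie below j; \<open>p - 1 - n3\<close> is the
  integer part of 2p/3 in both residue classes of p modulo 3.\<close>

lemma three_mul_div:
  assumes "j \<in> {1..p-1}"
  shows "3 * j div p = of_bool (n3 < j) + of_bool (p - 1 - n3 < j)"
proof -
  consider "j \<le> n3" | "n3 < j" "j \<le> p - 1 - n3" | "p - 1 - n3 < j" "n3 < j"
    using p_mod_3 by linarith
  then show ?thesis
  proof cases
    case 1
    then show ?thesis using p_mod_3 assms by (auto intro!: div_less)
  next
    case 2
    have "p \<le> 3 * j" "3 * j < 2 * p" using 2 p_mod_3 by linarith+
    then have "3 * j div p = 1" by (intro div_nat_eqI) auto
    then show ?thesis using 2 by simp
  next
    case 3
    have "2 * p \<le> 3 * j" "j < p" using 3 p_mod_3 assms p_ge by auto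
    then have "3 * j div p = 2" by (intro div_nat_eqI) auto
    then show ?thesis using 3 by simp
  qed
qed

text \<open>Modulo p, 3/(3j mod p) is 1/j, and the two thresholds of \<open>three_mul_div\<close>
  contribute two tails of the harmonic sum, congruent to each other by reflection.\<close>

lemma fermat_quot3_zcong: "zcong 1 (3 * fermat_quot3) (- 2 * harm_sum n3)"
proof -
  have b: "n3 \<le> p - 1" "p - 1 - n3 \<le> p - 1" by auto
  have "3 * fermat_quot3 = (\<Sum>j=1..p-1. of_nat (3 * j div p) * (3 / of_nat (3 * j mod p)))"
    by (simp add: fermat_quot3_def sum_distrib_left mult_ac)
  also have "zcong 1 \<dots> (\<Sum>j=1..p-1. of_nat (3 * j div p) * (1 / of_nat j))"
  proof (intro zcong_sum zcong_cmult R_of_nat)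
    fix j assume j: "j \<in> {1..p-1}"
    have u: "runit (of_nat j)" "runit (of_nat (3 * j mod p))"
      using j three_mul_mod_bounds[OF j] by (auto intro!: runit_less)
    have "[int (3 * j) = int (3 * j mod p)] (mod int p ^ 1)"
      by (simp add: cong_def zmod_int)
    then have "zcong 1 (of_int (int (3 * j))) (of_int (int (3 * j mod p)))"
      by (rule zcong_of_int)
    then have "zcong 1 (3 * of_nat j / (of_nat j * of_nat (3 * j mod p))) (of_nat (3 * j mod p) / (of_nat j * of_nat (3 * j mod p)))"
      using u runit_3 by (intro zcong_divide runit_mult) (auto simp del: of_nat_mod simp: runit_R)
    then show "zcong 1 (3 / of_nat (3 * j mod p)) (1 / of_nat j)"
      using u[THEN runit_nz] by (simp del: of_nat_mod)
  qed
  also have "(\<Sum>j=1..p-1. of_nat (3 * j div p) * (1 / of_nat j)) =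
     (\<Sum>j=1..p-1. of_bool (n3 < j) * (1 / (of_nat j :: rat)) + of_bool (p - 1 - n3 < j) * (1 / of_nat j))"
    by (intro sum.cong) (simp_all only: three_mul_div of_nat_add of_nat_of_bool distrib_right)
  also have "\<dots> = (harm_sum (p - 1) - harm_sum n3) + (harm_sum (p - 1) - harm_sum (p - 1 - n3))"
    unfolding sum.distrib sum_of_bool_greater[OF b(1)] sum_of_bool_greater[OF b(2)] harm_sum_def ..
  also have "zcong 1 \<dots> ((0 - harm_sum n3) + (0 - harm_sum n3))"
  proof (intro zcong_add zcong_diff zcong_refl)
    show "zcong 1 (harm_sum (p - 1)) 0" "zcong 1 (harm_sum (p - 1)) 0"
      using harm_sum_reflect[of 0] p_ge by (simp_all add: harm_sum_def)
    show "zcong 1 (harm_sum (p - 1 - n3)) (harm_sum n3)"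
      using n3_bounds by (intro harm_sum_reflect) auto
  qed
  finally show ?thesis by simp
qed

text \<open>\<open>n3\<close> is -1/3 or -2/3 modulo p, and (n+i)(i-1-n) is symmetric under n ->
  -1-n, so both cases give (i-1/3)(i-2/3). More exactly, nine times the difference is (3n+1)(3n+2),
  and one of these factors is p.\<close>

lemma az_ratio_zcong_legendre_coeff:
  assumes "k < p"
  shows "zcong 1 (az_ratio k) (legendre_coeff n3 k)"
  unfolding az_ratio_eq_prod legendre_coeff_eq_prod
proof (rule zcong_prod)
  fix i assume i: "i \<in> {1..k}"
  then have u: "runit (of_nat i)" using assms runit_of_nat_less by auto
  then have u9: "runit (9 * of_nat i ^ 2)" by (intro runit_mult runit_power runit_9)
  show a: "(of_nat n3 + of_nat i) * (of_nat i - 1 - of_nat n3) / of_nat i ^ 2 \<in> R"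
    using u by (intro R_divide runit_power R_mult R_add R_diff R_of_nat R_1)
  have "int p = 3 * int n3 + 1 \<or> int p = 3 * int n3 + 2"
    using p_mod_3 by linarith
  then have "int p dvd (3 * int n3 + 1) * (3 * int n3 + 2)"
    by (elim disjE) (simp_all only: dvd_triv_left dvd_triv_right)
  then obtain c :: int where "(3 * int n3 + 1) * (3 * int n3 + 2) = int p * c"
    by (rule dvdE)
  then have "rat_of_int ((3 * int n3 + 1) * (3 * int n3 + 2)) = rat_of_int (int p * c)"
    by (simp only:)
  then have c: "(3 * of_nat n3 + 1) * (3 * of_nat n3 + 2) = of_nat p * rat_of_int c"
    by simp
  show "zcong 1 ((3 * of_nat i - 1) * (3 * of_nat i - 2) / (9 * of_nat i ^ 2))
     ((of_nat n3 + of_nat i) * (of_nat i - 1 - of_nat n3) / of_nat i ^ 2)"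
  proof (rule zcongI)
    show "of_int c / (9 * of_nat i ^ 2) \<in> R"
      using u9 by (intro R_divide) auto
    have "(of_nat n3 + of_nat i) * (of_nat i - 1 - of_nat n3) / of_nat i ^ 2 =
        9 * ((of_nat n3 + of_nat i) * (of_nat i - 1 - of_nat n3)) / (9 * of_nat i ^ 2 :: rat)"
      by simp
    then have "(3 * of_nat i - 1) * (3 * of_nat i - 2) / (9 * of_nat i ^ 2)
      - (of_nat n3 + of_nat i) * (of_nat i - 1 - of_nat n3) / of_nat i ^ 2 =
      ((3 * of_nat i - 1) * (3 * of_nat i - 2) - 9 * ((of_nat n3 + of_nat i) * (of_nat i - 1 - of_nat n3))) / (9 * of_nat i ^ 2 :: rat)"
      by (simp only: diff_divide_distrib)
    also have "(3 * of_nat i - 1) * (3 * of_nat i - 2) - 9 * ((of_nat n3 + of_nat i) * (of_nat i - 1 - of_nat n3)) =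
      (3 * of_nat n3 + 1) * (3 * of_nat n3 + 2 :: rat)"
      by (simp add: algebra_simps)
    finally show "(3 * of_nat i - 1) * (3 * of_nat i - 2) / (9 * of_nat i ^ 2)
      - (of_nat n3 + of_nat i) * (of_nat i - 1 - of_nat n3) / of_nat i ^ 2 = of_nat p ^ 1 * (of_int c / (9 * of_nat i ^ 2) :: rat)"
      unfolding c by simp
  qed
  show "(3 * of_nat i - 1) * (3 * of_nat i - 2) / (9 * of_nat i ^ 2) \<in> R"
    using u9 by (intro R_divide R_mult R_diff R_of_nat R_1 R_numeral)
qed

section \<open>The closed form at its pole, and the common value of both sums\<close>

definition pole_quotient :: rat where
  "pole_quotient = (\<Prod>i=1..n3. of_nat (4 * i) - 1) / (\<Prod>j\<in>{0..n3} - {m}. of_nat (4 * j + 1))"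

text \<open>Behind the factor p, \<open>az_ratio\<close> may be replaced by the Legendre
  coefficients, whose sum over all k < p is known exactly. \<open>pole_quotient\<close> is p times
  that sum; the term k = m, whose denominator is p, is subtracted again.\<close>

lemma off_diagonal_sum_zcong:
  "zcong 2 off_diagonal_sum (pole_quotient - legendre_coeff n3 m)"
proof -
  define f where "f k = legendre_coeff n3 k / of_nat (4 * k + 1)" for k
  have p0: "(of_nat p :: rat) \<noteq> 0" using p_ge by simp
  have "zcong 2 off_diagonal_sum (\<Sum>k\<in>{..<p} - {m}. of_nat p * f k)"
    unfolding off_diagonal_sum_def f_def
  proof (rule zcong_sum)
    fix k assume k: "k \<in> {..<p} - {m}"
    then have u: "runit (of_nat (4 * k + 1))"
      by (intro runit_of_nat not_dvd_4k1) auto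
    have "zcong 1 (inverse (of_nat (4 * k + 1)) * az_ratio k) (inverse (of_nat (4 * k + 1)) * legendre_coeff n3 k)"
      using u k by (intro zcong_cmult az_ratio_zcong_legendre_coeff runit_inverse_R) auto
    then show "zcong 2 (of_nat p * (az_ratio k / of_nat (4 * k + 1))) (of_nat p * (legendre_coeff n3 k / of_nat (4 * k + 1)))"
      by (intro zcong_p_mult_2) (simp add: divide_inverse mult.commute)
  qed
  also have "(\<Sum>k\<in>{..<p} - {m}. of_nat p * f k) = of_nat p * ((\<Sum>k<p. f k) - f m)"
    using n3_bounds by (simp add: sum_diff1 flip: sum_distrib_left)
  also have "\<dots> = of_nat p * (\<Sum>k<p. f k) - legendre_coeff n3 m"
  proof -
    have "of_nat (4 * m + 1) = (of_nat p :: rat)" by (simp only: p_eq)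
    then have "of_nat p * f m = legendre_coeff n3 m" using p0 by (simp only: f_def) simp
    then show ?thesis by (simp add: right_diff_distrib)
  qed
  also have "of_nat p * (\<Sum>k<p. f k) = pole_quotient"
  proof -
    have "n3 < p" using n3_bounds by linarith
    then have "(\<Sum>k<p. f k) = (\<Prod>i=1..n3. of_nat (4 * i) - 1) / (\<Prod>j=0..n3. of_nat (4 * j + 1))"
      unfolding f_def by (rule sum_legendre_coeff)
    moreover have "(\<Prod>j=0..n3. of_nat (4 * j + 1)) = (of_nat p :: rat) * (\<Prod>j\<in>{0..n3} - {m}. of_nat (4 * j + 1))"
      using n3_bounds by (subst prod.remove[of _ m]) (auto simp only: p_eq finite_atLeastAtMost atLeastAtMost_iff)
    ultimately show ?thesis using p0 by (simp add: pole_quotient_def)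
  qed
  finally show ?thesis .
qed

lemma prod_atLeastAtMost_reflect: "(\<Prod>i<N. f i) = (\<Prod>d=1..N. f (N - d))" for N :: nat
  by (rule prod.reindex_bij_witness[where i = "\<lambda>d. N - d" and j = "\<lambda>d. N - d"]) auto

lemma prod_atLeastAtMost_shift: "(\<Prod>i=k+1..N. f i) = (\<Prod>d=1..N-k. f (k + d))" if "k \<le> N" for N k :: nat
  by (rule prod.reindex_bij_witness[where i = "\<lambda>d. k + d" and j = "\<lambda>d. d - k"]) (use that in auto)

definition pole_factor :: "nat \<Rightarrow> rat" where "pole_factor d = 1 / (4 * of_nat d)"

text \<open>All factors are centred at p: 4i - 1 = 4(m+i) - p, while 4j + 1 is p - 4(m-j) or p +
  4(j-m). Each is then, up to sign, 4d times 1 + p/(4d) or 1 - p/(4d), and the leading parts combine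
  exactly to \<open>legendre_coeff n3 m\<close>.\<close>

lemma pole_quotient_eq:
  "pole_quotient * ((\<Prod>d=1..m. 1 + of_nat p * (- pole_factor d)) * (\<Prod>d=1..n3-m. 1 + of_nat p * pole_factor d))
    = legendre_coeff n3 m * (\<Prod>e=m+1..n3+m. 1 + of_nat p * (- pole_factor e))"
proof -
  define X where "X = (\<Prod>e=m+1..n3+m. 1 + of_nat p * (- pole_factor e))"
  define Y where "Y = (\<Prod>d=1..m. 1 + of_nat p * (- pole_factor d))"
  define Z where "Z = (\<Prod>d=1..n3-m. 1 + of_nat p * pole_factor d)"
  define E where "E = (\<Prod>e=m+1..n3+m. (of_nat e :: rat))"
  have fe: "fact (n3 + m) = fact m * E"
  proof -
    have "{1..n3+m} = {1..m} \<union> {m+1..n3+m}" by auto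
    then have "\<Prod>{1..n3+m} = \<Prod>{1..m} * \<Prod>{m+1..n3+m}"
      by (simp add: prod.union_disjoint)
    then show ?thesis unfolding fact_prod E_def by simp
  qed
  have num: "(\<Prod>i=1..n3. of_nat (4 * i) - 1) = 4 ^ n3 * E * X"
  proof -
    have "4 ^ n3 * E * X = (\<Prod>e=m+1..n3+m. 4 * of_nat e * (1 + of_nat p * (- pole_factor e)))"
      by (simp add: E_def X_def prod.distrib)
    also have "\<dots> = (\<Prod>d=1..n3. 4 * of_nat (m + d) * (1 + of_nat p * (- pole_factor (m + d))))"
      by (subst prod_atLeastAtMost_shift[of m "n3 + m"]) simp_all
    also have "\<dots> = (\<Prod>i=1..n3. of_nat (4 * i) - 1)"
    proof (rule prod.cong[OF refl])
      fix d assume "d \<in> {1..n3}"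
      have "4 * of_nat (m + d) * (1 + of_nat p * (- pole_factor (m + d))) = 4 * of_nat (m + d) - (of_nat p :: rat)"
        using m_pos by (simp add: pole_factor_def right_diff_distrib del: of_nat_add)
      also have "\<dots> = of_nat (4 * d) - 1" by (simp add: p_eq)
      finally show "4 * of_nat (m + d) * (1 + of_nat p * (- pole_factor (m + d))) = of_nat (4 * d) - 1" .
    qed
    finally show ?thesis ..
  qed
  have den1: "(\<Prod>j<m. of_nat (4 * j + 1)) = (-4) ^ m * fact m * Y"
  proof -
    have "(-4) ^ m * fact m * Y = (\<Prod>d=1..m. -4 * of_nat d * (1 + of_nat p * (- pole_factor d)))"
      unfolding fact_prod Y_def prod.distrib prod_constant by simp
    also have "\<dots> = (\<Prod>d=1..m. of_nat (4 * (m - d) + 1))"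
    proof (rule prod.cong[OF refl])
      fix d assume d: "d \<in> {1..m}"
      then have "-4 * of_nat d * (1 + of_nat p * (- pole_factor d)) = (of_nat p :: rat) - 4 * of_nat d"
        by (simp add: pole_factor_def right_diff_distrib)
      also have "\<dots> = of_nat (4 * (m - d) + 1)" using d by (simp add: p_eq of_nat_diff)
      finally show "-4 * of_nat d * (1 + of_nat p * (- pole_factor d)) = of_nat (4 * (m - d) + 1)" .
    qed
    finally show ?thesis by (simp only: prod_atLeastAtMost_reflect)
  qed
  have den2: "(\<Prod>j=m+1..n3. of_nat (4 * j + 1)) = 4 ^ (n3 - m) * fact (n3 - m) * Z"
  proof -
    have "4 ^ (n3 - m) * fact (n3 - m) * Z = (\<Prod>d=1..n3-m. 4 * of_nat d * (1 + of_nat p * pole_factor d))"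
      by (simp add: fact_prod Z_def prod.distrib)
    also have "\<dots> = (\<Prod>d=1..n3-m. of_nat (4 * (m + d) + 1))"
    proof (rule prod.cong[OF refl])
      fix d assume d: "d \<in> {1..n3-m}"
      then have "4 * of_nat d * (1 + of_nat p * pole_factor d) = 4 * of_nat d + (of_nat p :: rat)"
        by (simp add: pole_factor_def distrib_left)
      also have "\<dots> = of_nat (4 * (m + d) + 1)" by (simp add: p_eq)
      finally show "4 * of_nat d * (1 + of_nat p * pole_factor d) = of_nat (4 * (m + d) + 1)" .
    qed
    finally show ?thesis
      using prod_atLeastAtMost_shift[OF n3_bounds(1), of "\<lambda>j. of_nat (4 * j + 1)"] by (simp only:)
  qed
  have split: "{0..n3} - {m} = {..<m} \<union> {m+1..n3}" using n3_bounds by auto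
  have den: "(\<Prod>j\<in>{0..n3} - {m}. of_nat (4 * j + 1)) =
     ((-4) ^ m * fact m * Y) * (4 ^ (n3 - m) * fact (n3 - m) * Z)"
    unfolding split den1[symmetric] den2[symmetric] by (rule prod.union_disjoint) auto
  have nz: "(\<Prod>j\<in>{0..n3} - {m}. of_nat (4 * j + 1)) \<noteq> (0 :: rat)"
    by (simp add: prod_zero_iff flip: of_nat_Suc)
  then have YZ: "Y \<noteq> 0" "Z \<noteq> 0" unfolding den by auto
  have "int n3 - int m = int (n3 - m)" using n3_bounds by simp
  then have "legendre_coeff n3 m = (-1) ^ m * fact (n3 + m) * (1 / fact (n3 - m)) / fact m ^ 2"
    unfolding legendre_coeff_def by (simp only: recip_fact_of_nat)
  then have L: "legendre_coeff n3 m = (-1) ^ m * E / (fact (n3 - m) * fact m)"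
    unfolding fe by (simp add: power2_eq_square)
  have "(-4 :: rat) ^ m * 4 ^ (n3 - m) = (-1) ^ m * 4 ^ n3"
    using n3_bounds by (simp add: power_minus[of 4] flip: power_add)
  then have "4 ^ n3 * E * X / (((-4) ^ m * fact m * Y) * (4 ^ (n3 - m) * fact (n3 - m) * Z)) * (Y * Z)
      = 4 ^ n3 * E * X / (((-1) ^ m * 4 ^ n3) * (fact m * fact (n3 - m)))"
    using YZ by (simp add: field_simps)
  also have "\<dots> = legendre_coeff n3 m * X"
    unfolding L by (cases "even m") (simp_all add: field_simps)
  finally show ?thesis
    unfolding pole_quotient_def num den X_def Y_def Z_def .
qed

lemma runit_legendre_coeff: "runit (legendre_coeff n3 m)"
proof -
  have "int n3 - int m = int (n3 - m)" using n3_bounds by simp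
  then have L: "legendre_coeff n3 m = (-1) ^ m * fact (n3 + m) * (1 / fact (n3 - m)) / fact m ^ 2"
    unfolding legendre_coeff_def by (simp only: recip_fact_of_nat)
  show ?thesis unfolding L using n3_bounds
    by (intro runit_divide runit_mult runit_power runit_fact runit_uminus runit_1) auto
qed

lemma pole_factor_R: "i \<in> {1..N} \<Longrightarrow> N < p \<Longrightarrow> pole_factor i \<in> R"
  unfolding pole_factor_def by (intro R_divide R_1 runit_mult runit_4 runit_of_nat_less)

lemma sum_pole_factor: "(\<Sum>d=1..N. pole_factor d) = harm_sum N / 4"
  by (simp add: harm_sum_def pole_factor_def sum_divide_distrib mult.commute)

lemma runit_1_plus:
  assumes "c \<in> R"
  shows "runit (1 + of_nat p * c)"
proof -
  obtain a b where ab: "\<not> int p dvd b" "c = of_int a / of_int b"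
    using assms unfolding Z_ring_iff by blast
  then have "b \<noteq> 0" by auto
  then have "1 + of_nat p * c = of_int (b + int p * a) / of_int b"
    using ab by (simp add: field_simps)
  moreover have "\<not> int p dvd b + int p * a"
    using ab by (simp add: dvd_add_left_iff)
  ultimately show ?thesis
    using ab by (metis runit_divide runit_of_int)
qed

lemma zcong_1_plus_mult:
  assumes "x \<in> R" "y \<in> R"
  shows "zcong 2 ((1 + of_nat p * x) * (1 + of_nat p * y)) (1 + of_nat p * (x + y))"
  using assms by (intro zcongI[of "x * y"]) (auto simp: algebra_simps power2_eq_square)

lemma three_power_zcong': "zcong 2 (3 ^ ((p - 1) * (m + 1))) (1 + of_nat p * (of_nat (m + 1) * fermat_quot3))"
proof -
  have "zcong 2 (3 ^ ((p - 1) * (m + 1))) ((1 + of_nat p * fermat_quot3) ^ (m + 1))"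
    unfolding power_mult using fermat_quot3_R by (intro zcong_power three_power_zcong) auto
  also have "(1 + of_nat p * fermat_quot3) ^ (m + 1) = (\<Prod>i<m+1. 1 + of_nat p * fermat_quot3)"
    by simp
  also have "zcong 2 \<dots> (1 + of_nat p * (\<Sum>i<m+1. fermat_quot3))"
    using fermat_quot3_R by (intro zcong_prod_one_plus) auto
  also have "(\<Sum>i<m+1. fermat_quot3) = of_nat (m + 1) * fermat_quot3" by simp
  finally show ?thesis .
qed

text \<open>To first order in p the claim is 4q + H(n3-m) - H(m) = H(m) - H(n3+m) modulo p, with H
  for \<open>harm_sum\<close> and q = (m+1) \<open>fermat_quot3\<close>. This is
  \<open>harm_sum_twelfths\<close> combined with \<open>fermat_quot3_zcong\<close>.\<close>

lemma pole_quotient_zcong: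
  "zcong 2 pole_quotient (legendre_coeff n3 m * 3 ^ ((p - 1) * (m + 1)))"
proof -
  define L where "L = legendre_coeff n3 m"
  define X where "X = (\<Prod>e=m+1..n3+m. 1 + of_nat p * (- pole_factor e))"
  define Y where "Y = (\<Prod>d=1..m. 1 + of_nat p * (- pole_factor d))"
  define Z where "Z = (\<Prod>d=1..n3-m. 1 + of_nat p * pole_factor d)"
  define q where "q = of_nat (m + 1) * fermat_quot3"
  note b = n3_bounds
  have pf: "pole_factor i \<in> R" if "0 < i" "i \<le> n3 + m" for i
    using pole_factor_R[of i "n3 + m"] that b by auto
  have H: "harm_sum N / 4 \<in> R" if "N < p" for N
    using harm_sum_R[OF that] runit_4 by (intro R_divide)
  have q: "q \<in> R" unfolding q_def by (intro R_mult fermat_quot3_R) auto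
  have s: "(\<Sum>e=m+1..n3+m. pole_factor e) = harm_sum (n3 + m) / 4 - harm_sum m / 4"
  proof -
    have "{1..n3+m} = {1..m} \<union> {m+1..n3+m}" by auto
    then have "(\<Sum>e=1..n3+m. pole_factor e) = (\<Sum>e=1..m. pole_factor e) + (\<Sum>e=m+1..n3+m. pole_factor e)"
      by (simp add: sum.union_disjoint)
    then show ?thesis unfolding sum_pole_factor by linarith
  qed
  have X: "zcong 2 X (1 + of_nat p * (harm_sum m / 4 - harm_sum (n3 + m) / 4))"
  proof -
    have "zcong 2 X (1 + of_nat p * (\<Sum>e=m+1..n3+m. - pole_factor e))"
      unfolding X_def by (intro zcong_prod_one_plus) (auto intro!: pf)
    then show ?thesis by (simp only: sum_negf s minus_diff_eq)
  qed
  have Y: "zcong 2 Y (1 + of_nat p * (- (harm_sum m / 4)))"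
  proof -
    have "zcong 2 Y (1 + of_nat p * (\<Sum>d=1..m. - pole_factor d))"
      unfolding Y_def by (intro zcong_prod_one_plus) (auto intro!: pf)
    then show ?thesis by (simp only: sum_negf sum_pole_factor)
  qed
  have Z: "zcong 2 Z (1 + of_nat p * (harm_sum (n3 - m) / 4))"
  proof -
    have "zcong 2 Z (1 + of_nat p * (\<Sum>d=1..n3-m. pole_factor d))"
      unfolding Z_def by (intro zcong_prod_one_plus) (auto intro!: pf)
    then show ?thesis by (simp only: sum_pole_factor)
  qed
  have ZR: "Z \<in> R" unfolding Z_def by (intro R_prod R_add R_mult R_uminus R_1 R_of_nat pf) auto
  have YR: "Y \<in> R" unfolding Y_def by (intro R_prod R_add R_mult R_uminus R_1 R_of_nat pf) auto
  have XR: "X \<in> R" unfolding X_def by (intro R_prod R_add R_mult R_uminus R_1 R_of_nat pf) auto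
  have YZ: "zcong 2 (Y * Z) (1 + of_nat p * (- (harm_sum m / 4) + harm_sum (n3 - m) / 4))"
  proof -
    have "zcong 2 (Y * Z) ((1 + of_nat p * (- (harm_sum m / 4))) * (1 + of_nat p * (harm_sum (n3 - m) / 4)))"
      using b by (intro zcong_mult Y Z YR R_add R_mult R_1 R_of_nat H) auto
    also have "zcong 2 \<dots> (1 + of_nat p * (- (harm_sum m / 4) + harm_sum (n3 - m) / 4))"
      using b by (intro zcong_1_plus_mult R_uminus H) auto
    finally show ?thesis .
  qed
  have "zcong 2 (3 ^ ((p - 1) * (m + 1)) * (Y * Z)) ((1 + of_nat p * q) * (1 + of_nat p * (- (harm_sum m / 4) + harm_sum (n3 - m) / 4)))"
    unfolding q_def using b
    by (intro zcong_mult three_power_zcong' YZ R_power R_add R_mult R_1 R_of_nat R_numeral R_uminus H) auto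
  also have "zcong 2 \<dots> (1 + of_nat p * (q + (- (harm_sum m / 4) + harm_sum (n3 - m) / 4)))"
    using b by (intro zcong_1_plus_mult q R_add R_uminus H) auto
  also have "zcong 2 \<dots> (1 + of_nat p * (harm_sum m / 4 - harm_sum (n3 + m) / 4))"
  proof (intro zcong_add zcong_refl zcong_p_mult_2)
    \<comment> \<open>The origin of the exponent m + 1: it is 3/4 modulo p, since 4(m+1) = p +
      3.\<close>
    have "zcong 1 (4 * q) (3 * fermat_quot3)"
    proof (rule zcongI[OF fermat_quot3_R])
      have e: "(4 * of_nat (m + 1) :: rat) = of_nat p + 3" by (simp add: p_eq)
      then show "4 * q - 3 * fermat_quot3 = of_nat p ^ 1 * fermat_quot3"
        unfolding q_def mult.assoc[symmetric] e by (simp add: distrib_right)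
    qed
    also note fermat_quot3_zcong
    also note zcong_sym[OF harm_sum_twelfths]
    finally have "zcong 1 (4 * q + (harm_sum (n3 - m) - harm_sum m))
       (2 * harm_sum m - harm_sum (n3 + m) - harm_sum (n3 - m) + (harm_sum (n3 - m) - harm_sum m))"
      by (intro zcong_add zcong_refl)
    then have "zcong 1 (4 * (q + (- (harm_sum m / 4) + harm_sum (n3 - m) / 4)))
       (4 * (harm_sum m / 4 - harm_sum (n3 + m) / 4))"
      by (simp add: algebra_simps)
    then show "zcong 1 (q + (- (harm_sum m / 4) + harm_sum (n3 - m) / 4)) (harm_sum m / 4 - harm_sum (n3 + m) / 4)"
      using runit_4 by (rule zcong_cancel)
  qed
  also note zcong_sym[OF X]
  finally have main: "zcong 2 (3 ^ ((p - 1) * (m + 1)) * (Y * Z)) X" .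
  have LR: "L \<in> R" unfolding L_def by (rule runit_R[OF runit_legendre_coeff])
  have "zcong 2 ((Y * Z) * (L * 3 ^ ((p - 1) * (m + 1)))) (L * X)"
    using zcong_cmult[OF main LR] by (simp only: mult_ac)
  also have "L * X = (Y * Z) * pole_quotient"
    using pole_quotient_eq unfolding L_def X_def Y_def Z_def by (simp only: mult_ac)
  finally have e: "zcong 2 ((Y * Z) * (L * 3 ^ ((p - 1) * (m + 1)))) ((Y * Z) * pole_quotient)" .
  have "runit (Y * Z)"
    unfolding Y_def Z_def by (intro runit_mult runit_prod runit_1_plus) (auto intro!: pf)
  then show ?thesis
    using zcong_sym[OF zcong_cancel[OF e]] by (simp add: L_def)
qed

text \<open>The correction L (E - 1) carries a factor p, so L may be replaced by
  \<open>az_ratio m\<close>, and the summands merge to \<open>az_ratio m * E\<close>. As (p-1)(m+1)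
  = 3m + pm, the power 27^m in the denominator cancels.\<close>

lemma common_sum_zcong:
  "zcong 2 (az_ratio m + off_diagonal_sum) (fact (3 * m) / fact m ^ 3 * 3 ^ (p * m))"
proof -
  define L where "L = legendre_coeff n3 m"
  define E :: rat where "E = 3 ^ ((p - 1) * (m + 1))"
  define q where "q = of_nat (m + 1) * fermat_quot3"
  have q: "q \<in> R" unfolding q_def by (intro R_mult fermat_quot3_R R_of_nat)
  have LR: "L \<in> R" unfolding L_def by (rule runit_R[OF runit_legendre_coeff])
  have LM: "zcong 1 L (az_ratio m)"
    unfolding L_def using n3_bounds by (intro zcong_sym[OF az_ratio_zcong_legendre_coeff]) auto
  have MR: "az_ratio m \<in> R"
    using zcong_R[OF zcong_sym[OF LM] LR] .
  have E: "zcong 2 (E - 1) (of_nat p * q)"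
    using zcong_diff[OF three_power_zcong' zcong_refl, of 1] by (simp add: E_def q_def)
  have "zcong 2 (az_ratio m + off_diagonal_sum) (az_ratio m + (L * E - L))"
    unfolding L_def E_def
    by (intro zcong_add zcong_refl zcong_trans[OF off_diagonal_sum_zcong] zcong_diff pole_quotient_zcong)
  also have "az_ratio m + (L * E - L) = az_ratio m + L * (E - 1)"
    by (simp add: right_diff_distrib)
  also have "zcong 2 \<dots> (az_ratio m + L * (of_nat p * q))"
    using E LR by (intro zcong_add zcong_refl zcong_cmult)
  also have "L * (of_nat p * q) = of_nat p * (q * L)" by simp
  also have "zcong 2 (az_ratio m + of_nat p * (q * L)) (az_ratio m + of_nat p * (q * az_ratio m))"
    using q LM by (intro zcong_add zcong_refl zcong_p_mult_2 zcong_cmult)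
  also have "of_nat p * (q * az_ratio m) = az_ratio m * (of_nat p * q)" by simp
  also have "zcong 2 (az_ratio m + az_ratio m * (of_nat p * q)) (az_ratio m + az_ratio m * (E - 1))"
    using zcong_sym[OF E] MR by (intro zcong_add zcong_refl zcong_cmult)
  also have "az_ratio m + az_ratio m * (E - 1) = az_ratio m * E"
    by (simp add: right_diff_distrib)
  also have "\<dots> = fact (3 * m) / fact m ^ 3 * 3 ^ (p * m)"
  proof -
    have "(p - 1) * (m + 1) = 3 * m + p * m" by (simp add: p_eq algebra_simps)
    then have "E = 27 ^ m * 3 ^ (p * m)" by (simp add: E_def power_add power_mult)
    then show ?thesis by (simp add: az_ratio_def)
  qed
  finally show ?thesis .
qed

section \<open>The central term as a square of a binomial expression\<close>

lemma jacobi_value_square: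
  fixes u :: int
  assumes "[2 * u = (int p - 1) * (-1) ^ m * (3 * int (2 * m choose m) - 2 * int (6 * m choose m))] (mod int p ^ 2)"
  shows "zcong 2 (of_int (u ^ 2)) ((-1) ^ m * (fact (3 * m) / fact m ^ 3))"
proof -
  \<comment> \<open>Both sides of the claim will be b^2 (1 - p h) modulo p^2: the factors beyond 2m
    in the factorials are written as p - e or p + e with e in m+1..2m.\<close>
  define b :: rat where "b = of_nat (2 * m choose m)"
  define c :: rat where "c = of_nat (6 * m choose m)"
  define h :: rat where "h = (\<Sum>e=m+1..2*m. 1 / of_nat e)"
  define V :: rat where "V = (\<Prod>e=m+1..2*m. of_nat e)"
  define G :: rat where "G = (\<Prod>e=m+1..2*m. 1 + of_nat p * (1 / of_nat e))"
  define G' :: rat where "G' = (\<Prod>e=m+1..2*m. 1 + of_nat p * (- (1 / of_nat e)))"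
  have ur: "runit (of_nat e)" if "e \<in> {m+1..2*m}" for e
    using that p_eq by (intro runit_less) auto
  have hR: "h \<in> R" unfolding h_def using ur by (intro R_sum R_divide R_1)
  have bR: "b \<in> R" unfolding b_def by (rule R_of_nat)
  have G: "zcong 2 G (1 + of_nat p * h)"
    unfolding G_def h_def using ur by (intro zcong_prod_one_plus R_divide R_1) auto
  have "zcong 2 G' (1 + of_nat p * (\<Sum>e=m+1..2*m. - (1 / of_nat e)))"
    unfolding G'_def using ur by (intro zcong_prod_one_plus R_uminus R_divide R_1) auto
  then have G': "zcong 2 G' (1 - of_nat p * h)"
    by (simp add: h_def sum_negf)
  have f2: "fact (2 * m) = fact m * V"
  proof -
    have "{1..2*m} = {1..m} \<union> {m+1..2*m}" by auto
    then have "\<Prod>{1..2*m} = \<Prod>{1..m} * \<Prod>{m+1..2*m}"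
      by (simp add: prod.union_disjoint)
    then show ?thesis unfolding fact_prod V_def by simp
  qed
  have f3: "fact (3 * m) = fact (2 * m) * ((-1) ^ m * V * G')"
  proof -
    have "{1..3*m} = {1..2*m} \<union> {2*m+1..3*m}" by auto
    then have "\<Prod>{1..3*m} = \<Prod>{1..2*m} * \<Prod>{2*m+1..3*m}"
      by (simp add: prod.union_disjoint)
    then have "fact (3 * m) = fact (2 * m) * (\<Prod>i=2*m+1..3*m. (of_nat i :: rat))"
      unfolding fact_prod by simp
    also have "(\<Prod>i=2*m+1..3*m. (of_nat i :: rat)) = (\<Prod>e=m+1..2*m. of_nat (p - e))"
      by (rule prod.reindex_bij_witness[where i = "\<lambda>i. p - i" and j = "\<lambda>i. p - i"])
         (use p_eq in auto)
    also have "\<dots> = (\<Prod>e=m+1..2*m. (-1) * of_nat e * (1 + of_nat p * (- (1 / of_nat e))))"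
      using p_eq by (intro prod.cong) (auto simp: of_nat_diff right_diff_distrib)
    also have "\<dots> = (-1) ^ m * V * G'"
      unfolding prod.distrib prod_constant V_def G'_def by simp
    finally show ?thesis .
  qed
  \<comment> \<open>The factors p + e with e in m+1..2m fill 5m+2..6m+1, one place beyond
    (6m)!/(5m)!; hence the additional 6m + 1 and 5m + 1.\<close>
  have f6: "fact (6 * m) * of_nat (6 * m + 1) = fact (5 * m) * (V * G) * of_nat (5 * m + 1)"
  proof -
    have "{1..6*m+1} = {1..5*m+1} \<union> {5*m+2..6*m+1}" by auto
    then have "\<Prod>{1..6*m+1} = \<Prod>{1..5*m+1} * \<Prod>{5*m+2..6*m+1}"
      by (simp add: prod.union_disjoint)
    then have "fact (6 * m + 1) = fact (5 * m + 1) * (\<Prod>i=5*m+2..6*m+1. (of_nat i :: rat))"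
      unfolding fact_prod by (simp only: of_nat_mult of_nat_prod)
    also have "(\<Prod>i=5*m+2..6*m+1. (of_nat i :: rat)) = (\<Prod>e=m+1..2*m. of_nat (p + e))"
      by (rule prod.reindex_bij_witness[where i = "\<lambda>e. p + e" and j = "\<lambda>i. i - p"])
         (use p_eq in auto)
    also have "\<dots> = (\<Prod>e=m+1..2*m. of_nat e * (1 + of_nat p * (1 / of_nat e)))"
      by (intro prod.cong) (auto simp: distrib_left)
    also have "\<dots> = V * G"
      unfolding prod.distrib V_def G_def ..
    finally show ?thesis by (simp add: mult_ac)
  qed
  have b: "b * fact m = V"
    unfolding b_def using f2 by (simp add: binomial_fact)
  have c: "c * of_nat (6 * m + 1) = b * G * of_nat (5 * m + 1)"
  proof -
    have cf: "c * (fact m * fact (5 * m)) = fact (6 * m)"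
      unfolding c_def by (simp add: binomial_fact)
    have nz: "fact m * fact (5 * m) \<noteq> (0 :: rat)" by simp
    have "(c * of_nat (6 * m + 1)) * (fact m * fact (5 * m)) = (c * (fact m * fact (5 * m))) * of_nat (6 * m + 1)"
      by (simp only: mult_ac)
    also have "\<dots> = fact (5 * m) * (V * G) * of_nat (5 * m + 1)"
      unfolding cf by (rule f6)
    also have "\<dots> = (b * G * of_nat (5 * m + 1)) * (fact m * fact (5 * m))"
      unfolding b[symmetric] by (simp only: mult_ac)
    finally show ?thesis
      by (rule mult_right_cancel[THEN iffD1, OF nz])
  qed
  have "(-1) ^ m * (fact (3 * m) / fact m ^ 3) = b ^ 2 * G'"
    unfolding f3 f2 b[symmetric] by (cases "even m") (simp_all add: field_simps power2_eq_square power3_eq_cube)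
  also have "zcong 2 (b ^ 2 * G') (b ^ 2 * (1 - of_nat p * h))"
    using G' bR by (intro zcong_cmult) auto
  finally have R: "zcong 2 ((-1) ^ m * (fact (3 * m) / fact m ^ 3)) (b ^ 2 * (1 - of_nat p * h))" .
  \<comment> \<open>With 4m = p - 1 the ratio 2(5m+1)/(6m+1) is (1-5p)/(1-3p), which is 1 - 2p
    modulo p^2.\<close>
  have "zcong 2 (2 * c) (b * (1 + of_nat p * (h - 2)))"
  proof (rule zcong_cancel)
    show "runit (of_nat (6 * m + 1))"
    proof (intro runit_of_nat)
      have e: "6 * m + 1 = p + 2 * m" by (simp add: p_eq)
      have "\<not> p dvd 2 * m"
        using not_p_dvd_small[of "2 * m"] m_pos p_eq by simp
      then show "\<not> p dvd 6 * m + 1" unfolding e by (simp only: dvd_add_triv_left_iff not_False_eq_True)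
    qed
    have "of_nat (6 * m + 1) * (2 * c) = 2 * (c * of_nat (6 * m + 1))" by (simp only: mult_ac)
    also have "\<dots> = (b * (2 * of_nat (5 * m + 1))) * G"
      unfolding c by (simp only: mult_ac)
    also have "zcong 2 \<dots> ((b * (2 * of_nat (5 * m + 1))) * (1 + of_nat p * h))"
      using G bR by (intro zcong_cmult) auto
    also have "zcong 2 \<dots> (of_nat (6 * m + 1) * (b * (1 + of_nat p * (h - 2))))"
    proof (rule zcongI)
      show "b * (h + 3) \<in> R" using bR hR by auto
      define x :: rat where "x = of_nat m"
      have p: "of_nat p = 4 * x + 1" by (simp add: x_def p_eq)
      show "b * (2 * of_nat (5 * m + 1)) * (1 + of_nat p * h) - of_nat (6 * m + 1) * (b * (1 + of_nat p * (h - 2)))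
         = of_nat p ^ 2 * (b * (h + 3))"
        unfolding p by (simp add: algebra_simps power2_eq_square flip: x_def)
    qed
    finally show "zcong 2 (of_nat (6 * m + 1) * (2 * c)) (of_nat (6 * m + 1) * (b * (1 + of_nat p * (h - 2))))" .
  qed
  then have d: "zcong 2 (3 * b - 2 * c) (3 * b - b * (1 + of_nat p * (h - 2)))"
    by (intro zcong_diff zcong_refl)
  have "zcong 2 (of_int (2 * u)) (of_int ((int p - 1) * (-1) ^ m * (3 * int (2 * m choose m) - 2 * int (6 * m choose m))))"
    using assms by (rule zcong_of_int)
  also have "of_int ((int p - 1) * (-1) ^ m * (3 * int (2 * m choose m) - 2 * int (6 * m choose m)))
      = (of_nat p - 1) * (-1) ^ m * (3 * b - 2 * c)"
    by (simp add: b_def c_def)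
  also have "zcong 2 \<dots> ((of_nat p - 1) * (-1) ^ m * (3 * b - b * (1 + of_nat p * (h - 2))))"
    using d by (intro zcong_cmult) auto
  \<comment> \<open>Multiplication by p - 1 removes the term 2p from 2 + 2p - ph.\<close>
  also have "zcong 2 \<dots> ((-1) ^ m * b * (of_nat p * h - 2))"
  proof (rule zcongI)
    show "(-1) ^ m * b * (2 - h) \<in> R" using bR hR by auto
  qed (simp add: algebra_simps power2_eq_square)
  finally have u: "zcong 2 (of_int (2 * u)) ((-1) ^ m * b * (of_nat p * h - 2))" .
  have "zcong 2 (of_int (2 * u) ^ 2) (((-1) ^ m * b * (of_nat p * h - 2)) ^ 2)"
    using u bR hR by (intro zcong_power) auto
  also have "((-1) ^ m * b * (of_nat p * h - 2)) ^ 2 = b ^ 2 * (of_nat p * h - 2) ^ 2"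
    by (simp add: power_mult_distrib flip: power_mult)
  also have "zcong 2 \<dots> (4 * (b ^ 2 * (1 - of_nat p * h)))"
  proof (rule zcongI)
    show "b ^ 2 * h ^ 2 \<in> R" using bR hR by auto
  qed (simp add: algebra_simps power2_eq_square)
  also have "of_int (2 * u) ^ 2 = (4 * of_int (u ^ 2) :: rat)" by (simp add: power_mult_distrib)
  finally have "zcong 2 (of_int (u ^ 2)) (b ^ 2 * (1 - of_nat p * h))"
    using runit_4 by (rule zcong_cancel)
  also note zcong_sym[OF R]
  finally show ?thesis .
qed

text \<open>As p is odd, the sign (-1)^m of \<open>jacobi_value_square\<close> turns 3^(pm) into
  (-3)^(pm); this is how the quartic character at -3 enters.\<close>

lemma sums_zcong_jacobi_value:
  fixes u :: int
  assumes "[2 * u = (int p - 1) * (-1) ^ m * (3 * int (2 * m choose m) - 2 * int (6 * m choose m))] (mod int p ^ 2)"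
  shows "zcong 2 (\<Sum>n<p. of_int (almkvist_zudilin n) / (-3) ^ n) (of_int ((-3) ^ (p * m) * u ^ 2))"
    and "zcong 2 (\<Sum>n<p. of_int (almkvist_zudilin n) / (-27) ^ n) (of_int ((-3) ^ (p * m) * u ^ 2))"
proof -
  have "odd p" using p_eq by simp
  then have s: "(-3) ^ (p * m) = ((-1) ^ m * 3 ^ (p * m) :: rat)"
    by (cases "even m") (simp_all add: power_minus_odd power_minus_even)
  have "zcong 2 ((-3) ^ (p * m) * of_int (u ^ 2)) ((-3) ^ (p * m) * ((-1) ^ m * (fact (3 * m) / fact m ^ 3)))"
    using R_of_int[of "-3"] by (intro zcong_cmult jacobi_value_square[OF assms] R_power) auto
  also have "(-3) ^ (p * m) * ((-1) ^ m * (fact (3 * m) / fact m ^ 3)) = (fact (3 * m) / fact m ^ 3 * 3 ^ (p * m) :: rat)"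
    unfolding s by (cases "even m") simp_all
  finally have a: "zcong 2 (of_int ((-3) ^ (p * m) * u ^ 2)) (fact (3 * m) / fact m ^ 3 * 3 ^ (p * m))"
    by simp
  note b = zcong_trans[OF common_sum_zcong zcong_sym[OF a]]
  show "zcong 2 (\<Sum>n<p. of_int (almkvist_zudilin n) / (-3) ^ n) (of_int ((-3) ^ (p * m) * u ^ 2))"
    by (rule zcong_trans[OF sums_zcong_off_diagonal(1) b])
  show "zcong 2 (\<Sum>n<p. of_int (almkvist_zudilin n) / (-27) ^ n) (of_int ((-3) ^ (p * m) * u ^ 2))"
    by (rule zcong_trans[OF sums_zcong_off_diagonal(2) b])
qed

end

text \<open>The cofactor of a - b in a^n - b^n is n b^(n-1) modulo P, hence divisible by P. So x^p
  modulo p^2 depends only on x modulo p, which makes it a multiplicative lift of residues.\<close>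

lemma cong_power_p:
  fixes a b P :: int
  assumes "[a = b] (mod P)" "P = int n" "n > 0"
  shows "[a ^ n = b ^ n] (mod P ^ 2)"
proof -
  obtain k where n: "n = Suc k" using assms(3) gr0_implies_Suc by blast
  have "[(\<Sum>i<n. a ^ i * b ^ (k - i)) = (\<Sum>i<n. b ^ i * b ^ (k - i))] (mod P)"
    using assms(1) by (intro cong_sum cong_mult cong_pow cong_refl)
  also have "(\<Sum>i<n. b ^ i * b ^ (k - i)) = P * b ^ k"
  proof -
    have "(\<Sum>i<n. b ^ i * b ^ (k - i)) = (\<Sum>i<n. b ^ k)"
      by (intro sum.cong) (auto simp: n simp flip: power_add)
    then show ?thesis by (simp add: assms(2))
  qed
  finally have "P dvd (\<Sum>i<n. a ^ i * b ^ (k - i))"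
    by (metis cong_dvd_iff dvd_triv_left)
  moreover have "P dvd a - b" using assms(1) by (simp add: cong_iff_dvd_diff)
  ultimately have "P * P dvd (a - b) * (\<Sum>i<n. a ^ i * b ^ (k - i))"
    by (rule mult_dvd_mono[rotated])
  also have "(a - b) * (\<Sum>i<n. a ^ i * b ^ (k - i)) = a ^ n - b ^ n"
    unfolding n by (rule diff_power_eq_sum[symmetric])
  finally show ?thesis by (simp add: cong_iff_dvd_diff power2_eq_square)
qed

section \<open>A quartic Jacobi sum\<close>

context p_integral
begin

abbreviation P :: int where "P \<equiv> int p"

abbreviation residues_p :: "int set" where "residues_p \<equiv> {0..<P}"

definition periodic :: "(int \<Rightarrow> 'a) \<Rightarrow> bool" where
  "periodic f \<longleftrightarrow> (\<forall>x y. [x = y] (mod P) \<longrightarrow> f x = f y)"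

lemma periodicD: "periodic f \<Longrightarrow> [x = y] (mod P) \<Longrightarrow> f x = f y"
  by (auto simp: periodic_def)

lemma periodic_mod: "periodic f \<Longrightarrow> f (x mod P) = f x"
  by (erule periodicD) (simp add: cong_def)

lemma P_pos: "P > 0" using prime_gt_0_nat[OF prime_p] by simp

lemma P_gt_1: "P > 1" using prime_gt_1_nat[OF prime_p] by simp

lemma residues_cong_eq: "x \<in> residues_p \<Longrightarrow> y \<in> residues_p \<Longrightarrow> [x = y] (mod P) \<Longrightarrow> x = y"
  by (auto simp: cong_def)

lemma sum_periodic_reindex:
  assumes f: "periodic f" and A: "A \<subseteq> residues_p" and hA: "\<And>x. x \<in> A \<Longrightarrow> h x mod P \<in> A"
    and inj: "\<And>x y. x \<in> A \<Longrightarrow> y \<in> A \<Longrightarrow> [h x = h y] (mod P) \<Longrightarrow> [x = y] (mod P)"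
  shows "(\<Sum>x\<in>A. f (h x)) = (\<Sum>x\<in>A. f x)"
proof -
  have fin: "finite A" using A finite_subset by blast
  have "inj_on (\<lambda>x. h x mod P) A"
  proof (rule inj_onI)
    fix x y assume "x \<in> A" "y \<in> A" "h x mod P = h y mod P"
    then show "x = y" using inj[of x y] subsetD[OF A] residues_cong_eq[of x y] by (simp add: cong_def)
  qed
  moreover from this have "(\<lambda>x. h x mod P) ` A = A"
    using fin hA by (intro endo_inj_surj) auto
  ultimately have "bij_betw (\<lambda>x. h x mod P) A A" by (simp add: bij_betw_def)
  then have "(\<Sum>x\<in>A. f (h x mod P)) = (\<Sum>x\<in>A. f x)" by (rule sum.reindex_bij_betw)
  then show ?thesis using periodic_mod[OF f] by simp
qed

lemma sum_periodic_affine: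
  assumes "periodic f" "\<not> P dvd a"
  shows "(\<Sum>x\<in>residues_p. f (a * x + b)) = (\<Sum>x\<in>residues_p. f x)"
proof (rule sum_periodic_reindex[OF assms(1)])
  fix x y assume "[a * x + b = a * y + b] (mod P)"
  then have "[a * x = a * y] (mod P)" by (simp add: cong_add_rcancel)
  moreover have "coprime a P"
    using assms(2) prime_int_p by (metis coprime_commute prime_imp_coprime)
  ultimately show "[x = y] (mod P)" by (simp add: cong_mult_lcancel)
qed (use P_pos in auto)

lemma sum_periodic_scale:
  "periodic f \<Longrightarrow> \<not> P dvd a \<Longrightarrow> (\<Sum>x\<in>residues_p. f (a * x)) = (\<Sum>x\<in>residues_p. f x)"
  using sum_periodic_affine[of f a 0] by simp

lemma sum_periodic_shift:
  "periodic f \<Longrightarrow> (\<Sum>x\<in>residues_p. f (x + b)) = (\<Sum>x\<in>residues_p. f x)"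
  using sum_periodic_affine[of f 1 b] P_gt_1 by simp

lemma sum_periodic_neg:
  "periodic f \<Longrightarrow> (\<Sum>x\<in>residues_p. f (b - x)) = (\<Sum>x\<in>residues_p. f x)"
  using sum_periodic_affine[of f "-1" b] P_gt_1 by simp

end

context quartic_prime
begin

definition inv_p :: "int \<Rightarrow> int" where "inv_p x = x ^ (p - 2)"

lemma mult_inv_p: "\<not> P dvd x \<Longrightarrow> [x * inv_p x = 1] (mod P)"
  unfolding inv_p_def by (rule inv_pow)

lemma sum_periodic_inverse:
  assumes "periodic f"
  shows "(\<Sum>x\<in>residues_p - {0}. f (inv_p x)) = (\<Sum>x\<in>residues_p - {0}. f x)"
proof (rule sum_periodic_reindex[OF assms])
  have nd: "\<not> P dvd x" if "x \<in> residues_p - {0}" for x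
    using that by (auto dest: zdvd_imp_le)
  fix x y assume xy: "x \<in> residues_p - {0}" "y \<in> residues_p - {0}" "[inv_p x = inv_p y] (mod P)"
  have "[x * 1 = x * (y * inv_p y)] (mod P)"
    using mult_inv_p[OF nd[OF xy(2)]] by (intro cong_mult cong_refl) (simp add: cong_sym)
  also have "[x * (y * inv_p y) = x * (y * inv_p x)] (mod P)"
    using xy(3) by (intro cong_mult cong_refl) (simp add: cong_sym)
  also have "x * (y * inv_p x) = y * (x * inv_p x)" by simp
  also have "[y * (x * inv_p x) = y * 1] (mod P)"
    using mult_inv_p[OF nd[OF xy(1)]] by (intro cong_mult cong_refl)
  finally show "[x = y] (mod P)" by simp
next
  fix x assume x: "x \<in> residues_p - {0}"
  then have "\<not> P dvd x" by (auto dest: zdvd_imp_le)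
  then have "\<not> P dvd inv_p x"
    unfolding inv_p_def using prime_int_p prime_dvd_power by blast
  then show "inv_p x mod P \<in> residues_p - {0}"
    using P_pos by auto
qed auto

end

text \<open>\<open>g\<close> certifies that \<open>\<chi>\<close>^2 is nontrivial, so that
  \<open>\<chi>\<close> has exact order 4. The value 0 at multiples of p lets all sums run over
  complete residue systems.\<close>

locale quartic_char = quartic_prime +
  fixes \<chi> :: "int \<Rightarrow> complex" and g :: int
  assumes chi_periodic: "periodic \<chi>"
    and chi_mult: "\<chi> (x * y) = \<chi> x * \<chi> y"
    and chi_0_iff: "\<chi> x = 0 \<longleftrightarrow> P dvd x"
    and chi_4: "\<not> P dvd x \<Longrightarrow> \<chi> x ^ 4 = 1"
    and chi_gen: "\<chi> g ^ 2 \<noteq> 1" "\<not> P dvd g"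
    and chi_values: "\<chi> x \<in> {0, 1, -1, \<i>, -\<i>}"
begin

definition \<rho> :: "int \<Rightarrow> complex" where "\<rho> x = \<chi> x ^ 2"

definition J :: complex where "J = (\<Sum>x\<in>residues_p. \<chi> x * \<rho> (1 - x))"

definition J' :: complex where "J' = (\<Sum>x\<in>residues_p. \<chi> x * \<chi> (1 - x))"

lemma rho_periodic: "periodic \<rho>"
  using chi_periodic by (auto simp: periodic_def \<rho>_def)

lemma rho_mult: "\<rho> (x * y) = \<rho> x * \<rho> y"
  by (simp add: \<rho>_def chi_mult power_mult_distrib)

lemma rho_0_iff: "\<rho> x = 0 \<longleftrightarrow> P dvd x"
  by (simp add: \<rho>_def chi_0_iff)

lemma rho_sq: "\<not> P dvd x \<Longrightarrow> \<rho> x * \<rho> x = 1"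
  using chi_4[of x] by (simp add: \<rho>_def flip: power_add)

lemma chi_1: "\<chi> 1 = 1"
proof -
  have "\<chi> 1 * \<chi> 1 = \<chi> 1" using chi_mult[of 1 1] by simp
  moreover have "\<chi> 1 \<noteq> 0" using chi_0_iff[of 1] P_gt_1 by simp
  ultimately show ?thesis by simp
qed

lemma rho_1: "\<rho> 1 = 1" by (simp add: \<rho>_def chi_1)

lemma rho_cong_1: "[x = 1] (mod P) \<Longrightarrow> \<rho> x = 1"
  using periodicD[OF rho_periodic] rho_1 by simp

lemma chi_cong_1: "[x = 1] (mod P) \<Longrightarrow> \<chi> x = 1"
  using periodicD[OF chi_periodic] chi_1 by simp

lemma periodic_comp:
  assumes "periodic f" "\<And>x y. [x = y] (mod P) \<Longrightarrow> [h x = h y] (mod P)"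
  shows "periodic (\<lambda>x. f (h x))"
  using assms by (auto simp: periodic_def)

lemma periodic_times:
  fixes f h :: "int \<Rightarrow> complex"
  shows "periodic f \<Longrightarrow> periodic h \<Longrightarrow> periodic (\<lambda>x. f x * h x)"
  by (auto simp: periodic_def)

lemma sum_eq_0_if_scaled:
  fixes f :: "int \<Rightarrow> complex"
  assumes "periodic f" "\<And>x. f (g * x) = c * f x" "c \<noteq> 1"
  shows "(\<Sum>x\<in>residues_p. f x) = 0"
proof -
  have "c * (\<Sum>x\<in>residues_p. f x) = (\<Sum>x\<in>residues_p. f x)"
    using sum_periodic_scale[OF assms(1) chi_gen(2)] by (simp add: assms(2) sum_distrib_left)
  then have "(c - 1) * (\<Sum>x\<in>residues_p. f x) = 0" by (simp add: left_diff_distrib)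
  then show ?thesis using assms(3) by simp
qed

lemma sum_chi: "(\<Sum>x\<in>residues_p. \<chi> x) = 0"
  using chi_gen(1) by (intro sum_eq_0_if_scaled[of _ "\<chi> g"] chi_periodic) (auto simp: chi_mult)

lemma sum_rho: "(\<Sum>x\<in>residues_p. \<rho> x) = 0"
  using chi_gen(1) by (intro sum_eq_0_if_scaled[of _ "\<rho> g"] rho_periodic) (auto simp: chi_mult \<rho>_def power_mult_distrib)

lemma sum_chi_rho: "(\<Sum>x\<in>residues_p. \<chi> x * \<rho> x) = 0"
proof (rule sum_eq_0_if_scaled[of _ "\<chi> g * \<rho> g"])
  show "\<chi> g * \<rho> g \<noteq> 1"
  proof
    assume "\<chi> g * \<rho> g = 1"
    then have "\<chi> g * (\<chi> g * \<rho> g) = \<chi> g" by simp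
    moreover have "\<chi> g * (\<chi> g * \<rho> g) = 1"
      using chi_4[OF chi_gen(2)] by (simp add: \<rho>_def power2_eq_square power4_eq_xxxx mult_ac)
    ultimately show False using chi_gen(1) by simp
  qed
qed (auto intro!: periodic_times chi_periodic rho_periodic simp: chi_mult rho_mult)

lemma chi_convolution: "(\<Sum>x\<in>residues_p. \<chi> x * \<chi> (c - x)) = \<rho> c * J'"
proof (cases "P dvd c")
  case True
  have "(\<Sum>x\<in>residues_p. \<chi> x * \<chi> (c - x)) = (\<Sum>x\<in>residues_p. \<chi> (-1) * \<rho> x)"
  proof (rule sum.cong[OF refl])
    fix x
    have "\<chi> (c - x) = \<chi> (-1 * x)"
      using True by (intro periodicD[OF chi_periodic]) (simp add: cong_iff_dvd_diff)
    then show "\<chi> x * \<chi> (c - x) = \<chi> (-1) * \<rho> x"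
      unfolding chi_mult by (simp add: \<rho>_def power2_eq_square)
  qed
  also have "\<dots> = 0" by (simp add: sum_rho flip: sum_distrib_left)
  finally show ?thesis using True rho_0_iff[of c] by simp
next
  case False
  have per: "periodic (\<lambda>x. \<chi> x * \<chi> (c - x))"
    by (intro periodic_times chi_periodic periodic_comp[OF chi_periodic] cong_diff cong_refl)
  have "(\<Sum>x\<in>residues_p. \<chi> x * \<chi> (c - x)) = (\<Sum>x\<in>residues_p. \<chi> (c * x) * \<chi> (c - c * x))"
    using sum_periodic_scale[OF per False] by simp
  also have "\<dots> = (\<Sum>x\<in>residues_p. \<rho> c * (\<chi> x * \<chi> (1 - x)))"
  proof (rule sum.cong[OF refl])
    fix x
    have "c - c * x = c * (1 - x)" by (simp add: algebra_simps)
    then show "\<chi> (c * x) * \<chi> (c - c * x) = \<rho> c * (\<chi> x * \<chi> (1 - x))"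
      by (simp add: chi_mult \<rho>_def power2_eq_square)
  qed
  finally show ?thesis by (simp add: J'_def sum_distrib_left)
qed

text \<open>The product of the Jacobi sums becomes a sum over x + y + z = 1, in which the cyclic
  symmetry is visible.\<close>

lemma triple_sum: "(\<Sum>y\<in>residues_p. \<Sum>x\<in>residues_p. \<chi> y * \<chi> x * \<chi> (1 - y - x)) = J' * J"
proof -
  have "(\<Sum>y\<in>residues_p. \<Sum>x\<in>residues_p. \<chi> y * \<chi> x * \<chi> (1 - y - x)) =
    (\<Sum>y\<in>residues_p. \<chi> y * (\<Sum>x\<in>residues_p. \<chi> x * \<chi> ((1 - y) - x)))"
    by (simp add: sum_distrib_left mult.assoc)
  also have "\<dots> = (\<Sum>y\<in>residues_p. J' * (\<chi> y * \<rho> (1 - y)))"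
    unfolding chi_convolution by (simp add: mult_ac)
  finally show ?thesis by (simp add: J_def sum_distrib_left)
qed

lemma sum_remove_0:
  fixes f :: "int \<Rightarrow> complex"
  shows "(\<Sum>x\<in>residues_p. f x) = f 0 + (\<Sum>x\<in>residues_p - {0}. f x)"
  using P_pos by (intro sum.remove) auto

lemma not_dvd_residue: "x \<in> residues_p - {0} \<Longrightarrow> \<not> P dvd x"
  by (auto dest: zdvd_imp_le)

lemma chi_0: "\<chi> 0 = 0" and rho_0: "\<rho> 0 = 0"
  by (simp_all add: chi_0_iff rho_0_iff)

text \<open>Substituting 1/x for x turns \<open>\<chi> x * \<chi> (1 - x)\<close> into
  \<open>\<rho> x * \<chi> (x - 1)\<close>, as \<open>\<rho>\<close> takes the same value at x and
  1/x; then 1 - x is substituted for x.\<close>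

lemma J'_eq: "J' = \<chi> (-1) * J"
proof -
  have per: "periodic (\<lambda>x. \<chi> x * \<chi> (1 - x))" "periodic (\<lambda>x. \<rho> x * \<chi> (x - 1))"
    by (intro periodic_times chi_periodic rho_periodic periodic_comp[OF chi_periodic] cong_diff cong_refl; assumption)+
  have "J' = (\<Sum>x\<in>residues_p - {0}. \<chi> (inv_p x) * \<chi> (1 - inv_p x))"
    unfolding J'_def sum_remove_0[of "\<lambda>x. \<chi> x * \<chi> (1 - x)"] sum_periodic_inverse[OF per(1)] by (simp add: chi_0)
  also have "\<dots> = (\<Sum>x\<in>residues_p - {0}. \<rho> x * \<chi> (x - 1))"
  proof (rule sum.cong[OF refl])
    fix x assume "x \<in> residues_p - {0}"
    then have x: "\<not> P dvd x" by (rule not_dvd_residue)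
    have "[1 - inv_p x = x * inv_p x - inv_p x] (mod P)"
      using mult_inv_p[OF x] by (intro cong_diff cong_refl) (simp add: cong_sym)
    then have "\<chi> (1 - inv_p x) = \<chi> (inv_p x * (x - 1))"
      by (intro periodicD[OF chi_periodic]) (simp add: algebra_simps)
    moreover have "\<rho> (x * inv_p x) = 1" by (rule rho_cong_1[OF mult_inv_p[OF x]])
    then have "\<rho> x * \<rho> x * \<rho> (inv_p x) = \<rho> x" by (simp add: rho_mult)
    then have "\<rho> (inv_p x) = \<rho> x" using rho_sq[OF x] by simp
    ultimately show "\<chi> (inv_p x) * \<chi> (1 - inv_p x) = \<rho> x * \<chi> (x - 1)"
      by (simp add: chi_mult \<rho>_def power2_eq_square)
  qed
  also have "\<dots> = (\<Sum>x\<in>residues_p. \<rho> x * \<chi> (x - 1))"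
    using sum_remove_0[of "\<lambda>x. \<rho> x * \<chi> (x - 1)"] by (simp add: rho_0)
  also have "\<dots> = (\<Sum>x\<in>residues_p. \<rho> (1 - x) * \<chi> ((1 - x) - 1))"
    using sum_periodic_neg[OF per(2), of 1] by simp
  also have "\<dots> = (\<Sum>x\<in>residues_p. \<chi> (-1) * (\<chi> x * \<rho> (1 - x)))"
  proof (rule sum.cong[OF refl])
    fix x :: int
    have "(1 - x) - 1 = -1 * x" by simp
    then show "\<rho> (1 - x) * \<chi> ((1 - x) - 1) = \<chi> (-1) * (\<chi> x * \<rho> (1 - x))"
      by (simp only: chi_mult mult_ac)
  qed
  finally show ?thesis by (simp add: J_def sum_distrib_left)
qed

text \<open>If d = x - y is nonzero modulo p, scaling t by d and splitting off t^2 leaves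
  \<open>\<rho>\<close> at 1 + 1/t, whose argument takes every residue except 1; the full character
  sum is 0.\<close>

lemma rho_correlation:
  "(\<Sum>t\<in>residues_p. \<rho> (t - x) * \<rho> (t - y)) = (if [x = y] (mod P) then of_nat p - 1 else -1)"
proof -
  define d where "d = x - y"
  have per: "periodic (\<lambda>t. \<rho> t * \<rho> (t + d))" for d
    by (intro periodic_times rho_periodic periodic_comp[OF rho_periodic] cong_add cong_refl)
  have "(\<Sum>t\<in>residues_p. \<rho> (t - x) * \<rho> (t - y)) = (\<Sum>t\<in>residues_p. \<rho> t * \<rho> (t + d))"
    using sum_periodic_shift[OF per, of "-x" d] by (simp add: d_def algebra_simps)
  also have "\<dots> = (if P dvd d then of_nat p - 1 else -1)"
  proof (cases "P dvd d")
    case True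
    have "(\<Sum>t\<in>residues_p. \<rho> t * \<rho> (t + d)) = (\<Sum>t\<in>residues_p - {0}. \<rho> t * \<rho> (t + d))"
      using sum_remove_0[of "\<lambda>t. \<rho> t * \<rho> (t + d)"] by (simp add: rho_0)
    also have "\<dots> = (\<Sum>t\<in>residues_p - {0}. 1)"
    proof (rule sum.cong[OF refl])
      fix t assume "t \<in> residues_p - {0}"
      then have t: "\<not> P dvd t" by (rule not_dvd_residue)
      have "\<rho> (t + d) = \<rho> t"
        using True by (intro periodicD[OF rho_periodic]) (simp add: cong_iff_dvd_diff)
      then show "\<rho> t * \<rho> (t + d) = 1" using rho_sq[OF t] by simp
    qed
    also have "\<dots> = of_nat p - 1"
      using P_pos by (simp add: card_Diff_singleton of_nat_diff)
    finally show ?thesis using True by simp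
  next
    case False
    have per1: "periodic (\<lambda>s. \<rho> (1 + s))"
      by (intro periodic_comp[OF rho_periodic] cong_add cong_refl)
    have "(\<Sum>t\<in>residues_p. \<rho> t * \<rho> (t + d)) = (\<Sum>t\<in>residues_p. \<rho> (d * t) * \<rho> (d * t + d))"
      using sum_periodic_scale[OF per False] by simp
    also have "\<dots> = (\<Sum>t\<in>residues_p. \<rho> t * \<rho> (t + 1))"
    proof (rule sum.cong[OF refl])
      fix t
      have "d * t + d = d * (t + 1)" by (simp add: algebra_simps)
      then have "\<rho> (d * t) * \<rho> (d * t + d) = (\<rho> d * \<rho> d) * (\<rho> t * \<rho> (t + 1))"
        by (simp add: rho_mult)
      then show "\<rho> (d * t) * \<rho> (d * t + d) = \<rho> t * \<rho> (t + 1)"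
        using rho_sq[OF False] by simp
    qed
    also have "\<dots> = (\<Sum>t\<in>residues_p - {0}. \<rho> t * \<rho> (t + 1))"
      using sum_remove_0[of "\<lambda>t. \<rho> t * \<rho> (t + 1)"] by (simp add: rho_0)
    also have "\<dots> = (\<Sum>t\<in>residues_p - {0}. \<rho> (1 + inv_p t))"
    proof (rule sum.cong[OF refl])
      fix t assume "t \<in> residues_p - {0}"
      then have t: "\<not> P dvd t" by (rule not_dvd_residue)
      have "[t + 1 = t + t * inv_p t] (mod P)"
        using mult_inv_p[OF t] by (intro cong_add cong_refl) (simp add: cong_sym)
      then have "\<rho> (t + 1) = \<rho> (t * (1 + inv_p t))"
        by (intro periodicD[OF rho_periodic]) (simp add: algebra_simps)
      then show "\<rho> t * \<rho> (t + 1) = \<rho> (1 + inv_p t)"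
        using rho_sq[OF t] by (simp add: rho_mult flip: mult.assoc)
    qed
    also have "\<dots> = (\<Sum>t\<in>residues_p - {0}. \<rho> (1 + t))"
      by (rule sum_periodic_inverse[OF per1])
    also have "\<dots> = (\<Sum>t\<in>residues_p. \<rho> (1 + t)) - 1"
      using sum_remove_0[of "\<lambda>t. \<rho> (1 + t)"] by (simp add: rho_1)
    also have "(\<Sum>t\<in>residues_p. \<rho> (1 + t)) = 0"
      using sum_periodic_shift[OF rho_periodic, of 1] by (simp add: sum_rho add.commute)
    finally show ?thesis using False by simp
  qed
  also have "P dvd d \<longleftrightarrow> [x = y] (mod P)" by (simp add: d_def cong_iff_dvd_diff)
  finally show ?thesis .
qed

end

definition gaussian_int :: "complex \<Rightarrow> bool" where
  "gaussian_int z \<longleftrightarrow> Re z \<in> \<int> \<and> Im z \<in> \<int>"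

lemma gaussian_int_add: "gaussian_int x \<Longrightarrow> gaussian_int y \<Longrightarrow> gaussian_int (x + y)"
  and gaussian_int_mult: "gaussian_int x \<Longrightarrow> gaussian_int y \<Longrightarrow> gaussian_int (x * y)"
  and gaussian_int_0: "gaussian_int 0"
  and gaussian_int_of_bool: "gaussian_int (of_bool b)"
  by (auto simp: gaussian_int_def)

lemma gaussian_int_sum: "(\<And>i. i \<in> A \<Longrightarrow> gaussian_int (f i)) \<Longrightarrow> gaussian_int (sum f A)"
  by (induction A rule: infinite_finite_induct) (auto intro: gaussian_int_add gaussian_int_0)

lemma gaussian_int_obtain:
  assumes "gaussian_int z"
  obtains a b :: int where "z = Complex (of_int a) (of_int b)"
  using assms by (auto simp: gaussian_int_def complex_eq_iff elim!: Ints_cases)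

context quartic_char
begin

lemma gaussian_int_chi: "gaussian_int (\<chi> x)"
  using chi_values[of x] by (auto simp: gaussian_int_def)

lemma gaussian_int_rho: "gaussian_int (\<rho> x)"
  unfolding \<rho>_def power2_eq_square by (intro gaussian_int_mult gaussian_int_chi)

lemma cnj_rho: "cnj (\<rho> x) = \<rho> x"
  using chi_values[of x] by (auto simp: \<rho>_def)

lemma chi_cnj: "\<chi> x * cnj (\<chi> x) = of_bool (\<not> P dvd x)"
  using chi_values[of x] chi_0_iff[of x] by (auto simp: complex_eq_iff)

lemma rho_convolution: "(\<Sum>x\<in>residues_p. \<chi> x * \<rho> (t - x)) = \<chi> t * \<rho> t * J"
proof (cases "P dvd t")
  case True
  have "(\<Sum>x\<in>residues_p. \<chi> x * \<rho> (t - x)) = (\<Sum>x\<in>residues_p. \<rho> (-1) * (\<chi> x * \<rho> x))"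
  proof (rule sum.cong[OF refl])
    fix x
    have "\<rho> (t - x) = \<rho> (-1 * x)"
      using True by (intro periodicD[OF rho_periodic]) (simp add: cong_iff_dvd_diff)
    then show "\<chi> x * \<rho> (t - x) = \<rho> (-1) * (\<chi> x * \<rho> x)"
      unfolding rho_mult by (simp only: mult_ac)
  qed
  also have "\<dots> = 0" by (simp add: sum_chi_rho flip: sum_distrib_left)
  finally show ?thesis using True chi_0_iff[of t] by simp
next
  case False
  have per: "periodic (\<lambda>x. \<chi> x * \<rho> (t - x))"
    by (intro periodic_times chi_periodic periodic_comp[OF rho_periodic] cong_diff cong_refl)
  have "(\<Sum>x\<in>residues_p. \<chi> x * \<rho> (t - x)) = (\<Sum>x\<in>residues_p. \<chi> (t * x) * \<rho> (t - t * x))"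
    using sum_periodic_scale[OF per False] by simp
  also have "\<dots> = (\<Sum>x\<in>residues_p. (\<chi> t * \<rho> t) * (\<chi> x * \<rho> (1 - x)))"
  proof (rule sum.cong[OF refl])
    fix x
    have "t - t * x = t * (1 - x)" by (simp add: algebra_simps)
    then show "\<chi> (t * x) * \<rho> (t - t * x) = (\<chi> t * \<rho> t) * (\<chi> x * \<rho> (1 - x))"
      by (simp add: chi_mult rho_mult)
  qed
  finally show ?thesis by (simp add: J_def sum_distrib_left)
qed

lemma sum_not_dvd: "(\<Sum>x\<in>residues_p. of_bool (\<not> P dvd x)) = (of_nat p - 1 :: complex)"
proof -
  have "(\<Sum>x\<in>residues_p. of_bool (\<not> P dvd x)) = (\<Sum>x\<in>residues_p - {0}. of_bool (\<not> P dvd x) :: complex)"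
    using sum_remove_0[of "\<lambda>x. of_bool (\<not> P dvd x)"] by simp
  also have "\<dots> = (\<Sum>x\<in>residues_p - {0}. 1)"
    by (rule sum.cong) (auto simp: not_dvd_residue)
  also have "\<dots> = of_nat p - 1"
    using P_pos by (simp add: card_Diff_singleton of_nat_diff)
  finally show ?thesis .
qed

text \<open>The second moment of \<open>S\<close> is computed twice, by
  \<open>rho_convolution\<close> and by \<open>rho_correlation\<close>. This gives |J|^2 = p without
  Gauss sums.\<close>

lemma J_norm: "J * cnj J = of_nat p"
proof -
  define S where "S t = (\<Sum>x\<in>residues_p. \<chi> x * \<rho> (t - x))" for t
  have "(\<Sum>t\<in>residues_p. S t * cnj (S t)) = (\<Sum>t\<in>residues_p. of_bool (\<not> P dvd t) * (J * cnj J))"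
  proof (rule sum.cong[OF refl])
    fix t
    have "S t * cnj (S t) = (\<chi> t * cnj (\<chi> t)) * (\<rho> t * \<rho> t) * (J * cnj J)"
      unfolding S_def rho_convolution by (simp add: cnj_rho mult_ac)
    then show "S t * cnj (S t) = of_bool (\<not> P dvd t) * (J * cnj J)"
      using rho_sq[of t] by (cases "P dvd t") (simp_all add: chi_cnj)
  qed
  also have "\<dots> = (of_nat p - 1) * (J * cnj J)"
    by (simp only: sum_not_dvd flip: sum_distrib_right)
  finally have 1: "(\<Sum>t\<in>residues_p. S t * cnj (S t)) = (of_nat p - 1) * (J * cnj J)" .
  have "(\<Sum>t\<in>residues_p. S t * cnj (S t)) =
    (\<Sum>t\<in>residues_p. \<Sum>x\<in>residues_p. \<Sum>y\<in>residues_p. \<chi> x * cnj (\<chi> y) * (\<rho> (t - x) * \<rho> (t - y)))"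
    unfolding S_def cnj_sum sum_product by (simp add: cnj_rho mult_ac)
  also have "\<dots> = (\<Sum>x\<in>residues_p. \<Sum>t\<in>residues_p. \<Sum>y\<in>residues_p. \<chi> x * cnj (\<chi> y) * (\<rho> (t - x) * \<rho> (t - y)))"
    by (rule sum.swap)
  also have "\<dots> = (\<Sum>x\<in>residues_p. \<Sum>y\<in>residues_p. \<Sum>t\<in>residues_p. \<chi> x * cnj (\<chi> y) * (\<rho> (t - x) * \<rho> (t - y)))"
    by (intro sum.cong refl sum.swap)
  also have "\<dots> = (\<Sum>x\<in>residues_p. \<Sum>y\<in>residues_p. (if x = y then of_nat p * (\<chi> x * cnj (\<chi> x)) else 0) - \<chi> x * cnj (\<chi> y))"
  proof (intro sum.cong refl)
    fix x y assume xy: "x \<in> residues_p" "y \<in> residues_p"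
    then have "[x = y] (mod P) \<longleftrightarrow> x = y" using residues_cong_eq[OF xy] by auto
    then show "(\<Sum>t\<in>residues_p. \<chi> x * cnj (\<chi> y) * (\<rho> (t - x) * \<rho> (t - y))) =
        (if x = y then of_nat p * (\<chi> x * cnj (\<chi> x)) else 0) - \<chi> x * cnj (\<chi> y)"
      unfolding sum_distrib_left[symmetric] rho_correlation by (simp add: algebra_simps)
  qed
  also have "\<dots> = (\<Sum>x\<in>residues_p. of_nat p * (\<chi> x * cnj (\<chi> x))) - (\<Sum>x\<in>residues_p. \<chi> x) * (\<Sum>y\<in>residues_p. cnj (\<chi> y))"
    by (simp add: sum_subtractf sum_product)
  also have "\<dots> = of_nat p * (of_nat p - 1)"
    by (simp only: sum_chi chi_cnj sum_not_dvd flip: sum_distrib_left) simp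
  finally have "(of_nat p - 1) * (J * cnj J) = (of_nat p - 1) * of_nat p"
    using 1 by (simp add: mult.commute)
  moreover have "(of_nat p - 1 :: complex) \<noteq> 0"
    using P_gt_1 by simp
  ultimately show ?thesis by simp
qed

text \<open>The triple sum is grouped into orbits under the cyclic rotation of the summation
  variables \<open>x + y + z = 1\<close>; all orbits have three elements except the fixed point \<open>x = y = z\<close>.\<close>

definition third :: "int \<times> int \<Rightarrow> int" where "third \<omega> = (1 - fst \<omega> - snd \<omega>) mod P"

definition rotate_pair :: "int \<times> int \<Rightarrow> int \<times> int" where "rotate_pair \<omega> = (snd \<omega>, third \<omega>)"

lemma third_range: "third \<omega> \<in> residues_p"
  using P_pos by (simp add: third_def)

lemma third_cong: "[third \<omega> = 1 - fst \<omega> - snd \<omega>] (mod P)"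
  by (simp add: third_def cong_def)

lemma third_rotate: "\<omega> \<in> residues_p \<times> residues_p \<Longrightarrow> third (rotate_pair \<omega>) = fst \<omega>"
proof -
  assume w: "\<omega> \<in> residues_p \<times> residues_p"
  have "[third (rotate_pair \<omega>) = 1 - snd \<omega> - third \<omega>] (mod P)"
    using third_cong[of "rotate_pair \<omega>"] by (simp add: rotate_pair_def)
  also have "[1 - snd \<omega> - third \<omega> = 1 - snd \<omega> - (1 - fst \<omega> - snd \<omega>)] (mod P)"
    by (intro cong_diff cong_refl third_cong)
  also have "1 - snd \<omega> - (1 - fst \<omega> - snd \<omega>) = fst \<omega>" by simp
  finally have "[third (rotate_pair \<omega>) = fst \<omega>] (mod P)" .
  then show ?thesis
    by (rule residues_cong_eq[OF third_range, rotated]) (use w in auto)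
qed

lemma rotate_range: "\<omega> \<in> residues_p \<times> residues_p \<Longrightarrow> rotate_pair \<omega> \<in> residues_p \<times> residues_p"
  using third_range by (auto simp: rotate_pair_def)

lemma rotate_cube: "\<omega> \<in> residues_p \<times> residues_p \<Longrightarrow> rotate_pair (rotate_pair (rotate_pair \<omega>)) = \<omega>"
  using third_rotate[of \<omega>] third_rotate[of "rotate_pair \<omega>"] rotate_range[of \<omega>]
  by (simp add: rotate_pair_def prod_eq_iff)

lemma bij_rotate: "bij_betw rotate_pair (residues_p \<times> residues_p) (residues_p \<times> residues_p)"
proof (rule bij_betw_byWitness[where f' = "rotate_pair \<circ> rotate_pair"])
  show "\<forall>\<omega>\<in>residues_p \<times> residues_p. (rotate_pair \<circ> rotate_pair) (rotate_pair \<omega>) = \<omega>"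
    "\<forall>\<omega>\<in>residues_p \<times> residues_p. rotate_pair ((rotate_pair \<circ> rotate_pair) \<omega>) = \<omega>"
    unfolding o_apply using rotate_cube by blast+
  show "rotate_pair ` (residues_p \<times> residues_p) \<subseteq> residues_p \<times> residues_p"
    "(rotate_pair \<circ> rotate_pair) ` (residues_p \<times> residues_p) \<subseteq> residues_p \<times> residues_p"
    unfolding image_comp[symmetric] using rotate_range by blast+
qed

lemma triple_sum_mod_3: "\<exists>M. gaussian_int M \<and> J' * J = \<chi> 3 + 3 * M"
proof -
  define W where "W = residues_p \<times> residues_p"
  define F where "F \<omega> = \<chi> (fst \<omega>) * \<chi> (snd \<omega>) * \<chi> (third \<omega>)" for \<omega>
  \<comment> \<open>\<open>D\<close> picks one pair per rotation orbit: the minimum stands first,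
    and of a repeated minimum the copy followed by the other one. Only the fixed point is left to
    \<open>C\<close>.\<close>
  define D :: "int \<times> int \<Rightarrow> complex" where "D \<omega> = of_bool (fst \<omega> \<le> snd \<omega> \<and> fst \<omega> < third \<omega>)" for \<omega>
  define C :: "int \<times> int \<Rightarrow> complex" where "C \<omega> = of_bool (fst \<omega> = snd \<omega> \<and> snd \<omega> = third \<omega>)" for \<omega>
  define M where "M = (\<Sum>\<omega>\<in>W. F \<omega> * D \<omega>)"
  have FM: "gaussian_int M"
    unfolding M_def F_def D_def
    by (intro gaussian_int_sum gaussian_int_mult gaussian_int_chi gaussian_int_of_bool)
  have rot: "(\<Sum>\<omega>\<in>W. G (rotate_pair \<omega>)) = (\<Sum>\<omega>\<in>W. G \<omega>)" for G :: "int \<times> int \<Rightarrow> complex"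
    unfolding W_def by (rule sum.reindex_bij_betw[OF bij_rotate])
  have Frot: "F (rotate_pair \<omega>) = F \<omega>" if "\<omega> \<in> W" for \<omega>
    using third_rotate that by (simp add: F_def W_def) (simp add: rotate_pair_def)
  have Wrot: "rotate_pair \<omega> \<in> W" if "\<omega> \<in> W" for \<omega>
    using rotate_range that by (simp add: W_def)
  have orbit: "D \<omega> + D (rotate_pair \<omega>) + D (rotate_pair (rotate_pair \<omega>)) = 1 - C \<omega>" if "\<omega> \<in> W" for \<omega>
  proof -
    have "third (rotate_pair \<omega>) = fst \<omega>" "third (rotate_pair (rotate_pair \<omega>)) = snd \<omega>"
      using third_rotate[of \<omega>] third_rotate[of "rotate_pair \<omega>"] rotate_range[of \<omega>] that
      by (simp_all add: W_def) (simp add: rotate_pair_def)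
    moreover have "(of_bool (a \<le> b \<and> a < c) :: complex) + of_bool (b \<le> c \<and> b < a) + of_bool (c \<le> a \<and> c < b)
        = 1 - of_bool (a = b \<and> b = c)" for a b c :: int
      by auto
    ultimately show ?thesis
      unfolding D_def C_def by (simp add: rotate_pair_def)
  qed
  have "J' * J = (\<Sum>y\<in>residues_p. \<Sum>x\<in>residues_p. F (y, x))"
    unfolding triple_sum[symmetric] F_def using periodic_mod[OF chi_periodic]
    by (simp add: third_def)
  also have "\<dots> = (\<Sum>\<omega>\<in>W. F \<omega>)"
    by (simp add: W_def sum.cartesian_product)
  also have "\<dots> = (\<Sum>\<omega>\<in>W. F \<omega> * C \<omega> + (F \<omega> * D \<omega> + F (rotate_pair \<omega>) * D (rotate_pair \<omega>)
      + F (rotate_pair (rotate_pair \<omega>)) * D (rotate_pair (rotate_pair \<omega>))))"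
  proof (rule sum.cong[OF refl])
    fix \<omega> assume w: "\<omega> \<in> W"
    have one: "C \<omega> + (D \<omega> + D (rotate_pair \<omega>) + D (rotate_pair (rotate_pair \<omega>))) = 1"
      using orbit[OF w] by simp
    show "F \<omega> = F \<omega> * C \<omega> + (F \<omega> * D \<omega> + F (rotate_pair \<omega>) * D (rotate_pair \<omega>)
      + F (rotate_pair (rotate_pair \<omega>)) * D (rotate_pair (rotate_pair \<omega>)))"
      unfolding Frot[OF w] Frot[OF Wrot[OF w]]
      by (simp only: distrib_left[symmetric] one mult_1_right)
  qed
  also have "\<dots> = (\<Sum>\<omega>\<in>W. F \<omega> * C \<omega>) + 3 * M"
    unfolding sum.distrib rot[of "\<lambda>\<omega>. F \<omega> * D \<omega>"] rot[of "\<lambda>\<omega>. F (rotate_pair \<omega>) * D (rotate_pair \<omega>)"]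
    by (simp add: M_def)
  also have "(\<Sum>\<omega>\<in>W. F \<omega> * C \<omega>) = \<chi> 3"
  proof -
    have n3: "\<not> P dvd 3"
      using p_ge not_p_dvd_small[of 3] int_dvd_int_iff[of p 3] by simp
    define x0 where "x0 = inv_p 3 mod P"
    have x0: "x0 \<in> residues_p" "[3 * x0 = 1] (mod P)"
      using P_pos mult_inv_p[OF n3] by (simp_all add: x0_def cong_def mod_mult_right_eq)
    have uniq: "x = x0" if "x \<in> residues_p" "x = third (x, x)" for x
    proof -
      have "[x = 1 - x - x] (mod P)" using third_cong[of "(x, x)"] that(2) by simp
      then have "[3 * x = 1] (mod P)" by (simp add: cong_iff_dvd_diff)
      then have "[3 * x = 3 * x0] (mod P)" using x0(2) cong_sym cong_trans by blast
      moreover have "coprime 3 P"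
        using n3 prime_int_p by (metis coprime_commute prime_imp_coprime)
      ultimately have "[x = x0] (mod P)" by (simp add: cong_mult_lcancel)
      then show ?thesis using residues_cong_eq that(1) x0(1) by blast
    qed
    have "[x0 = third (x0, x0)] (mod P)"
    proof -
      have "[third (x0, x0) = 1 - x0 - x0] (mod P)" using third_cong[of "(x0, x0)"] by simp
      also have "[1 - x0 - x0 = 3 * x0 - x0 - x0] (mod P)"
        using x0(2) by (intro cong_diff cong_refl) (simp add: cong_sym)
      also have "3 * x0 - x0 - x0 = x0" by simp
      finally show ?thesis by (rule cong_sym)
    qed
    then have fx: "x0 = third (x0, x0)"
      using residues_cong_eq[OF x0(1) third_range] by blast
    have "(\<Sum>\<omega>\<in>W. F \<omega> * C \<omega>) = (\<Sum>\<omega>\<in>{(x0, x0)}. F \<omega> * C \<omega>)"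
    proof (rule sum.mono_neutral_right)
      show "finite W" "{(x0, x0)} \<subseteq> W" using x0(1) by (auto simp: W_def)
      show "\<forall>\<omega>\<in>W - {(x0, x0)}. F \<omega> * C \<omega> = 0"
        using uniq by (auto simp: C_def W_def)
    qed
    also have "\<dots> = \<chi> x0 ^ 3" using fx by (simp add: F_def C_def power3_eq_cube)
    \<comment> \<open>The fixed point is 1/3; it contributes the inverse cube of
      \<open>\<chi> 3\<close>, which is \<open>\<chi> 3\<close> itself, as its fourth power is
      1.\<close>
    also have "\<dots> = \<chi> 3 ^ 4 * \<chi> x0 ^ 3" using chi_4[OF n3] by simp
    also have "\<dots> = \<chi> 3 * (\<chi> 3 * \<chi> x0) ^ 3" by (simp add: power_mult_distrib eval_nat_numeral mult_ac)
    also have "\<chi> 3 * \<chi> x0 = 1" using chi_cong_1[OF x0(2)] by (simp add: chi_mult)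
    finally show ?thesis by simp
  qed
  finally show ?thesis using FM by blast
qed

text \<open>This takes the place of quartic reciprocity: it ties \<open>\<chi> (-3)\<close> to J
  modulo 3. The sign between 3 and -3 comes from \<open>J'_eq\<close>.\<close>

lemma J_square_mod_3: "\<exists>M. gaussian_int M \<and> J ^ 2 = \<chi> (-3) + 3 * M"
proof -
  obtain M where M: "gaussian_int M" "J' * J = \<chi> 3 + 3 * M" using triple_sum_mod_3 by blast
  have "\<chi> (-1) * \<chi> (-1) = 1" by (simp add: chi_1 flip: chi_mult)
  then have "J ^ 2 = \<chi> (-1) * (J' * J)"
    by (simp add: J'_eq power2_eq_square flip: mult.assoc)
  also have "\<dots> = \<chi> (-1 * 3) + 3 * (\<chi> (-1) * M)"
    unfolding M(2) chi_mult by (simp add: algebra_simps)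
  finally show ?thesis
    using gaussian_int_mult[OF gaussian_int_chi M(1)] by auto
qed

end

section \<open>Evaluation of Gaussian integers at a square root of -1\<close>

definition gauss_units0 :: "complex set" where
  "gauss_units0 = {0, 1, -1, \<i>, -\<i>}"

lemma gauss_units0_mult: "z \<in> gauss_units0 \<Longrightarrow> w \<in> gauss_units0 \<Longrightarrow> z * w \<in> gauss_units0"
  by (auto simp: gauss_units0_def)

lemma gaussian_int_units0: "z \<in> gauss_units0 \<Longrightarrow> gaussian_int z"
  by (auto simp: gauss_units0_def gaussian_int_def)

text \<open>The map on Z[i] sending \<open>\<i>\<close> to \<open>\<iota>\<close>; it is additive,
  and multiplicative modulo divisors of \<open>\<iota>\<close>^2 + 1. The floors merely extract the
  integer coordinates.\<close>

definition gauss_eval :: "int \<Rightarrow> complex \<Rightarrow> int" where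
  "gauss_eval \<iota> z = \<lfloor>Re z\<rfloor> + \<lfloor>Im z\<rfloor> * \<iota>"

lemma gauss_eval_Complex [simp]: "gauss_eval \<iota> (Complex (of_int a) (of_int b)) = a + b * \<iota>"
  by (simp add: gauss_eval_def)

lemma gauss_eval_simps [simp]:
  "gauss_eval \<iota> 0 = 0" "gauss_eval \<iota> 1 = 1" "gauss_eval \<iota> (-1) = -1"
  "gauss_eval \<iota> \<i> = \<iota>" "gauss_eval \<iota> (-\<i>) = -\<iota>"
proof -
  have "\<lfloor>- 1 :: real\<rfloor> = - 1" by (simp add: floor_eq_iff)
  then show "gauss_eval \<iota> 0 = 0" "gauss_eval \<iota> 1 = 1" "gauss_eval \<iota> (-1) = -1"
    "gauss_eval \<iota> \<i> = \<iota>" "gauss_eval \<iota> (-\<i>) = -\<iota>"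
    by (simp_all add: gauss_eval_def)
qed

lemma gauss_eval_add:
  "gaussian_int z \<Longrightarrow> gaussian_int w \<Longrightarrow> gauss_eval \<iota> (z + w) = gauss_eval \<iota> z + gauss_eval \<iota> w"
  by (auto simp: gauss_eval_def gaussian_int_def algebra_simps elim!: Ints_cases simp flip: of_int_add)

lemma gauss_eval_diff:
  "gaussian_int z \<Longrightarrow> gaussian_int w \<Longrightarrow> gauss_eval \<iota> (z - w) = gauss_eval \<iota> z - gauss_eval \<iota> w"
  by (auto simp: gauss_eval_def gaussian_int_def algebra_simps elim!: Ints_cases simp flip: of_int_diff)

lemma gauss_eval_sum:
  "(\<And>i. i \<in> A \<Longrightarrow> gaussian_int (f i)) \<Longrightarrow> gauss_eval \<iota> (sum f A) = (\<Sum>i\<in>A. gauss_eval \<iota> (f i))"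
  by (induction A rule: infinite_finite_induct) (auto simp: gauss_eval_add gaussian_int_sum)

lemma gauss_eval_mult:
  assumes "gaussian_int z" "gaussian_int w" "[\<iota> ^ 2 = -1] (mod M)"
  shows "[gauss_eval \<iota> (z * w) = gauss_eval \<iota> z * gauss_eval \<iota> w] (mod M)"
proof -
  obtain a b where z: "z = Complex (of_int a) (of_int b)" using gaussian_int_obtain[OF assms(1)] .
  obtain c d where w: "w = Complex (of_int c) (of_int d)" using gaussian_int_obtain[OF assms(2)] .
  have "z * w = Complex (of_int (a * c - b * d)) (of_int (a * d + b * c))"
    by (simp add: z w complex_eq_iff)
  then have "gauss_eval \<iota> (z * w) = (a * c - b * d) + (a * d + b * c) * \<iota>"
    by (simp only: gauss_eval_Complex)
  then have "gauss_eval \<iota> (z * w) = (a * c + (a * d + b * c) * \<iota>) + (b * d) * (-1)"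
    by simp
  also have "[\<dots> = (a * c + (a * d + b * c) * \<iota>) + (b * d) * \<iota> ^ 2] (mod M)"
    using assms(3) by (intro cong_add cong_mult cong_refl) (rule cong_sym)
  also have "(a * c + (a * d + b * c) * \<iota>) + (b * d) * \<iota> ^ 2 = gauss_eval \<iota> z * gauss_eval \<iota> w"
    by (simp add: z w algebra_simps power2_eq_square)
  finally show ?thesis .
qed

context quartic_prime
begin

lemma not_P_dvd_small: "0 < a \<Longrightarrow> a < 5 \<Longrightarrow> \<not> P dvd a"
  using p_ge by (auto dest: zdvd_imp_le)

text \<open>-1 is a square modulo p since (p-1)/2 = 2m is even; from y^2 = -1 modulo p it follows
  that (y^p)^2 = (-1)^p = -1 modulo p^2.\<close>

lemma exists_sqrt_minus_1: "\<exists>\<iota>. [\<iota> ^ 2 = -1] (mod P ^ 2)"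
proof -
  have "(p - 1) div 2 = 2 * m" using p_eq by simp
  then have "[Legendre (-1) P = 1] (mod P)"
    using euler_criterion[OF prime_p p_gt, of "-1"] by simp
  moreover have "\<not> [-1 = 1] (mod P)" "\<not> [0 = 1] (mod P)"
    using not_P_dvd_small[of 2] not_P_dvd_small[of 1] by (auto simp: cong_iff_dvd_diff)
  ultimately have "QuadRes P (-1)"
    by (auto simp: Legendre_def split: if_splits)
  then obtain y where "[y ^ 2 = -1] (mod P)" by (auto simp: QuadRes_def)
  then have "[(y ^ 2) ^ p = (-1) ^ p] (mod P ^ 2)"
    using p_gt by (intro cong_power_p) auto
  moreover have "odd p" using p_eq by simp
  ultimately have "[(y ^ p) ^ 2 = -1] (mod P ^ 2)"
    by (simp add: mult.commute flip: power_mult)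
  then show ?thesis by blast
qed

lemma exists_generator: "\<exists>g. \<not> P dvd g \<and> (\<forall>k. [g ^ k = 1] (mod P) \<longleftrightarrow> 4 * m dvd k)"
proof -
  obtain g where g: "residue_primroot p g"
    using prime_primitive_root_exists[of p] prime_p prime_gt_1_nat by auto
  then have "coprime p g" "ord p g = 4 * m"
    using prime_p p_eq by (auto simp: residue_primroot_def totient_prime)
  then have "[g ^ k = 1] (mod p) \<longleftrightarrow> 4 * m dvd k" for k
    using ord_divides[of g k p] by simp
  then have "[int g ^ k = 1] (mod P) \<longleftrightarrow> 4 * m dvd k" for k
    using cong_int_iff[of "g ^ k" 1 p] by simp
  moreover have "\<not> P dvd int g"
    using \<open>coprime p g\<close> prime_p by (metis coprime_absorb_left int_dvd_int_iff not_prime_unit)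
  ultimately show ?thesis by blast
qed

lemma power_4m: "\<not> P dvd x \<Longrightarrow> [x ^ (4 * m) = 1] (mod P)"
  using fermat_int[of x] p_eq by simp

lemma power_p: "[x ^ p = x] (mod P)"
proof (cases "P dvd x")
  case True
  then have "P dvd x ^ p" using p_gt by (simp add: dvd_power_le[of P x 1 p, simplified])
  then show ?thesis using True by (simp add: cong_iff_dvd_diff)
next
  case False
  have "x ^ p = x ^ (4 * m) * x" by (simp add: p_eq)
  also have "[\<dots> = 1 * x] (mod P)" by (intro cong_mult power_4m False cong_refl)
  finally show ?thesis by simp
qed

lemma cong_square_modulus: "[a = b] (mod P ^ 2) \<Longrightarrow> [a = b] (mod P)"
  by (rule cong_dvd_modulus) (auto simp: power2_eq_square)

text \<open>x^p modulo p^2 is a function of x modulo p, so the usual argument works at the modulus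
  p^2: scaling by a generator \<open>g\<close> multiplies the sum by g^(pN), and g^(pN) - 1 is prime
  to p unless 4m divides N.\<close>

lemma power_sum_zcong:
  assumes "N > 0"
  shows "[(\<Sum>x\<in>residues_p. (x ^ p) ^ N) = (if 4 * m dvd N then P - 1 else 0)] (mod P ^ 2)"
proof (cases "4 * m dvd N")
  case True
  then obtain k where k: "N = 4 * m * k" by blast
  have r: "(\<Sum>x\<in>residues_p. (x ^ p) ^ N) = 0 + (\<Sum>x\<in>residues_p - {0}. (x ^ p) ^ N)"
    using P_pos assms p_gt by (subst sum.remove[of _ 0]) auto
  have "[(\<Sum>x\<in>residues_p - {0}. (x ^ p) ^ N) = (\<Sum>x\<in>residues_p - {0}. 1)] (mod P ^ 2)"
  proof (rule cong_sum)
    fix x assume "x \<in> residues_p - {0}"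
    then have "\<not> P dvd x" by (auto dest: zdvd_imp_le)
    then have "[(x ^ (4 * m)) ^ p = 1 ^ p] (mod P ^ 2)"
      using p_gt by (intro cong_power_p power_4m) auto
    then have "[((x ^ (4 * m)) ^ p) ^ k = (1 ^ p) ^ k] (mod P ^ 2)" by (rule cong_pow)
    then show "[(x ^ p) ^ N = 1] (mod P ^ 2)"
      by (simp add: k mult_ac flip: power_mult)
  qed
  moreover have "(\<Sum>x\<in>residues_p - {0}. 1) = P - 1"
    using P_pos by (simp add: card_Diff_singleton of_nat_diff)
  ultimately show ?thesis using True r by simp
next
  case False
  obtain g where g: "\<not> P dvd g" "\<And>k. [g ^ k = 1] (mod P) \<longleftrightarrow> 4 * m dvd k"
    using exists_generator by blast
  define f where "f x = (x ^ p) ^ N mod P ^ 2" for x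
  have fc: "[f x = (x ^ p) ^ N] (mod P ^ 2)" for x by (simp add: f_def cong_def)
  have "periodic f"
    unfolding periodic_def f_def
  proof (intro allI impI)
    fix x y assume "[x = y] (mod P)"
    then have "[x ^ p = y ^ p] (mod P ^ 2)" using p_gt by (intro cong_power_p) auto
    then show "(x ^ p) ^ N mod P ^ 2 = (y ^ p) ^ N mod P ^ 2"
      using cong_pow by (auto simp: cong_def)
  qed
  define S where "S = (\<Sum>x\<in>residues_p. f x)"
  have S: "[(\<Sum>x\<in>residues_p. (x ^ p) ^ N) = S] (mod P ^ 2)"
    unfolding S_def using fc by (intro cong_sum) (auto intro: cong_sym)
  have "S = (\<Sum>x\<in>residues_p. f (g * x))"
    unfolding S_def using sum_periodic_scale[OF \<open>periodic f\<close> g(1)] by simp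
  also have "[\<dots> = (\<Sum>x\<in>residues_p. (g ^ p) ^ N * (x ^ p) ^ N)] (mod P ^ 2)"
    using fc[of "g * _"] by (intro cong_sum) (simp add: power_mult_distrib)
  also have "(\<Sum>x\<in>residues_p. (g ^ p) ^ N * (x ^ p) ^ N) = (g ^ p) ^ N * (\<Sum>x\<in>residues_p. (x ^ p) ^ N)"
    by (simp add: sum_distrib_left)
  also have "[\<dots> = (g ^ p) ^ N * S] (mod P ^ 2)"
    by (intro cong_mult cong_refl S)
  finally have "P ^ 2 dvd ((g ^ p) ^ N - 1) * S"
    by (simp add: cong_iff_dvd_diff left_diff_distrib dvd_diff_commute)
  moreover have "\<not> P dvd (g ^ p) ^ N - 1"
  proof
    assume "P dvd (g ^ p) ^ N - 1"
    then have "[(g ^ p) ^ N = 1] (mod P)" by (simp add: cong_iff_dvd_diff)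
    moreover have "[(g ^ p) ^ N = g ^ N] (mod P)" by (intro cong_pow power_p)
    ultimately have "[g ^ N = 1] (mod P)" using cong_sym cong_trans by blast
    then show False using g(2) False by simp
  qed
  then have "coprime (P ^ 2) ((g ^ p) ^ N - 1)"
    using prime_int_p by (simp add: prime_imp_coprime)
  ultimately have "P ^ 2 dvd S" by (simp add: coprime_dvd_mult_right_iff)
  then have "[S = 0] (mod P ^ 2)" by (simp add: cong_0_iff)
  then show ?thesis using S False cong_trans by simp
qed

lemma binomial_power_sum:
  "[(\<Sum>x\<in>residues_p. (x ^ p) ^ (3 * m) * (1 - x ^ p) ^ M) =
     (\<Sum>j | j \<le> M \<and> 4 * m dvd 3 * m + j. (-1) ^ j * int (M choose j) * (P - 1))] (mod P ^ 2)"
proof -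
  have "(\<Sum>x\<in>residues_p. (x ^ p) ^ (3 * m) * (1 - x ^ p) ^ M) =
    (\<Sum>x\<in>residues_p. \<Sum>j\<le>M. (-1) ^ j * int (M choose j) * (x ^ p) ^ (3 * m + j))"
  proof (rule sum.cong[OF refl])
    fix x
    have "(1 - x ^ p) ^ M = (\<Sum>j\<le>M. int (M choose j) * (- (x ^ p)) ^ j)"
      using binomial_ring[of "- (x ^ p)" 1 M] by simp
    also have "\<dots> = (\<Sum>j\<le>M. (-1) ^ j * int (M choose j) * (x ^ p) ^ j)"
      by (intro sum.cong refl) (simp add: power_minus[of "x ^ p"])
    finally show "(x ^ p) ^ (3 * m) * (1 - x ^ p) ^ M =
        (\<Sum>j\<le>M. (-1) ^ j * int (M choose j) * (x ^ p) ^ (3 * m + j))"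
      by (simp add: sum_distrib_left power_add mult_ac)
  qed
  also have "\<dots> = (\<Sum>j\<le>M. \<Sum>x\<in>residues_p. (-1) ^ j * int (M choose j) * (x ^ p) ^ (3 * m + j))"
    by (rule sum.swap)
  also have "\<dots> = (\<Sum>j\<le>M. (-1) ^ j * int (M choose j) * (\<Sum>x\<in>residues_p. (x ^ p) ^ (3 * m + j)))"
    by (simp add: sum_distrib_left)
  also have "[\<dots> = (\<Sum>j\<le>M. (-1) ^ j * int (M choose j) * (if 4 * m dvd 3 * m + j then P - 1 else 0))] (mod P ^ 2)"
    using m_pos by (intro cong_sum cong_mult cong_refl power_sum_zcong) auto
  also have "(\<Sum>j\<le>M. (-1) ^ j * int (M choose j) * (if 4 * m dvd 3 * m + j then P - 1 else 0)) =
    (\<Sum>j | j \<le> M \<and> 4 * m dvd 3 * m + j. (-1) ^ j * int (M choose j) * (P - 1))"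
    by (rule sum.mono_neutral_cong_right) auto
  finally show ?thesis .
qed

lemma binomial_power_sum_2m:
  "[(\<Sum>x\<in>residues_p. (x ^ p) ^ (3 * m) * (1 - x ^ p) ^ (2 * m)) =
     (P - 1) * (-1) ^ m * int (2 * m choose m)] (mod P ^ 2)"
proof -
  have set: "{j. j \<le> 2 * m \<and> 4 * m dvd 3 * m + j} = {m}"
  proof (intro Set.set_eqI iffI)
    fix j assume "j \<in> {j. j \<le> 2 * m \<and> 4 * m dvd 3 * m + j}"
    then obtain c where c: "j \<le> 2 * m" "3 * m + j = 4 * m * c" by blast
    then have "0 < m * c" "m * c < m * 2" using m_pos by linarith+
    then have "c = 1" by simp
    then show "j \<in> {m}" using c by simp
  qed auto
  have "(\<Sum>j | j \<le> 2 * m \<and> 4 * m dvd 3 * m + j. (-1) ^ j * int (2 * m choose j) * (P - 1)) =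
      (P - 1) * (-1) ^ m * int (2 * m choose m)"
    unfolding set by (simp add: mult_ac)
  then show ?thesis using binomial_power_sum[of "2 * m"] by (simp only:)
qed

text \<open>Among the exponents 3m + j with j up to 6m, just 4m and 8m are multiples of 4m. The
  contributions of j = m and j = 5m agree by symmetry, whence the factor 2.\<close>

lemma binomial_power_sum_6m:
  "[(\<Sum>x\<in>residues_p. (x ^ p) ^ (3 * m) * (1 - x ^ p) ^ (6 * m)) =
     (P - 1) * (-1) ^ m * (2 * int (6 * m choose m))] (mod P ^ 2)"
proof -
  have set: "{j. j \<le> 6 * m \<and> 4 * m dvd 3 * m + j} = {m, 5 * m}"
  proof (intro Set.set_eqI iffI)
    fix j assume "j \<in> {j. j \<le> 6 * m \<and> 4 * m dvd 3 * m + j}"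
    then obtain c where c: "j \<le> 6 * m" "3 * m + j = 4 * m * c" by blast
    then have "0 < m * c" "m * c < m * 3" using m_pos by linarith+
    then have "c = 1 \<or> c = 2" by auto
    then show "j \<in> {m, 5 * m}" using c by auto
  qed auto
  have sym: "(6 * m) choose (5 * m) = (6 * m) choose m"
    using binomial_symmetric[of "5 * m" "6 * m"] by simp
  have sgn: "(-1 :: int) ^ (5 * m) = (-1) ^ m"
    by (cases "even m") auto
  have "m \<noteq> 5 * m" using m_pos by simp
  then have "(\<Sum>j | j \<le> 6 * m \<and> 4 * m dvd 3 * m + j. (-1) ^ j * int (6 * m choose j) * (P - 1)) =
      (-1) ^ m * int (6 * m choose m) * (P - 1) + (-1) ^ (5 * m) * int (6 * m choose (5 * m)) * (P - 1)"
    unfolding set by simp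
  also have "\<dots> = (P - 1) * (-1) ^ m * (2 * int (6 * m choose m))"
    unfolding sym sgn by (simp only: mult_2 distrib_left mult_ac)
  finally show ?thesis using binomial_power_sum[of "6 * m"] by (simp only:)
qed

lemma gauss_eval_norm:
  assumes "[\<iota> ^ 2 = -1] (mod P)" "gaussian_int z" "P dvd gauss_eval \<iota> z"
  shows "P dvd \<lfloor>Re z\<rfloor> ^ 2 + \<lfloor>Im z\<rfloor> ^ 2"
proof -
  obtain a b where z: "z = Complex (of_int a) (of_int b)" using gaussian_int_obtain[OF assms(2)] .
  have "P dvd (a + b * \<iota>) * (a - b * \<iota>)"
    using assms(3) by (simp add: z)
  moreover have "P dvd b ^ 2 * (\<iota> ^ 2 - -1)"
    using assms(1) unfolding cong_iff_dvd_diff by (rule dvd_mult)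
  ultimately have "P dvd (a + b * \<iota>) * (a - b * \<iota>) + b ^ 2 * (\<iota> ^ 2 - -1)"
    by (rule dvd_add)
  also have "(a + b * \<iota>) * (a - b * \<iota>) + b ^ 2 * (\<iota> ^ 2 - -1) = a ^ 2 + b ^ 2"
    by (simp add: algebra_simps power2_eq_square)
  finally show ?thesis by (simp add: z)
qed

text \<open>The difference of two distinct elements has norm 1, 2 or 4, and p, being at least 5,
  divides none of these. Hence a value of the symbol is determined by its reduction modulo
  p.\<close>

lemma gauss_units0_eqI:
  assumes i: "[\<iota> ^ 2 = -1] (mod P)" and z: "z \<in> gauss_units0" "w \<in> gauss_units0"
    and c: "[gauss_eval \<iota> z = gauss_eval \<iota> w] (mod P)"
  shows "z = w"
proof (rule ccontr)
  assume ne: "z \<noteq> w"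
  have g: "gaussian_int z" "gaussian_int w" using z by (auto intro: gaussian_int_units0)
  have "gaussian_int (z - w)" using g by (auto simp: gaussian_int_def)
  moreover have "P dvd gauss_eval \<iota> (z - w)"
    using c g by (simp add: gauss_eval_diff cong_iff_dvd_diff)
  ultimately have "P dvd \<lfloor>Re (z - w)\<rfloor> ^ 2 + \<lfloor>Im (z - w)\<rfloor> ^ 2"
    by (rule gauss_eval_norm[OF i])
  moreover have "\<lfloor>Re (z - w)\<rfloor> ^ 2 + \<lfloor>Im (z - w)\<rfloor> ^ 2 \<in> {1, 2, 4}"
  proof -
    have "\<lfloor>- 1 :: real\<rfloor> = - 1" "\<lfloor>- 2 :: real\<rfloor> = - 2" by (simp_all add: floor_eq_iff)
    then show ?thesis using z ne by (auto simp: gauss_units0_def)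
  qed
  moreover have "\<not> P dvd k" if "k \<in> {1, 2, 4}" for k
    using that not_P_dvd_small[of k] by auto
  ultimately show False by blast
qed

lemma prime_dvd_cases: "P dvd a * b \<Longrightarrow> P dvd a \<or> P dvd b"
  using prime_int_p by (simp add: prime_dvd_mult_iff)

lemma gauss_units0_exists:
  assumes i: "[\<iota> ^ 2 = -1] (mod P)"
  shows "\<exists>z\<in>gauss_units0. [gauss_eval \<iota> z = x ^ (3 * m)] (mod P)"
proof (cases "P dvd x")
  case True
  then have "P dvd x ^ (3 * m)" using m_pos by (simp add: dvd_power_le[of P x 1 "3 * m", simplified])
  then show ?thesis
    by (intro bexI[of _ 0]) (auto simp: gauss_units0_def cong_iff_dvd_diff)
next
  case False
  define t where "t = x ^ (3 * m)"
  have "[(x ^ (4 * m)) ^ 3 = 1 ^ 3] (mod P)" by (intro cong_pow power_4m False)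
  then have "[t ^ 4 = 1] (mod P)"
    by (simp add: t_def flip: power_mult)
  \<comment> \<open>Modulo p, t^4 - 1 splits into linear factors with the roots 1, -1,
    \<open>\<iota>\<close> and \<open>-\<iota>\<close>; one of the factors is divisible by
    p.\<close>
  then have "P dvd t ^ 4 - 1" by (simp add: cong_iff_dvd_diff)
  moreover have "P dvd (\<iota> ^ 2 - -1) * (t ^ 2 - 1)"
    using i unfolding cong_iff_dvd_diff by (rule dvd_mult2)
  ultimately have "P dvd (t ^ 4 - 1) - (\<iota> ^ 2 - -1) * (t ^ 2 - 1)" by (rule dvd_diff)
  also have "(t ^ 4 - 1) - (\<iota> ^ 2 - -1) * (t ^ 2 - 1) = (1 - t) * ((-1 - t) * ((\<iota> - t) * (- \<iota> - t)))"
    by (simp add: algebra_simps power2_eq_square power4_eq_xxxx)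
  finally consider "P dvd 1 - t" | "P dvd -1 - t" | "P dvd \<iota> - t" | "P dvd - \<iota> - t"
    using prime_dvd_cases by metis
  then show ?thesis
  proof cases
    case 1
    then show ?thesis by (intro bexI[of _ 1]) (auto simp: gauss_units0_def cong_iff_dvd_diff t_def)
  next
    case 2
    then show ?thesis by (intro bexI[of _ "-1"]) (auto simp: gauss_units0_def cong_iff_dvd_diff t_def)
  next
    case 3
    then show ?thesis by (intro bexI[of _ \<i>]) (auto simp: gauss_units0_def cong_iff_dvd_diff t_def)
  next
    case 4
    then show ?thesis by (intro bexI[of _ "-\<i>"]) (auto simp: gauss_units0_def cong_iff_dvd_diff t_def)
  qed
qed

text \<open>The exponent 3m instead of m selects the conjugate of the usual symbol. It makes the
  value of J a unit modulo p: in the expansion the term j = m survives because 3m + m = 4m. The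
  conjugate of J is sent to a multiple of p.\<close>

definition quartic_symbol :: "int \<Rightarrow> int \<Rightarrow> complex" where
  "quartic_symbol \<iota> x = (SOME z. z \<in> gauss_units0 \<and> [gauss_eval \<iota> z = x ^ (3 * m)] (mod P))"

lemma quartic_symbol:
  assumes "[\<iota> ^ 2 = -1] (mod P)"
  shows "quartic_symbol \<iota> x \<in> gauss_units0"
    and "[gauss_eval \<iota> (quartic_symbol \<iota> x) = x ^ (3 * m)] (mod P)"
  using someI_ex[of "\<lambda>z. z \<in> gauss_units0 \<and> [gauss_eval \<iota> z = x ^ (3 * m)] (mod P)"]
    gauss_units0_exists[OF assms, of x] unfolding quartic_symbol_def by blast+

lemma quartic_symbol_eqI:
  assumes "[\<iota> ^ 2 = -1] (mod P)" "z \<in> gauss_units0" "[gauss_eval \<iota> z = x ^ (3 * m)] (mod P)"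
  shows "quartic_symbol \<iota> x = z"
  using quartic_symbol[OF assms(1), of x] assms cong_trans cong_sym
  by (intro gauss_units0_eqI[OF assms(1)]) blast+

text \<open>As p = 1 modulo 4, p-th powers fix fourth roots of unity, even modulo p^2; this allows
  values of the symbol to be lifted by \<open>cong_power_p\<close>.\<close>

lemma gauss_eval_units0_power_p:
  assumes i: "[\<iota> ^ 2 = -1] (mod P ^ 2)" and "z \<in> gauss_units0"
  shows "[gauss_eval \<iota> z ^ p = gauss_eval \<iota> z] (mod P ^ 2)"
proof -
  have "[(\<iota> ^ 2) ^ (2 * m) * \<iota> = (-1) ^ (2 * m) * \<iota>] (mod P ^ 2)"
    by (intro cong_mult cong_pow i cong_refl)
  moreover have "\<iota> ^ p = (\<iota> ^ 2) ^ (2 * m) * \<iota>"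
    by (simp add: p_eq mult.commute flip: power_mult)
  ultimately have a: "[\<iota> ^ p = \<iota>] (mod P ^ 2)"
    by simp
  have o: "odd p" using p_eq by simp
  have "[(- \<iota>) ^ p = - \<iota>] (mod P ^ 2)"
    using a o by (simp add: power_minus_odd cong_minus_minus_iff)
  with a o show ?thesis using assms(2) p_gt by (auto simp: gauss_units0_def power_0_left)
qed

lemma quartic_char_symbol:
  assumes i: "[\<iota> ^ 2 = -1] (mod P)"
    and g: "\<not> P dvd g" "\<And>k. [g ^ k = 1] (mod P) \<longleftrightarrow> 4 * m dvd k"
  shows "quartic_char p m (quartic_symbol \<iota>) g"
proof
  show "periodic (quartic_symbol \<iota>)"
    unfolding periodic_def
  proof (intro allI impI)
    fix x y assume "[x = y] (mod P)"
    then have "[y ^ (3 * m) = x ^ (3 * m)] (mod P)" by (intro cong_pow) (rule cong_sym)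
    then show "quartic_symbol \<iota> x = quartic_symbol \<iota> y"
      using quartic_symbol[OF i, of y] by (intro quartic_symbol_eqI i) (auto intro: cong_trans)
  qed
  show "quartic_symbol \<iota> (x * y) = quartic_symbol \<iota> x * quartic_symbol \<iota> y" for x y
  proof (rule quartic_symbol_eqI[OF i])
    show "quartic_symbol \<iota> x * quartic_symbol \<iota> y \<in> gauss_units0"
      by (intro gauss_units0_mult quartic_symbol i)
    have "[gauss_eval \<iota> (quartic_symbol \<iota> x * quartic_symbol \<iota> y) =
        gauss_eval \<iota> (quartic_symbol \<iota> x) * gauss_eval \<iota> (quartic_symbol \<iota> y)] (mod P)"
      by (intro gauss_eval_mult gaussian_int_units0 quartic_symbol i)
    also have "[gauss_eval \<iota> (quartic_symbol \<iota> x) * gauss_eval \<iota> (quartic_symbol \<iota> y) =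
        x ^ (3 * m) * y ^ (3 * m)] (mod P)"
      by (intro cong_mult quartic_symbol i)
    finally show "[gauss_eval \<iota> (quartic_symbol \<iota> x * quartic_symbol \<iota> y) = (x * y) ^ (3 * m)] (mod P)"
      by (simp add: power_mult_distrib)
  qed
  show z: "quartic_symbol \<iota> x = 0 \<longleftrightarrow> P dvd x" for x
  proof
    assume "quartic_symbol \<iota> x = 0"
    then have "[0 = x ^ (3 * m)] (mod P)" using quartic_symbol(2)[OF i, of x] by simp
    then have "P dvd x ^ (3 * m)" by (simp add: cong_iff_dvd_diff)
    then show "P dvd x" using prime_int_p prime_dvd_power by blast
  next
    assume "P dvd x"
    then have "P dvd x ^ (3 * m)" using m_pos by (simp add: dvd_power_le[of P x 1 "3 * m", simplified])
    then show "quartic_symbol \<iota> x = 0"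
      by (intro quartic_symbol_eqI i) (auto simp: gauss_units0_def cong_iff_dvd_diff)
  qed
  show v: "quartic_symbol \<iota> x \<in> {0, 1, -1, \<i>, -\<i>}" for x
    using quartic_symbol(1)[OF i, of x] by (simp add: gauss_units0_def)
  show "quartic_symbol \<iota> x ^ 4 = 1" if "\<not> P dvd x" for x
    using v[of x] z[of x] that by (auto simp: power4_eq_xxxx)
  show "\<not> P dvd g" by (rule g)
  \<comment> \<open>The value 1 would give g^(6m) = 1 modulo p, but 4m does not divide 6m.\<close>
  show "quartic_symbol \<iota> g ^ 2 \<noteq> 1"
  proof
    assume "quartic_symbol \<iota> g ^ 2 = 1"
    then have "quartic_symbol \<iota> g \<in> {1, -1}" by (simp add: power2_eq_1_iff)
    then have "gauss_eval \<iota> (quartic_symbol \<iota> g) ^ 2 = 1" by auto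
    then have "[1 = (g ^ (3 * m)) ^ 2] (mod P)"
      using cong_pow[OF quartic_symbol(2)[OF i, of g], of 2] by simp
    then have "4 * m dvd 3 * m * 2" using g(2) by (simp only: power_mult[symmetric] cong_sym_eq)
    then have "m * 4 dvd m * 6" by (simp add: mult.commute)
    then show False using m_pos by simp
  qed
qed

end

text \<open>A Newton step towards a square root of 1.\<close>

lemma cong_square_lift:
  fixes e w M :: int
  assumes "[w = e] (mod M)" "e ^ 2 = 1"
  shows "[3 * w - w ^ 3 = 2 * e] (mod M ^ 2)"
proof -
  obtain k where w: "w = e + M * k"
    using assms(1) by (metis cong_iff_lin cong_sym)
  have "3 * w - w ^ 3 - 2 * e = M ^ 2 * (- 3 * e * k ^ 2 - M * k ^ 3) + (1 - e ^ 2) * (e + 3 * M * k)"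
    unfolding w by (simp add: algebra_simps power2_eq_square power3_eq_cube)
  then have "3 * w - w ^ 3 - 2 * e = M ^ 2 * (- 3 * e * k ^ 2 - M * k ^ 3)"
    using assms(2) by simp
  then show ?thesis by (simp only: cong_iff_dvd_diff) simp
qed

locale quartic_eval = quartic_char +
  fixes \<iota> :: int
  assumes iota: "[\<iota> ^ 2 = -1] (mod P ^ 2)"
    and chi_eval: "\<And>x. [gauss_eval \<iota> (\<chi> x) = x ^ (3 * m)] (mod P)"
begin

lemma chi_units0: "\<chi> x \<in> gauss_units0"
  using chi_values[of x] by (simp add: gauss_units0_def)

lemma chi_eval_lift: "[gauss_eval \<iota> (\<chi> x) = (x ^ p) ^ (3 * m)] (mod P ^ 2)"
proof -
  have "[gauss_eval \<iota> (\<chi> x) = gauss_eval \<iota> (\<chi> x) ^ p] (mod P ^ 2)"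
    by (rule cong_sym[OF gauss_eval_units0_power_p[OF iota chi_units0]])
  also have "[gauss_eval \<iota> (\<chi> x) ^ p = (x ^ (3 * m)) ^ p] (mod P ^ 2)"
    using p_gt by (intro cong_power_p chi_eval) auto
  also have "(x ^ (3 * m)) ^ p = (x ^ p) ^ (3 * m)"
    by (simp add: mult.commute flip: power_mult)
  finally show ?thesis .
qed

text \<open>w = (1 - x^p)^(2m) is a sign only modulo p, as 1 - x^p need not be a p-th power modulo
  p^2. \<open>cong_square_lift\<close> makes it precise modulo p^2 at the price of w^3, that is of
  the exponent 6m.\<close>

lemma rho_eval_lift:
  assumes "x \<in> residues_p"
  shows "[2 * gauss_eval \<iota> (\<rho> (1 - x)) = 3 * (1 - x ^ p) ^ (2 * m) - (1 - x ^ p) ^ (6 * m)] (mod P ^ 2)"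
proof (cases "P dvd 1 - x")
  case True
  then have "[x = 1] (mod P)" by (simp add: cong_iff_dvd_diff dvd_diff_commute)
  then have "x = 1" using residues_cong_eq[OF assms, of 1] P_gt_1 by simp
  then show ?thesis using True rho_0_iff[of "1 - x"] m_pos by (simp add: power_0_left)
next
  case False
  define e where "e = gauss_eval \<iota> (\<rho> (1 - x))"
  have "\<rho> (1 - x) \<noteq> 0" using False rho_0_iff by simp
  then have "\<rho> (1 - x) \<in> {1, -1}"
    using chi_values[of "1 - x"] by (auto simp: \<rho>_def)
  then have e: "e ^ 2 = 1" by (auto simp: e_def)
  have "[e = gauss_eval \<iota> (\<chi> (1 - x)) * gauss_eval \<iota> (\<chi> (1 - x))] (mod P)"
    unfolding e_def \<rho>_def power2_eq_square
    by (intro gauss_eval_mult gaussian_int_chi cong_square_modulus[OF iota])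
  also have "[gauss_eval \<iota> (\<chi> (1 - x)) * gauss_eval \<iota> (\<chi> (1 - x)) = (1 - x) ^ (3 * m) * (1 - x) ^ (3 * m)] (mod P)"
    by (intro cong_mult chi_eval)
  also have "(1 - x) ^ (3 * m) * (1 - x) ^ (3 * m) = (1 - x) ^ (4 * m) * (1 - x) ^ (2 * m)"
    by (simp flip: power_add)
  also have "[(1 - x) ^ (4 * m) * (1 - x) ^ (2 * m) = 1 * (1 - x ^ p) ^ (2 * m)] (mod P)"
    using False by (intro cong_mult power_4m cong_pow cong_diff cong_refl) (simp_all add: power_p cong_sym)
  finally have "[(1 - x ^ p) ^ (2 * m) = e] (mod P)" by (simp add: cong_sym)
  from cong_square_lift[OF this e]
  have "[3 * (1 - x ^ p) ^ (2 * m) - ((1 - x ^ p) ^ (2 * m)) ^ 3 = 2 * e] (mod P ^ 2)" .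
  moreover have "((1 - x ^ p) ^ (2 * m)) ^ 3 = (1 - x ^ p) ^ (6 * m)"
    by (simp flip: power_mult)
  ultimately show ?thesis unfolding e_def by (simp only: cong_sym_eq)
qed

lemma J_gaussian: "gaussian_int J"
  unfolding J_def by (intro gaussian_int_sum gaussian_int_mult gaussian_int_chi gaussian_int_rho)

text \<open>The exponents 2m and 6m of \<open>rho_eval_lift\<close> lead to the two binomial power
  sums; the result has the shape of the hypothesis of \<open>jacobi_value_square\<close>.\<close>

lemma J_eval:
  "[2 * gauss_eval \<iota> J = (P - 1) * (-1) ^ m * (3 * int (2 * m choose m) - 2 * int (6 * m choose m))] (mod P ^ 2)"
proof -
  have "2 * gauss_eval \<iota> J = (\<Sum>x\<in>residues_p. 2 * gauss_eval \<iota> (\<chi> x * \<rho> (1 - x)))"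
    unfolding J_def by (simp add: gauss_eval_sum gaussian_int_mult gaussian_int_chi gaussian_int_rho sum_distrib_left)
  also have "[\<dots> = (\<Sum>x\<in>residues_p. (x ^ p) ^ (3 * m) * (3 * (1 - x ^ p) ^ (2 * m) - (1 - x ^ p) ^ (6 * m)))] (mod P ^ 2)"
  proof (rule cong_sum)
    fix x assume x: "x \<in> residues_p"
    have "[2 * gauss_eval \<iota> (\<chi> x * \<rho> (1 - x)) = 2 * (gauss_eval \<iota> (\<chi> x) * gauss_eval \<iota> (\<rho> (1 - x)))] (mod P ^ 2)"
      by (intro cong_mult cong_refl gauss_eval_mult gaussian_int_chi gaussian_int_rho iota)
    also have "2 * (gauss_eval \<iota> (\<chi> x) * gauss_eval \<iota> (\<rho> (1 - x))) = gauss_eval \<iota> (\<chi> x) * (2 * gauss_eval \<iota> (\<rho> (1 - x)))"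
      by simp
    also have "[\<dots> = (x ^ p) ^ (3 * m) * (3 * (1 - x ^ p) ^ (2 * m) - (1 - x ^ p) ^ (6 * m))] (mod P ^ 2)"
      by (intro cong_mult chi_eval_lift rho_eval_lift x)
    finally show "[2 * gauss_eval \<iota> (\<chi> x * \<rho> (1 - x)) =
      (x ^ p) ^ (3 * m) * (3 * (1 - x ^ p) ^ (2 * m) - (1 - x ^ p) ^ (6 * m))] (mod P ^ 2)" .
  qed
  also have "(\<Sum>x\<in>residues_p. (x ^ p) ^ (3 * m) * (3 * (1 - x ^ p) ^ (2 * m) - (1 - x ^ p) ^ (6 * m))) =
     3 * (\<Sum>x\<in>residues_p. (x ^ p) ^ (3 * m) * (1 - x ^ p) ^ (2 * m))
     - (\<Sum>x\<in>residues_p. (x ^ p) ^ (3 * m) * (1 - x ^ p) ^ (6 * m))"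
    unfolding sum_distrib_left sum_subtractf[symmetric] by (intro sum.cong) (simp_all add: algebra_simps)
  also have "[\<dots> = 3 * ((P - 1) * (-1) ^ m * int (2 * m choose m)) - (P - 1) * (-1) ^ m * (2 * int (6 * m choose m))] (mod P ^ 2)"
    by (intro cong_diff cong_mult cong_refl binomial_power_sum_2m binomial_power_sum_6m)
  finally show ?thesis by (simp add: algebra_simps)
qed

end

section \<open>Sums of two squares and identification of the values\<close>

lemma prime_two_squares_unique:
  fixes q a b c d :: int
  assumes q: "prime q" and ab: "q = a ^ 2 + b ^ 2" and cd: "q = c ^ 2 + d ^ 2"
  shows "(a ^ 2 = c ^ 2 \<and> b ^ 2 = d ^ 2) \<or> (a ^ 2 = d ^ 2 \<and> b ^ 2 = c ^ 2)"
proof -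
  have q0: "q > 0" using q prime_gt_0_int by blast
  \<comment> \<open>One argument for both signs, e = c and e = -c. In (ae+bd)^2 + (ad-be)^2 = q^2
    the second square is q^2 k^2, so k^2 is 0 or 1 and one of the two squares vanishes.\<close>
  have aux: ?thesis if e: "q dvd a * d - b * e" "e ^ 2 = c ^ 2" for e
  proof -
    obtain k where k: "a * d - b * e = q * k" using e(1) by blast
    have id: "(a * e + b * d) ^ 2 + (a * d - b * e) ^ 2 = q ^ 2"
    proof -
      have "(a * e + b * d) ^ 2 + (a * d - b * e) ^ 2 = (a ^ 2 + b ^ 2) * (e ^ 2 + d ^ 2)"
        by (simp add: algebra_simps power2_eq_square)
      also have "\<dots> = q * q" using ab cd e(2) by simp
      finally show ?thesis by (simp add: power2_eq_square)
    qed
    have "q ^ 2 * k ^ 2 \<le> q ^ 2 * 1"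
      using id zero_le_power2[of "a * e + b * d"] unfolding k power_mult_distrib by linarith
    then have "k ^ 2 \<le> 1" using q0 by (simp only: mult_le_cancel_left_pos zero_less_power)
    show ?thesis
    proof (cases "k = 0")
      case True
      then have "(a * d) ^ 2 = (b * e) ^ 2" using k by simp
      then have "(a * d) ^ 2 = b ^ 2 * c ^ 2" by (simp add: power_mult_distrib e(2))
      then have "a ^ 2 * d ^ 2 - b ^ 2 * c ^ 2 = 0" by (simp add: power_mult_distrib)
      moreover have "a ^ 2 = q - b ^ 2" "c ^ 2 = q - d ^ 2" using ab cd by simp_all
      ultimately have "q * (d ^ 2 - b ^ 2) = 0" by (simp add: algebra_simps)
      then have "d ^ 2 = b ^ 2" using q0 by simp
      then show ?thesis using ab cd by simp
    next
      case False
      then have "k ^ 2 \<ge> 1" by (simp add: int_one_le_iff_zero_less)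
      then have "k ^ 2 = 1" using \<open>k ^ 2 \<le> 1\<close> by simp
      then have "(a * e + b * d) ^ 2 = 0" using id k by (simp add: power_mult_distrib)
      then have "a * e = - (b * d)" by simp
      then have "(a * e) ^ 2 = (b * d) ^ 2" by simp
      then have "a ^ 2 * c ^ 2 - b ^ 2 * d ^ 2 = 0" by (simp add: power_mult_distrib e(2))
      moreover have "q - a ^ 2 = b ^ 2" "q - c ^ 2 = d ^ 2" using ab cd by simp_all
      moreover have "q * (a ^ 2 + c ^ 2 - q) = a ^ 2 * c ^ 2 - (q - a ^ 2) * (q - c ^ 2)"
        by (simp add: algebra_simps)
      ultimately have "q * (a ^ 2 + c ^ 2 - q) = 0" by simp
      then have "a ^ 2 + c ^ 2 = q" using q0 by simp
      then show ?thesis using ab cd by simp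
    qed
  qed
  have "(a * d - b * c) * (a * d - b * (- c)) = a ^ 2 * d ^ 2 - b ^ 2 * c ^ 2"
    by (simp add: algebra_simps power2_eq_square)
  also have "\<dots> = q * (d ^ 2 - b ^ 2)"
  proof -
    have sq: "a ^ 2 = q - b ^ 2" "c ^ 2 = q - d ^ 2" using ab cd by simp_all
    show ?thesis unfolding sq by (simp add: algebra_simps)
  qed
  finally have "q dvd (a * d - b * c) * (a * d - b * (- c))" by simp
  then have "q dvd a * d - b * c \<or> q dvd a * d - b * (- c)"
    using q by (simp add: prime_dvd_mult_iff)
  then show ?thesis using aux[of c] aux[of "- c"] by auto
qed

lemma square_mod_3: "x ^ 2 mod 3 = (if 3 dvd x then 0 else 1)" for x :: int
proof -
  have e: "x ^ 2 mod 3 = (x mod 3) ^ 2 mod 3" by (simp add: power_mod)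
  have "x mod 3 = 0 \<or> x mod 3 = 1 \<or> x mod 3 = 2" by presburger
  then show ?thesis unfolding e dvd_eq_mod_eq_0 by (elim disjE) simp_all
qed

context quartic_eval
begin

definition U :: int where "U = gauss_eval \<iota> J"

text \<open>Modulo p, U^2 is up to sign a quotient of factorials of numbers below p, hence a unit.
  This decides which of the conjugate values A + B \<open>\<iota>\<close> and A - B
  \<open>\<iota>\<close> is divisible by p.\<close>

lemma not_P_dvd_U: "\<not> P dvd U"
proof
  assume "P dvd U"
  then have "[U ^ 2 = 0] (mod P ^ 1)" by (simp add: cong_0_iff power2_eq_square)
  then have a: "zcong 1 (of_int (U ^ 2)) (of_int 0)" by (rule zcong_of_int)
  have "zcong 2 (of_int (U ^ 2)) ((-1) ^ m * (fact (3 * m) / fact m ^ 3))"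
    using J_eval unfolding U_def by (rule jacobi_value_square)
  then have b: "zcong 1 (of_int (U ^ 2)) ((-1) ^ m * (fact (3 * m) / fact m ^ 3))"
    by (rule zcong_mono) simp
  have "zcong 1 ((-1) ^ m * (fact (3 * m) / fact m ^ 3)) (of_int 0)"
    by (rule zcong_trans[OF zcong_sym[OF b] a])
  moreover have u: "runit ((-1) ^ m * (fact (3 * m) / fact m ^ 3))"
    using p_eq by (intro runit_mult runit_divide runit_power runit_fact runit_uminus runit_1) auto
  ultimately have "zcong 1 (((-1) ^ m * (fact (3 * m) / fact m ^ 3)) * 1) (((-1) ^ m * (fact (3 * m) / fact m ^ 3)) * 0)"
    by simp
  then have "zcong 1 (of_int 1) (of_int 0)" using zcong_cancel[OF _ u] by simp
  then have "[1 = 0] (mod P ^ 1)" by (rule zcong_int_imp)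
  then show False using P_gt_1 by (simp add: cong_0_iff)
qed

text \<open>With V = A - B \<open>\<iota>\<close>, p divides UV and hence V, so V^2 vanishes modulo
  p^2. The two forms of U^2 are those of U^2 + V^2 and U^2 - V^2; the first serves the real values
  of \<open>\<chi> (-3)\<close>, the second the imaginary ones.\<close>

lemma J_coords:
  obtains A B :: int where "J = Complex (of_int A) (of_int B)" "P = A ^ 2 + B ^ 2"
    "[U ^ 2 = 2 * (A ^ 2 - B ^ 2)] (mod P ^ 2)" "[U ^ 2 = 4 * (A * B) * \<iota>] (mod P ^ 2)"
proof -
  obtain A B :: int where J: "J = Complex (of_int A) (of_int B)"
    using gaussian_int_obtain[OF J_gaussian] .
  have "Re (J * cnj J) = of_int (A ^ 2 + B ^ 2)" by (simp add: J power2_eq_square)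
  then have "real_of_int P = of_int (A ^ 2 + B ^ 2)" by (simp only: J_norm) simp
  then have P: "P = A ^ 2 + B ^ 2" by (simp only: of_int_eq_iff)
  define V where "V = A - B * \<iota>"
  have U: "U = A + B * \<iota>" by (simp add: U_def J)
  have "U * V = P - B ^ 2 * (\<iota> ^ 2 - -1)"
    unfolding U V_def P by (simp add: algebra_simps power2_eq_square)
  moreover have d: "P ^ 2 dvd \<iota> ^ 2 - -1" using iota by (simp only: cong_iff_dvd_diff)
  then have "P dvd \<iota> ^ 2 - -1" by (metis dvd_trans dvd_triv_left power2_eq_square)
  ultimately have "P dvd U * V" by (metis dvd_diff dvd_mult dvd_refl)
  then have "P dvd V" using prime_dvd_cases not_P_dvd_U by blast
  then have V2: "P ^ 2 dvd V ^ 2" by simp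
  have "U ^ 2 - 2 * (A ^ 2 - B ^ 2) = 2 * B ^ 2 * (\<iota> ^ 2 - -1) - V ^ 2"
    unfolding U V_def by (simp add: algebra_simps power2_eq_square)
  moreover have "P ^ 2 dvd 2 * B ^ 2 * (\<iota> ^ 2 - -1) - V ^ 2" by (rule dvd_diff[OF dvd_mult[OF d] V2])
  ultimately have 1: "[U ^ 2 = 2 * (A ^ 2 - B ^ 2)] (mod P ^ 2)" by (simp only: cong_iff_dvd_diff)
  have "U ^ 2 - 4 * (A * B) * \<iota> = V ^ 2"
    unfolding U V_def by (simp add: algebra_simps power2_eq_square)
  then have 2: "[U ^ 2 = 4 * (A * B) * \<iota>] (mod P ^ 2)" using V2 by (simp only: cong_iff_dvd_diff)
  show ?thesis using that[OF J P 1 2] .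
qed

text \<open>The exponents 9pm and pm differ by 8pm, and (-3)^(4pm) = 1 modulo p^2. The cube is the
  inverse of the fourth root of unity belonging to \<open>\<chi> (-3)\<close>.\<close>

lemma tau_cong: "[(-3) ^ (p * m) = gauss_eval \<iota> (\<chi> (-3)) ^ 3] (mod P ^ 2)"
proof -
  have n3: "\<not> P dvd -3" using not_P_dvd_small[of 3] by simp
  have "[gauss_eval \<iota> (\<chi> (-3)) ^ 3 = (((-3) ^ p) ^ (3 * m)) ^ 3] (mod P ^ 2)"
    by (intro cong_pow chi_eval_lift)
  also have "(((-3) ^ p) ^ (3 * m)) ^ 3 = (((-3) ^ (4 * m)) ^ p) ^ 2 * (-3 :: int) ^ (p * m)"
  proof -
    have "p * (3 * m) * 3 = 4 * m * p * 2 + p * m" by simp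
    then show ?thesis by (simp only: power_mult[symmetric] power_add[symmetric])
  qed
  also have "[\<dots> = (1 ^ p) ^ 2 * (-3) ^ (p * m)] (mod P ^ 2)"
    using p_gt n3 by (intro cong_mult cong_pow cong_refl cong_power_p power_4m) auto
  finally show ?thesis by (simp add: cong_sym)
qed

lemma chi_minus_3_cases:
  assumes "J = Complex (of_int A) (of_int B)"
  shows "3 dvd A ^ 2 - B ^ 2 - \<lfloor>Re (\<chi> (-3))\<rfloor>" "3 dvd 2 * (A * B) - \<lfloor>Im (\<chi> (-3))\<rfloor>"
proof -
  obtain M where M: "gaussian_int M" "J ^ 2 = \<chi> (-3) + 3 * M" using J_square_mod_3 by blast
  obtain c d where Mcd: "M = Complex (of_int c) (of_int d)" using gaussian_int_obtain[OF M(1)] .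
  obtain e f where ef: "\<chi> (-3) = Complex (of_int e) (of_int f)" using gaussian_int_obtain[OF gaussian_int_chi] .
  have "real_of_int (A ^ 2 - B ^ 2) = of_int (e + 3 * c)" "real_of_int (2 * (A * B)) = of_int (f + 3 * d)"
    using M(2) by (simp_all add: assms Mcd ef complex_eq_iff power2_eq_square)
  then have "A ^ 2 - B ^ 2 = e + 3 * c" "2 * (A * B) = f + 3 * d" by (simp_all only: of_int_eq_iff)
  then show "3 dvd A ^ 2 - B ^ 2 - \<lfloor>Re (\<chi> (-3))\<rfloor>" "3 dvd 2 * (A * B) - \<lfloor>Im (\<chi> (-3))\<rfloor>"
    by (simp_all add: ef)
qed

lemma chi_minus_3_nonzero: "\<chi> (-3) \<noteq> 0"
  using not_P_dvd_small[of 3] chi_0_iff[of "-3"] by simp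

text \<open>As A^2 + B^2 = 1 modulo 3, exactly one of A, B is divisible by 3 and is 3y up to sign.
  Which one is decided by \<open>\<chi> (-3)\<close>, congruent to A^2 - B^2 modulo 3, and the
  resulting sign of A^2 - B^2 is compensated by the same root of unity. Imaginary values would force
  A^2 = B^2 modulo 3.\<close>

lemma value_1_mod_12:
  assumes xy: "P = x ^ 2 + 9 * y ^ 2" and p12: "P mod 3 = 1"
  shows "[(-3) ^ (p * m) * U ^ 2 = 4 * x ^ 2 - 2 * P] (mod P ^ 2)"
proof -
  obtain A B where AB: "J = Complex (of_int A) (of_int B)" "P = A ^ 2 + B ^ 2"
    "[U ^ 2 = 2 * (A ^ 2 - B ^ 2)] (mod P ^ 2)" "[U ^ 2 = 4 * (A * B) * \<iota>] (mod P ^ 2)"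
    by (rule J_coords)
  note c3 = chi_minus_3_cases[OF AB(1)]
  have uniq: "(A ^ 2 = x ^ 2 \<and> B ^ 2 = (3 * y) ^ 2) \<or> (A ^ 2 = (3 * y) ^ 2 \<and> B ^ 2 = x ^ 2)"
    using AB(2) xy by (intro prime_two_squares_unique[OF prime_int_p]) (simp_all add: power_mult_distrib)
  have AB3: "(A ^ 2 + B ^ 2) mod 3 = 1" using p12 AB(2) by simp
  have sq: "A ^ 2 mod 3 = (if 3 dvd A then 0 else 1)" "B ^ 2 mod 3 = (if 3 dvd B then 0 else 1)"
    by (simp_all add: square_mod_3)
  have y3: "3 dvd C" if "C ^ 2 = (3 * y) ^ 2" for C :: int
  proof -
    have "C ^ 2 = 3 * (3 * y ^ 2)" using that by (simp add: power_mult_distrib)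
    then have "C ^ 2 mod 3 = 0" by simp
    then show ?thesis using square_mod_3[of C] by (auto split: if_splits)
  qed
  have "\<chi> (-3) \<in> {1, -1, \<i>, -\<i>}" using chi_values[of "-3"] chi_minus_3_nonzero by auto
  then consider "\<chi> (-3) = 1" | "\<chi> (-3) = -1" | "\<chi> (-3) = \<i> \<or> \<chi> (-3) = -\<i>" by auto
  then show ?thesis
  proof cases
    case 1
    then have "3 dvd A ^ 2 - B ^ 2 - 1" using c3 by simp
    moreover have "s mod 3 \<noteq> 0" if "3 dvd s - t - 1" "(s + t) mod 3 = 1" for s t :: int
      using that by presburger
    ultimately have "\<not> 3 dvd A" using sq(1) AB3 by fastforce
    then have "A ^ 2 = x ^ 2 \<and> B ^ 2 = (3 * y) ^ 2" using uniq y3[of A] by auto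
    then have e: "2 * (A ^ 2 - B ^ 2) = 4 * x ^ 2 - 2 * P" using xy by (simp add: power_mult_distrib)
    have "[(-3) ^ (p * m) = 1] (mod P ^ 2)" using tau_cong 1 by simp
    from cong_mult[OF this AB(3)] show ?thesis by (simp only: e mult_1_left)
  next
    case 2
    have f: "\<lfloor>- 1 :: real\<rfloor> = - 1" by (simp add: floor_eq_iff)
    have "3 dvd A ^ 2 - B ^ 2 + 1" using c3(1) 2 by (simp add: f)
    moreover have "t mod 3 \<noteq> 0" if "3 dvd s - t + 1" "(s + t) mod 3 = 1" for s t :: int
      using that by presburger
    ultimately have "\<not> 3 dvd B" using sq(2) AB3 by fastforce
    then have "A ^ 2 = (3 * y) ^ 2 \<and> B ^ 2 = x ^ 2" using uniq y3[of B] by auto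
    then have e: "-1 * (2 * (A ^ 2 - B ^ 2)) = 4 * x ^ 2 - 2 * P" using xy by (simp add: power_mult_distrib)
    have "[(-3) ^ (p * m) = -1] (mod P ^ 2)" using tau_cong 2 by simp
    from cong_mult[OF this AB(3)] show ?thesis by (simp only: e)
  next
    case 3
    then have "3 dvd A ^ 2 - B ^ 2" using c3(1) by auto
    moreover have "s mod 3 = 2" if "3 dvd s - t" "(s + t) mod 3 = 1" for s t :: int
      using that by presburger
    ultimately have "A ^ 2 mod 3 = 2" using AB3 by blast
    then have False using sq(1) by (simp split: if_splits)
    then show ?thesis ..
  qed
qed

text \<open>With x = a + b and 3y = a - b one has p = a^2 + b^2 and 2p - 2x^2 = -4ab. Uniqueness
  gives ab only up to sign; but a = b modulo 3 forces ab = 1 modulo 3, while 2AB is 1 or -1 modulo 3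
  according to the imaginary part of \<open>\<chi> (-3)\<close>, which settles the sign.\<close>

lemma value_5_mod_12:
  assumes xy: "2 * P = x ^ 2 + 9 * y ^ 2" and p12: "P mod 3 = 2"
  shows "[(-3) ^ (p * m) * U ^ 2 = 2 * P - 2 * x ^ 2] (mod P ^ 2)"
proof -
  obtain A B where AB: "J = Complex (of_int A) (of_int B)" "P = A ^ 2 + B ^ 2"
    "[U ^ 2 = 2 * (A ^ 2 - B ^ 2)] (mod P ^ 2)" "[U ^ 2 = 4 * (A * B) * \<iota>] (mod P ^ 2)"
    by (rule J_coords)
  note c3 = chi_minus_3_cases[OF AB(1)]
  have "even (x ^ 2 + 9 * y ^ 2)" using xy by (metis dvd_triv_left)
  then have "even (x + 3 * y)" by simp
  then obtain a where a: "x + 3 * y = 2 * a" by blast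
  define b where "b = a - 3 * y"
  have x: "x = a + b" and y: "a - b = 3 * y" using a by (simp_all add: b_def)
  have "2 * P = (a + b) ^ 2 + (a - b) ^ 2" using xy unfolding x y by (simp add: power_mult_distrib)
  then have Pab: "P = a ^ 2 + b ^ 2" by (simp add: algebra_simps power2_eq_square)
  have "(A ^ 2 = a ^ 2 \<and> B ^ 2 = b ^ 2) \<or> (A ^ 2 = b ^ 2 \<and> B ^ 2 = a ^ 2)"
    by (rule prime_two_squares_unique[OF prime_int_p AB(2) Pab])
  then have "(A * B) ^ 2 = (a * b) ^ 2" by (auto simp: power_mult_distrib)
  then have ab: "a * b = A * B \<or> a * b = - (A * B)" by (auto simp: power2_eq_iff)
  have target: "2 * P - 2 * x ^ 2 = -4 * (a * b)"
    unfolding x Pab by (simp add: algebra_simps power2_eq_square)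
  have ab1: "3 dvd a * b - 1"
  proof -
    have a': "a = b + 3 * y" using y by simp
    have "P = 2 * b ^ 2 + 3 * (2 * (b * y) + 3 * y ^ 2)"
      unfolding Pab a' by (simp add: algebra_simps power2_eq_square)
    moreover have "s mod 3 = 1" if "q = 2 * s + 3 * w" "q mod 3 = 2" for q s w :: int
      using that by presburger
    ultimately have "b ^ 2 mod 3 = 1" using p12 by blast
    moreover have "a * b = b ^ 2 + 3 * (y * b)"
      unfolding a' by (simp add: algebra_simps power2_eq_square)
    moreover have "3 dvd r - 1" if "s mod 3 = 1" "r = s + 3 * w" for r s w :: int
      using that by presburger
    ultimately show ?thesis by blast
  qed
  have iota4: "[\<iota> ^ 3 * (4 * (A * B) * \<iota>) = 4 * (A * B)] (mod P ^ 2)"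
  proof -
    have "[4 * (A * B) * (\<iota> ^ 2 * \<iota> ^ 2) = 4 * (A * B) * (-1 * -1)] (mod P ^ 2)"
      by (intro cong_mult cong_refl iota)
    then show ?thesis by (simp add: power2_eq_square power3_eq_cube mult_ac)
  qed
  have "\<chi> (-3) \<in> {1, -1, \<i>, -\<i>}" using chi_values[of "-3"] chi_minus_3_nonzero by auto
  then consider "\<chi> (-3) = 1 \<or> \<chi> (-3) = -1" | "\<chi> (-3) = \<i>" | "\<chi> (-3) = -\<i>" by auto
  then show ?thesis
  proof cases
    case 1
    then have "3 dvd 2 * (A * B)" using c3(2) by auto
    moreover have False if "3 dvd 2 * t" "s = t \<or> s = - t" "3 dvd s - 1" for s t :: int
      using that by presburger
    ultimately have False using ab ab1 by blast
    then show ?thesis ..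
  next
    case 2
    then have "3 dvd 2 * (A * B) - 1" using c3(2) by simp
    moreover have "s \<noteq> t" if "3 dvd 2 * t - 1" "3 dvd s - 1" for s t :: int
      using that by presburger
    ultimately have e: "a * b = - (A * B)" using ab ab1 by blast
    have "[(-3) ^ (p * m) = \<iota> ^ 3] (mod P ^ 2)" using tau_cong 2 by simp
    from cong_trans[OF cong_mult[OF this AB(4)] iota4] show ?thesis
      unfolding target e by simp
  next
    case 3
    have f: "\<lfloor>- 1 :: real\<rfloor> = - 1" by (simp add: floor_eq_iff)
    have "3 dvd 2 * (A * B) + 1" using c3(2) 3 by (simp add: f)
    moreover have "s \<noteq> - t" if "3 dvd 2 * t + 1" "3 dvd s - 1" for s t :: int
      using that by presburger
    ultimately have e: "a * b = A * B" using ab ab1 by blast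
    have "[(-3) ^ (p * m) = - (\<iota> ^ 3)] (mod P ^ 2)" using tau_cong 3 by simp
    from cong_mult[OF this AB(4)]
    have "[(-3) ^ (p * m) * U ^ 2 = - (\<iota> ^ 3 * (4 * (A * B) * \<iota>))] (mod P ^ 2)" by simp
    also have "[- (\<iota> ^ 3 * (4 * (A * B) * \<iota>)) = - (4 * (A * B))] (mod P ^ 2)"
      using iota4 by (simp only: cong_minus_minus_iff)
    finally show ?thesis unfolding target e by simp
  qed
qed

end

theorem theorem5p3:
  fixes p :: nat
  assumes "prime p" and "[p = 1] (mod 4)"
  defines "S\<^sub>1 \<equiv> (\<Sum>n=0..p - 1. of_int (almkvist_zudilin n) / (-3) ^ n :: rat)"
    and "S\<^sub>2 \<equiv> (\<Sum>n=0..p - 1. of_int (almkvist_zudilin n) / (-27) ^ n :: rat)"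
  shows "cong_Z p S\<^sub>1 S\<^sub>2 (p ^ 2) \<and>
    (\<forall>x y :: int.
      ([p = 1] (mod 12) \<and> int p = x ^ 2 + 9 * y ^ 2
         \<longrightarrow> cong_Z p S\<^sub>2 (of_int (4 * x ^ 2 - 2 * int p)) (p ^ 2)) \<and>
      ([p = 5] (mod 12) \<and> 2 * int p = x ^ 2 + 9 * y ^ 2
         \<longrightarrow> cong_Z p S\<^sub>2 (of_int (2 * int p - 2 * x ^ 2)) (p ^ 2)))"
proof -
  define m where "m = p div 4"
  have "p mod 4 = 1" using assms(2) by (simp add: cong_def)
  then have "p = 4 * m + 1" unfolding m_def by presburger
  then interpret quartic_prime p m
    by unfold_locales (use assms(1) in auto)
  obtain \<iota> where iota: "[\<iota> ^ 2 = -1] (mod P ^ 2)" using exists_sqrt_minus_1 by blast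
  note iota1 = cong_square_modulus[OF iota]
  obtain g where g: "\<not> P dvd g" "\<And>k. [g ^ k = 1] (mod P) \<longleftrightarrow> 4 * m dvd k"
    using exists_generator by blast
  interpret quartic_char p m "quartic_symbol \<iota>" g
    by (rule quartic_char_symbol[OF iota1 g])
  interpret quartic_eval p m "quartic_symbol \<iota>" g \<iota>
    by unfold_locales (use iota quartic_symbol(2)[OF iota1] in auto)
  have "{0..p - 1} = {..<p}" using p_gt by auto
  \<comment> \<open>Both sums are congruent to one integer, so their mutual congruence and the two
    cases all follow from it; p-integrality of the sums is inherited through
    \<open>zcong_R\<close>.\<close>
  then have S: "zcong 2 S\<^sub>1 (of_int ((-3) ^ (p * m) * U ^ 2))" "zcong 2 S\<^sub>2 (of_int ((-3) ^ (p * m) * U ^ 2))"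
    unfolding S\<^sub>1_def S\<^sub>2_def U_def
    using sums_zcong_jacobi_value[OF J_eval] by simp_all
  have R: "S\<^sub>1 \<in> R" "S\<^sub>2 \<in> R"
    using S zcong_R R_of_int by blast+
  have fin: "cong_Z p S\<^sub>2 (of_int t) (p ^ 2)" if "[(-3) ^ (p * m) * U ^ 2 = t] (mod P ^ 2)" for t
    unfolding cong_Z_iff using R(2) zcong_trans[OF S(2) zcong_of_int[OF that]] by blast
  show ?thesis
  proof (intro conjI allI impI)
    show "cong_Z p S\<^sub>1 S\<^sub>2 (p ^ 2)"
      unfolding cong_Z_iff using R zcong_trans[OF S(1) zcong_sym[OF S(2)]] by blast
  next
    fix x y :: int
    assume a: "[p = 1] (mod 12) \<and> int p = x ^ 2 + 9 * y ^ 2"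
    then have "p mod 12 = 1" by (simp add: cong_def)
    then have "int p mod 3 = 1" by presburger
    then show "cong_Z p S\<^sub>2 (of_int (4 * x ^ 2 - 2 * int p)) (p ^ 2)"
      using a by (intro fin value_1_mod_12) auto
  next
    fix x y :: int
    assume a: "[p = 5] (mod 12) \<and> 2 * int p = x ^ 2 + 9 * y ^ 2"
    then have "p mod 12 = 5" by (simp add: cong_def)
    then have "int p mod 3 = 2" by presburger
    then show "cong_Z p S\<^sub>2 (of_int (2 * int p - 2 * x ^ 2)) (p ^ 2)"
      using a by (intro fin value_5_mod_12) auto
  qed
qed

end
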